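(* Let $R$ be a commutative ring and let $f\colon T\to T'$ be a proper map between two trees such that the induced map $\mathfrak F(f)\colon\mathfrak F(T)\to\mathfrak F(T')$ on spaces of Freudenthal ends is injective. Then the change of coefficients functor $\mathbb F^f_*\colon\mathbf{mod}(\mathbf M_R(T))\to\mathbf{mod}(\mathbf M_R(T'))$ is exact.
   Context: A tree is a contractible, locally compact $1$-dimensional CW-complex; all trees are non-compact. $\mathfrak F(T)=\lim_K\pi_0(T-K)$ ($K\subset T$ compact) is the space of Freudenthal ends and $\hat T=T\sqcup\mathfrak F(T)$ the Freudenthal compactification, in which basic neighbourhoods of an end are $W\sqcup W^{\mathfrak F}$ with $W$ the component of some $T-K$ determined by the end and $W^{\mathfrak F}$ the set of ends determining $W$. Proper maps induce maps on ends. A free $T$-controlled $R$-module $R\langle A\rangle_\alpha$ is the free $R$-module with basis a discrete set $A$ together with a proper map $\alpha\colon A\to T$. A controlled homomorphism $\varphi\colon R\langle A\rangle_\alpha\to R\langle B\rangle_\beta$ is an $R$-homomorphism $R\langle A\rangle\to R\langle B\rangle$ such that for every neighbourhood $U$ of an end $\varepsilon\in\mathfrak F(T)$ in $\hat T$ there is another neighbourhood $V\subset U$ of $\varepsilon$ with $\varphi(\alpha^{-1}(V))\subset R\langle\beta^{-1}(U)\rangle$. $\mathbf M_R(T)$ is the resulting small additive category. For a small additive category $\mathbf A$, $\mathbf{mod}(\mathbf A)$ is the abelian category of additive functors $\mathbf A^{op}\to\mathbf{Ab}$. The ``change of tree'' functor $\mathbb F^f\colon\mathbf M_R(T)\to\mathbf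 M_R(T')$ is $R\langle A\rangle_\alpha\mapsto R\langle A\rangle_{f\alpha}$, the identity on underlying homomorphisms, and $\mathbb F^f_*$ is the left adjoint of the functor $\mathbf{mod}(\mathbf M_R(T'))\to\mathbf{mod}(\mathbf M_R(T))$ given by precomposition with $\mathbb F^f$. *)

theory Defs
  imports "HOL-Analysis.Analysis" "HOL-Algebra.Exact_Sequence" "HOL-Algebra.Module"
begin

section \<open>Trees\<close>

text \<open>
  Whitehead's description of a CW-structure, for complexes of dimension one: \<open>V\<close> is the 0-skeleton
  and \<open>E\<close> is the set of characteristic maps of the 1-cells. The maps in \<open>E\<close> may serve as their own
  indices because distinct 1-cells are disjoint and nonempty. The last clause is the weak
  topology. (Closure finiteness is the condition on the end points.)
\<close>

definition cw_complex_1_on :: "'a topology \<Rightarrow> 'a set \<Rightarrow> (real \<Rightarrow> 'a) set \<Rightarrow> bool" where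
  "cw_complex_1_on X V E \<longleftrightarrow>
     Hausdorff_space X \<and> V \<subseteq> topspace X \<and> E \<noteq> {} \<and>
     (\<forall>e\<in>E. continuous_map (top_of_set {0..1}) X e \<and>
            embedding_map (top_of_set {0<..<1}) X e \<and>
            e 0 \<in> V \<and> e 1 \<in> V \<and> e ` {0<..<1} \<inter> V = {}) \<and>
     (\<forall>d\<in>E. \<forall>e\<in>E. d \<noteq> e \<longrightarrow> d ` {0<..<1} \<inter> e ` {0<..<1} = {}) \<and>
     topspace X = V \<union> (\<Union>e\<in>E. e ` {0<..<1}) \<and>
     (\<forall>C. C \<subseteq> topspace X \<longrightarrow>
        (closedin X C \<longleftrightarrow> (\<forall>e\<in>E. closedin X (C \<inter> e ` {0..1}))))"

definition cw_complex_1 :: "'a topology \<Rightarrow> bool" where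
  "cw_complex_1 X \<longleftrightarrow> (\<exists>V E. cw_complex_1_on X V E)"

definition tree :: "'a topology \<Rightarrow> bool" where
  "tree T \<longleftrightarrow> cw_complex_1 T \<and> contractible_space T \<and> locally_compact_space T \<and> \<not> compact_space T"

text \<open>The library's proper maps need not be continuous.\<close>

definition proper_cont :: "'a topology \<Rightarrow> 'b topology \<Rightarrow> ('a \<Rightarrow> 'b) \<Rightarrow> bool" where
  "proper_cont X Y f \<longleftrightarrow> continuous_map X Y f \<and> proper_map X Y f"


section \<open>Freudenthal ends\<close>

definition pi0_compl :: "'a topology \<Rightarrow> 'a set \<Rightarrow> 'a set set" where
  "pi0_compl T K = path_components_of (subtopology T (topspace T - K))"

text \<open>
  The inverse limit of the sets \<open>pi0_compl T K\<close>: for \<open>K \<subseteq> L\<close> the transition map sends a component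
  of \<open>T - L\<close> to the component of \<open>T - K\<close> containing it.
\<close>

definition ends :: "'a topology \<Rightarrow> ('a set \<Rightarrow> 'a set) set" where
  "ends T = {\<epsilon> \<in> (\<Pi>\<^sub>E K\<in>{K. compactin T K}. pi0_compl T K).
      \<forall>K L. compactin T K \<longrightarrow> compactin T L \<longrightarrow> K \<subseteq> L \<longrightarrow> \<epsilon> L \<subseteq> \<epsilon> K}"

definition ends_map ::
    "'a topology \<Rightarrow> 'c topology \<Rightarrow> ('a \<Rightarrow> 'c) \<Rightarrow> ('a set \<Rightarrow> 'a set) \<Rightarrow> ('c set \<Rightarrow> 'c set)" where
  "ends_map T T' f \<epsilon> =
     (\<lambda>K\<in>{K. compactin T' K}. THE W. W \<in> pi0_compl T' K \<and> f ` \<epsilon> {x \<in> topspace T. f x \<in> K} \<subseteq> W)"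

text \<open>The Freudenthal compactification; \<open>Inl\<close> marks points of \<open>T\<close> and \<open>Inr\<close> marks ends.\<close>

definition freudenthal :: "'a topology \<Rightarrow> ('a + ('a set \<Rightarrow> 'a set)) topology" where
  "freudenthal T = topology_generated_by
     ({Inl ` U |U. openin T U} \<union>
      {Inl ` W \<union> Inr ` {\<epsilon> \<in> ends T. \<epsilon> K = W} |K W. compactin T K \<and> W \<in> pi0_compl T K})"

definition nbhd :: "'a topology \<Rightarrow> 'a \<Rightarrow> 'a set \<Rightarrow> bool" where
  "nbhd X x U \<longleftrightarrow> U \<subseteq> topspace X \<and> (\<exists>N. openin X N \<and> x \<in> N \<and> N \<subseteq> U)"


section \<open>Categories and functors\<close>

text \<open>
  \<open>Comp C X Y Z g f\<close> is the composite of \<open>f: X \<rightarrow> Y\<close> and \<open>g: Y \<rightarrow> Z\<close>. Hom-sets of different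
  pairs of objects need not be disjoint, which is why the operations take the objects as arguments.
\<close>

record ('o, 'm) cat =
  Ob :: "'o set"
  Hom :: "'o \<Rightarrow> 'o \<Rightarrow> 'm set"
  Ident :: "'o \<Rightarrow> 'm"
  Comp :: "'o \<Rightarrow> 'o \<Rightarrow> 'o \<Rightarrow> 'm \<Rightarrow> 'm \<Rightarrow> 'm"

record ('o, 'm) preadd_cat = "('o, 'm) cat" +
  Add :: "'o \<Rightarrow> 'o \<Rightarrow> 'm \<Rightarrow> 'm \<Rightarrow> 'm"

record ('o, 'm, 'p, 'n) functor_data =
  on_ob :: "'o \<Rightarrow> 'p"
  on_hom :: "'o \<Rightarrow> 'o \<Rightarrow> 'm \<Rightarrow> 'n"

definition is_functor ::
    "('o, 'm, 'x) cat_scheme \<Rightarrow> ('p, 'n, 'y) cat_scheme \<Rightarrow> ('o, 'm, 'p, 'n) functor_data \<Rightarrow> bool" where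
  "is_functor C D F \<longleftrightarrow>
     (\<forall>X\<in>Ob C. on_ob F X \<in> Ob D) \<and>
     (\<forall>X\<in>Ob C. \<forall>Y\<in>Ob C. \<forall>u\<in>Hom C X Y. on_hom F X Y u \<in> Hom D (on_ob F X) (on_ob F Y)) \<and>
     (\<forall>X\<in>Ob C. on_hom F X X (Ident C X) = Ident D (on_ob F X)) \<and>
     (\<forall>X\<in>Ob C. \<forall>Y\<in>Ob C. \<forall>Z\<in>Ob C. \<forall>u\<in>Hom C X Y. \<forall>v\<in>Hom C Y Z.
        on_hom F X Z (Comp C X Y Z v u) =
        Comp D (on_ob F X) (on_ob F Y) (on_ob F Z) (on_hom F Y Z v) (on_hom F X Y u))"

text \<open>\<open>L\<close> is left adjoint to \<open>G\<close>: there is a natural bijection \<open>Hom(L X, Y) \<rightarrow> Hom(X, G Y)\<close>.\<close>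

definition left_adjoint ::
    "('o, 'm, 'x) cat_scheme \<Rightarrow> ('p, 'n, 'y) cat_scheme \<Rightarrow>
     ('o, 'm, 'p, 'n) functor_data \<Rightarrow> ('p, 'n, 'o, 'm) functor_data \<Rightarrow> bool" where
  "left_adjoint C D L G \<longleftrightarrow> is_functor C D L \<and> is_functor D C G \<and>
     (\<exists>\<Phi>. (\<forall>X\<in>Ob C. \<forall>Y\<in>Ob D. bij_betw (\<Phi> X Y) (Hom D (on_ob L X) Y) (Hom C X (on_ob G Y))) \<and>
       (\<forall>X'\<in>Ob C. \<forall>X\<in>Ob C. \<forall>Y\<in>Ob D. \<forall>Y'\<in>Ob D.
         \<forall>u\<in>Hom C X' X. \<forall>h\<in>Hom D (on_ob L X) Y. \<forall>v\<in>Hom D Y Y'.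
           \<Phi> X' Y' (Comp D (on_ob L X') Y Y' v
                      (Comp D (on_ob L X') (on_ob L X) Y h (on_hom L X' X u))) =
           Comp C X' (on_ob G Y) (on_ob G Y') (on_hom G Y Y' v)
                      (Comp C X' X (on_ob G Y) (\<Phi> X Y h) u)))"


section \<open>The category of controlled modules\<close>

text \<open>
  The free module on \<open>A\<close>, realised as the finitely supported functions vanishing outside \<open>A\<close>.
  The multiplicative part of the \<^typ>\<open>('r, 'm) module\<close> record is irrelevant.
\<close>

definition free_mod :: "'r ring \<Rightarrow> 'b set \<Rightarrow> ('r, 'b \<Rightarrow> 'r) module" where
  "free_mod R A =
    \<lparr>carrier = {v. (\<forall>b. v b \<in> carrier R) \<and> (\<forall>b. b \<notin> A \<longrightarrow> v b = \<zero>\<^bsub>R\<^esub>) \<and> finite {b. v b \<noteq> \<zero>\<^bsub>R\<^esub>}},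
     mult = undefined, one = undefined,
     zero = (\<lambda>b. \<zero>\<^bsub>R\<^esub>),
     add = (\<lambda>v w b. v b \<oplus>\<^bsub>R\<^esub> w b),
     smult = (\<lambda>r v b. r \<otimes>\<^bsub>R\<^esub> v b)\<rparr>"

definition basis_vec :: "'r ring \<Rightarrow> 'b \<Rightarrow> 'b \<Rightarrow> 'r" where
  "basis_vec R a = (\<lambda>b. if b = a then \<one>\<^bsub>R\<^esub> else \<zero>\<^bsub>R\<^esub>)"

definition linear_maps :: "'r ring \<Rightarrow> ('r, 'm) module \<Rightarrow> ('r, 'n) module \<Rightarrow> ('m \<Rightarrow> 'n) set" where
  "linear_maps R M N = {h \<in> carrier M \<rightarrow>\<^sub>E carrier N.
     (\<forall>x\<in>carrier M. \<forall>y\<in>carrier M. h (x \<oplus>\<^bsub>M\<^esub> y) = h x \<oplus>\<^bsub>N\<^esub> h y) \<and>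
     (\<forall>r\<in>carrier R. \<forall>x\<in>carrier M. h (r \<odot>\<^bsub>M\<^esub> x) = r \<odot>\<^bsub>N\<^esub> h x)}"

text \<open>
  \<open>'b\<close> is the universe from which the bases \<open>A\<close> are taken. A basis of a controlled module over a
  tree is countable, so that every infinite \<open>'b\<close> yields the same category up to equivalence.
\<close>

definition ctrl_ob :: "'a topology \<Rightarrow> ('b set \<times> ('b \<Rightarrow> 'a)) set" where
  "ctrl_ob T = {(A, \<alpha>). \<alpha> \<in> extensional A \<and> proper_cont (discrete_topology A) T \<alpha>}"

definition ctrl_hom :: "'r ring \<Rightarrow> 'a topology \<Rightarrow> 'b set \<times> ('b \<Rightarrow> 'a) \<Rightarrow> 'b set \<times> ('b \<Rightarrow> 'a) \<Rightarrow>
    (('b \<Rightarrow> 'r) \<Rightarrow> ('b \<Rightarrow> 'r)) set" where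
  "ctrl_hom R T = (\<lambda>(A, \<alpha>) (B, \<beta>). {\<phi> \<in> linear_maps R (free_mod R A) (free_mod R B).
     \<forall>\<epsilon>\<in>ends T. \<forall>U. nbhd (freudenthal T) (Inr \<epsilon>) U \<longrightarrow>
       (\<exists>V\<subseteq>U. nbhd (freudenthal T) (Inr \<epsilon>) V \<and>
         (\<forall>a\<in>A. Inl (\<alpha> a) \<in> V \<longrightarrow>
            \<phi> (basis_vec R a) \<in> carrier (free_mod R {b \<in> B. Inl (\<beta> b) \<in> U})))})"

definition ctrl_cat :: "'r ring \<Rightarrow> 'a topology \<Rightarrow>
    ('b set \<times> ('b \<Rightarrow> 'a), ('b \<Rightarrow> 'r) \<Rightarrow> ('b \<Rightarrow> 'r)) preadd_cat" where
  "ctrl_cat R T =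
    \<lparr>Ob = ctrl_ob T,
     Hom = ctrl_hom R T,
     Ident = (\<lambda>(A, \<alpha>). \<lambda>v\<in>carrier (free_mod R A). v),
     Comp = (\<lambda>(A, \<alpha>) _ _ \<psi> \<phi>. compose (carrier (free_mod R A)) \<psi> \<phi>),
     Add = (\<lambda>(A, \<alpha>) (B, \<beta>) \<phi> \<psi>. \<lambda>v\<in>carrier (free_mod R A). \<phi> v \<oplus>\<^bsub>free_mod R B\<^esub> \<psi> v)\<rparr>"

definition change_of_tree :: "('a \<Rightarrow> 'c) \<Rightarrow>
    ('b set \<times> ('b \<Rightarrow> 'a), ('b \<Rightarrow> 'r) \<Rightarrow> ('b \<Rightarrow> 'r),
     'b set \<times> ('b \<Rightarrow> 'c), ('b \<Rightarrow> 'r) \<Rightarrow> ('b \<Rightarrow> 'r)) functor_data" where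
  "change_of_tree f =
    \<lparr>on_ob = (\<lambda>(A, \<alpha>). (A, compose A f \<alpha>)), on_hom = (\<lambda>_ _ \<phi>. \<phi>)\<rparr>"


section \<open>Modules over a small additive category\<close>

text \<open>
  An additive functor from the opposite of a preadditive category to abelian groups; the
  latter are the library's commutative groups, hence are written multiplicatively.
  \<open>act M X Y u\<close> is the map \<open>M Y \<rightarrow> M X\<close> induced by \<open>u: X \<rightarrow> Y\<close>; only its values on the carrier
  of \<open>M Y\<close> matter.
\<close>

record ('o, 'm, 'g) cmod =
  grp :: "'o \<Rightarrow> 'g monoid"
  act :: "'o \<Rightarrow> 'o \<Rightarrow> 'm \<Rightarrow> 'g \<Rightarrow> 'g"

definition cmodule :: "('o, 'm) preadd_cat \<Rightarrow> ('o, 'm, 'g) cmod \<Rightarrow> bool" where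
  "cmodule C M \<longleftrightarrow>
     (\<forall>X\<in>Ob C. comm_group (grp M X)) \<and>
     (\<forall>X\<in>Ob C. \<forall>Y\<in>Ob C. \<forall>u\<in>Hom C X Y. act M X Y u \<in> hom (grp M Y) (grp M X)) \<and>
     (\<forall>X\<in>Ob C. \<forall>m\<in>carrier (grp M X). act M X X (Ident C X) m = m) \<and>
     (\<forall>X\<in>Ob C. \<forall>Y\<in>Ob C. \<forall>Z\<in>Ob C. \<forall>u\<in>Hom C X Y. \<forall>v\<in>Hom C Y Z. \<forall>m\<in>carrier (grp M Z).
        act M X Z (Comp C X Y Z v u) m = act M X Y u (act M Y Z v m)) \<and>
     (\<forall>X\<in>Ob C. \<forall>Y\<in>Ob C. \<forall>u\<in>Hom C X Y. \<forall>v\<in>Hom C X Y. \<forall>m\<in>carrier (grp M Y).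
        act M X Y (Add C X Y u v) m = act M X Y u m \<otimes>\<^bsub>grp M X\<^esub> act M X Y v m)"

definition nat_trans ::
    "('o, 'm) preadd_cat \<Rightarrow> ('o, 'm, 'g) cmod \<Rightarrow> ('o, 'm, 'g) cmod \<Rightarrow> ('o \<Rightarrow> 'g \<Rightarrow> 'g) set" where
  "nat_trans C M N =
    {\<eta> \<in> (\<Pi>\<^sub>E X\<in>Ob C. hom (grp M X) (grp N X) \<inter> extensional (carrier (grp M X))).
       \<forall>X\<in>Ob C. \<forall>Y\<in>Ob C. \<forall>u\<in>Hom C X Y. \<forall>m\<in>carrier (grp M Y).
         \<eta> X (act M X Y u m) = act N X Y u (\<eta> Y m)}"

text \<open>\<open>mod(C)\<close>, with values in the abelian groups whose carriers lie in the universe \<open>'g\<close>.\<close>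

definition mod_cat :: "('o, 'm) preadd_cat \<Rightarrow> (('o, 'm, 'g) cmod, 'o \<Rightarrow> 'g \<Rightarrow> 'g) cat" where
  "mod_cat C =
    \<lparr>Ob = {M. cmodule C M},
     Hom = nat_trans C,
     Ident = (\<lambda>M. \<lambda>X\<in>Ob C. \<lambda>m\<in>carrier (grp M X). m),
     Comp = (\<lambda>M N P \<theta> \<eta>. \<lambda>X\<in>Ob C. compose (carrier (grp M X)) (\<theta> X) (\<eta> X))\<rparr>"

definition precomp :: "('o, 'm) preadd_cat \<Rightarrow> ('o, 'm, 'p, 'n) functor_data \<Rightarrow>
    (('p, 'n, 'g) cmod, 'p \<Rightarrow> 'g \<Rightarrow> 'g, ('o, 'm, 'g) cmod, 'o \<Rightarrow> 'g \<Rightarrow> 'g) functor_data" where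
  "precomp C F =
    \<lparr>on_ob = (\<lambda>N. \<lparr>grp = (\<lambda>X. grp N (on_ob F X)),
                  act = (\<lambda>X Y u. act N (on_ob F X) (on_ob F Y) (on_hom F X Y u))\<rparr>),
     on_hom = (\<lambda>_ _ \<eta>. \<lambda>X\<in>Ob C. \<eta> (on_ob F X))\<rparr>"

text \<open>
  Smallness relative to a universe. If the source and target categories are small relative to an
  infinite \<open>'g\<close>, then left Kan extensions of \<open>'g\<close>-valued modules are again \<open>'g\<close>-valued up to
  isomorphism, since their values are generated by at most \<open>|'g|\<close> elements.
  The left adjoint of \<^const>\<open>precomp\<close> over \<open>'g\<close> is thus the restriction of the one defined on all
  modules. (For categories of controlled modules over a tree with infinite \<open>'b\<close>, smallness forces
  \<open>'g\<close> to be infinite.)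
\<close>

definition small_in :: "'g set \<Rightarrow> ('o, 'm, 'x) cat_scheme \<Rightarrow> bool" where
  "small_in U C \<longleftrightarrow> Ob C \<lesssim> U \<and> (\<forall>X\<in>Ob C. \<forall>Y\<in>Ob C. Hom C X Y \<lesssim> U)"

text \<open>
  Kernels, images and cokernels in \<open>mod(C)\<close> are computed objectwise. In the library's convention
  the arguments of \<^const>\<open>short_exact_sequence\<close> run from right to left.
\<close>

definition short_exact :: "('o, 'm) preadd_cat \<Rightarrow> ('o, 'm, 'g) cmod \<Rightarrow> ('o, 'm, 'g) cmod \<Rightarrow>
    ('o, 'm, 'g) cmod \<Rightarrow> ('o \<Rightarrow> 'g \<Rightarrow> 'g) \<Rightarrow> ('o \<Rightarrow> 'g \<Rightarrow> 'g) \<Rightarrow> bool" where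
  "short_exact C M N P i p \<longleftrightarrow>
     cmodule C M \<and> cmodule C N \<and> cmodule C P \<and> i \<in> nat_trans C M N \<and> p \<in> nat_trans C N P \<and>
     (\<forall>X\<in>Ob C. short_exact_sequence (grp P X) (grp N X) (grp M X) (p X) (i X))"

definition exact_functor :: "('o, 'm) preadd_cat \<Rightarrow> ('p, 'n) preadd_cat \<Rightarrow>
    (('o, 'm, 'g) cmod, 'o \<Rightarrow> 'g \<Rightarrow> 'g, ('p, 'n, 'g) cmod, 'p \<Rightarrow> 'g \<Rightarrow> 'g) functor_data \<Rightarrow> bool" where
  "exact_functor C D L \<longleftrightarrow> (\<forall>M N P i p. short_exact C M N P i p \<longrightarrow>
     short_exact D (on_ob L M) (on_ob L N) (on_ob L P) (on_hom L M N i) (on_hom L N P p))"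

end

theory Submission
  imports Defs "HOL-Algebra.Product_Groups" "HOL-Library.Equipollence"
begin

text \<open>
  As the Freudenthal compactification is compact and \<open>f\<close> is injective on ends, every neighbourhood
  of an end \<open>\<epsilon>\<close> of \<open>T\<close> contains the preimage of a neighbourhood of the image of \<open>\<epsilon>\<close>; hence the
  change of tree functor is fully faithful. Moreover a map from a \<open>T'\<close>-controlled module
  \<open>R\<langle>A\<rangle>\<^sub>\<alpha>\<close> to a module coming from \<open>T\<close> is supported on a set \<open>A\<^sub>0\<close> of basis elements that
  accumulate only at ends in the image of \<open>T\<close>. These elements can be moved into \<open>f(T)\<close> by an amount
  that is negligible near the ends, so \<open>R\<langle>A\<^sub>0\<rangle>\<close> is isomorphic to a module coming from \<open>T\<close>. Thus
  every value \<open>(L M)(X')\<close> of the left adjoint is the directed union of the groups \<open>M(X)\<close>, where \<open>X\<close>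
  runs over the direct summands of \<open>X'\<close> that come from \<open>T\<close>, and exactness of \<open>L\<close> follows.
\<close>

section \<open>Modules over preadditive categories\<close>

text \<open>The obstacle is that \<open>L\<close> is given only through an abstract adjunction, over
  modules with values in \<open>'g\<close>, so no colimit formula for \<open>L M X'\<close> is at
  hand. Two consequences of the universal property replace it. The unit generates
  \<open>L M\<close>, since the identity of \<open>L M\<close> factors through the submodule that it
  generates. The unit is injective, since \<open>M\<close> embeds into the restriction of some
  module over the larger category; as such a module the image of the left in the right Kan extension
  is convenient, because its elements are plain functions and no quotients have to be formed.

  The retractions are what makes kernels visible: if y is the pullback of m along p and s is a
  section of p, then pulling y back along s returns m, so y vanishes only if m does. Factoring two
  maps through the same retract is needed to add elements that come from different objects.

  On the topological side compactness is used in sequential form: infinitely many points leaving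
  every compact set accumulate at an end. Every claim about control is then proved by letting
  counterexamples accumulate.\<close>

lemma mod_cat_simps [simp]:
  "Ob (mod_cat C) = {M. cmodule C M}"
  "Hom (mod_cat C) = nat_trans C"
  "Ident (mod_cat C) = (\<lambda>M. \<lambda>X\<in>Ob C. \<lambda>m\<in>carrier (grp M X). m)"
  "Comp (mod_cat C) M N P \<theta> \<eta> = (\<lambda>X\<in>Ob C. compose (carrier (grp M X)) (\<theta> X) (\<eta> X))"
  by (simp_all add: mod_cat_def)

lemma cmodule_comm_group: "cmodule C M \<Longrightarrow> X \<in> Ob C \<Longrightarrow> comm_group (grp M X)"
  by (simp add: cmodule_def)

lemma cmodule_group: "cmodule C M \<Longrightarrow> X \<in> Ob C \<Longrightarrow> group (grp M X)"
  by (simp add: cmodule_def comm_group_def)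

lemma cmodule_act_hom:
  "cmodule C M \<Longrightarrow> X \<in> Ob C \<Longrightarrow> Y \<in> Ob C \<Longrightarrow> u \<in> Hom C X Y \<Longrightarrow>
    act M X Y u \<in> hom (grp M Y) (grp M X)"
  by (simp add: cmodule_def)

lemma cmodule_act_closed:
  "cmodule C M \<Longrightarrow> X \<in> Ob C \<Longrightarrow> Y \<in> Ob C \<Longrightarrow> u \<in> Hom C X Y \<Longrightarrow> m \<in> carrier (grp M Y) \<Longrightarrow>
    act M X Y u m \<in> carrier (grp M X)"
  by (meson cmodule_act_hom hom_in_carrier)

lemma cmodule_act_mult:
  "cmodule C M \<Longrightarrow> X \<in> Ob C \<Longrightarrow> Y \<in> Ob C \<Longrightarrow> u \<in> Hom C X Y \<Longrightarrow>
    m \<in> carrier (grp M Y) \<Longrightarrow> n \<in> carrier (grp M Y) \<Longrightarrow>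
    act M X Y u (m \<otimes>\<^bsub>grp M Y\<^esub> n) = act M X Y u m \<otimes>\<^bsub>grp M X\<^esub> act M X Y u n"
  by (meson cmodule_act_hom hom_mult)

lemma cmodule_act_group_hom:
  assumes "cmodule C M" "X \<in> Ob C" "Y \<in> Ob C" "u \<in> Hom C X Y"
  shows "group_hom (grp M Y) (grp M X) (act M X Y u)"
  using assms by (simp add: group_hom_def group_hom_axioms_def cmodule_group cmodule_act_hom)

lemma cmodule_act_Ident:
  "cmodule C M \<Longrightarrow> X \<in> Ob C \<Longrightarrow> m \<in> carrier (grp M X) \<Longrightarrow> act M X X (Ident C X) m = m"
  by (simp add: cmodule_def)

lemma cmodule_act_Comp:
  "cmodule C M \<Longrightarrow> X \<in> Ob C \<Longrightarrow> Y \<in> Ob C \<Longrightarrow> Z \<in> Ob C \<Longrightarrow> u \<in> Hom C X Y \<Longrightarrow> v \<in> Hom C Y Z \<Longrightarrow>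
    m \<in> carrier (grp M Z) \<Longrightarrow> act M X Z (Comp C X Y Z v u) m = act M X Y u (act M Y Z v m)"
  unfolding cmodule_def by blast

lemma cmodule_act_Add:
  "cmodule C M \<Longrightarrow> X \<in> Ob C \<Longrightarrow> Y \<in> Ob C \<Longrightarrow> u \<in> Hom C X Y \<Longrightarrow> v \<in> Hom C X Y \<Longrightarrow>
    m \<in> carrier (grp M Y) \<Longrightarrow>
    act M X Y (Add C X Y u v) m = act M X Y u m \<otimes>\<^bsub>grp M X\<^esub> act M X Y v m"
  unfolding cmodule_def by blast

lemma nat_trans_hom: "\<eta> \<in> nat_trans C M N \<Longrightarrow> X \<in> Ob C \<Longrightarrow> \<eta> X \<in> hom (grp M X) (grp N X)"
  by (auto simp: nat_trans_def PiE_def Pi_def)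

lemma nat_trans_closed:
  "\<eta> \<in> nat_trans C M N \<Longrightarrow> X \<in> Ob C \<Longrightarrow> m \<in> carrier (grp M X) \<Longrightarrow> \<eta> X m \<in> carrier (grp N X)"
  by (meson nat_trans_hom hom_in_carrier)

lemma nat_trans_natural:
  "\<eta> \<in> nat_trans C M N \<Longrightarrow> X \<in> Ob C \<Longrightarrow> Y \<in> Ob C \<Longrightarrow> u \<in> Hom C X Y \<Longrightarrow> m \<in> carrier (grp M Y) \<Longrightarrow>
    \<eta> X (act M X Y u m) = act N X Y u (\<eta> Y m)"
  by (auto simp: nat_trans_def)

lemma nat_trans_group_hom:
  assumes "\<eta> \<in> nat_trans C M N" "cmodule C M" "cmodule C N" "X \<in> Ob C"
  shows "group_hom (grp M X) (grp N X) (\<eta> X)"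
  using assms by (simp add: group_hom_def group_hom_axioms_def cmodule_group nat_trans_hom)

text \<open>Morphisms of \<open>mod_cat\<close> are extensional both in the object and in the group
  element, so a family given by a formula has to be restricted twice. Since the action of
  \<open>M\<close> stays in the carriers, the restriction does not disturb naturality.\<close>

lemma nat_transI:
  assumes "\<And>X. X \<in> Ob C \<Longrightarrow> \<eta> X \<in> hom (grp M X) (grp N X)"
    and "\<And>X Y u m. \<lbrakk>X \<in> Ob C; Y \<in> Ob C; u \<in> Hom C X Y; m \<in> carrier (grp M Y);
            act M X Y u m \<in> carrier (grp M X)\<rbrakk> \<Longrightarrow> \<eta> X (act M X Y u m) = act N X Y u (\<eta> Y m)"
    and M: "cmodule C M"
  shows "(\<lambda>X\<in>Ob C. \<lambda>m\<in>carrier (grp M X). \<eta> X m) \<in> nat_trans C M N"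
proof -
  have "(\<lambda>m\<in>carrier (grp M X). \<eta> X m) \<in> hom (grp M X) (grp N X)" if "X \<in> Ob C" for X
    using assms(1)[OF that] group.is_monoid[OF cmodule_group[OF M that]]
    by (simp add: hom_def Pi_def monoid.m_closed)
  then show ?thesis
    using assms(2) cmodule_act_closed[OF M] by (auto simp: nat_trans_def)
qed

lemma nat_trans_eqI:
  assumes "\<eta> \<in> nat_trans C M N" "\<theta> \<in> nat_trans C M N'"
    and "\<And>X m. \<lbrakk>X \<in> Ob C; m \<in> carrier (grp M X)\<rbrakk> \<Longrightarrow> \<eta> X m = \<theta> X m"
  shows "\<eta> = \<theta>"
proof (rule extensionalityI[of _ "Ob C"])
  show "\<eta> X = \<theta> X" if "X \<in> Ob C" for X
    by (rule extensionalityI[of _ "carrier (grp M X)"])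
      (use assms that in \<open>auto simp: nat_trans_def PiE_iff\<close>)
qed (use assms in \<open>auto simp: nat_trans_def PiE_def\<close>)

lemma Ident_nat_trans:
  assumes "cmodule C M"
  shows "Ident (mod_cat C) M \<in> nat_trans C M M"
  using nat_transI[OF _ _ assms, where \<eta> = "\<lambda>_ m. m"] by (simp add: hom_def)

lemma Comp_nat_trans:
  assumes "cmodule C M" "\<eta> \<in> nat_trans C M N" "\<theta> \<in> nat_trans C N P"
  shows "Comp (mod_cat C) M N P \<theta> \<eta> \<in> nat_trans C M P"
proof -
  have "(\<lambda>X\<in>Ob C. \<lambda>m\<in>carrier (grp M X). \<theta> X (\<eta> X m)) \<in> nat_trans C M P"
    by (rule nat_transI[OF _ _ assms(1)])
      (use nat_trans_hom[OF assms(2)] nat_trans_hom[OF assms(3)] in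
        \<open>auto simp: hom_def Pi_iff nat_trans_natural[OF assms(2)] nat_trans_natural[OF assms(3)]\<close>)
  then show ?thesis
    by (simp add: compose_def)
qed

lemma mod_Comp_Ident_left:
  assumes "cmodule C M" "cmodule C N" "\<eta> \<in> nat_trans C M N"
  shows "Comp (mod_cat C) M N N (Ident (mod_cat C) N) \<eta> = \<eta>"
  by (rule nat_trans_eqI[OF Comp_nat_trans[OF assms(1,3) Ident_nat_trans[OF assms(2)]] assms(3)])
    (simp add: compose_def nat_trans_closed[OF assms(3)])

lemma mod_Comp_Ident_right:
  assumes "cmodule C M" "\<eta> \<in> nat_trans C M N"
  shows "Comp (mod_cat C) M M N \<eta> (Ident (mod_cat C) M) = \<eta>"
  by (rule nat_trans_eqI[OF Comp_nat_trans[OF assms(1) Ident_nat_trans[OF assms(1)] assms(2)] assms(2)])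
    (simp add: compose_def)

lemma short_exactI:
  assumes "cmodule C M" "cmodule C N" "cmodule C P" "i \<in> nat_trans C M N" "p \<in> nat_trans C N P"
    and "\<And>X. X \<in> Ob C \<Longrightarrow> inj_on (i X) (carrier (grp M X))"
    and "\<And>X. X \<in> Ob C \<Longrightarrow> p X ` carrier (grp N X) = carrier (grp P X)"
    and "\<And>X. X \<in> Ob C \<Longrightarrow> kernel (grp N X) (grp P X) (p X) = i X ` carrier (grp M X)"
  shows "short_exact C M N P i p"
  using assms unfolding short_exact_def short_exact_sequence_iff
  by (auto simp: group_hom_def group_hom_axioms_def cmodule_group nat_trans_hom
      epi_def mon_def intro!: exact_seq.intros)

lemma short_exactD:
  assumes "short_exact C M N P i p"
  shows "cmodule C M" "cmodule C N" "cmodule C P" "i \<in> nat_trans C M N" "p \<in> nat_trans C N P"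
    and "\<And>X. X \<in> Ob C \<Longrightarrow> inj_on (i X) (carrier (grp M X))"
    and "\<And>X. X \<in> Ob C \<Longrightarrow> p X ` carrier (grp N X) = carrier (grp P X)"
    and "\<And>X. X \<in> Ob C \<Longrightarrow> kernel (grp N X) (grp P X) (p X) = i X ` carrier (grp M X)"
proof -
  have *: "short_exact_sequence (grp P X) (grp N X) (grp M X) (p X) (i X)" if "X \<in> Ob C" for X
    using assms that by (simp add: short_exact_def)
  show "\<And>X. X \<in> Ob C \<Longrightarrow> inj_on (i X) (carrier (grp M X))"
    and "\<And>X. X \<in> Ob C \<Longrightarrow> p X ` carrier (grp N X) = carrier (grp P X)"
    using * unfolding short_exact_sequence_iff by (auto simp: epi_def mon_def)
  show "\<And>X. X \<in> Ob C \<Longrightarrow> kernel (grp N X) (grp P X) (p X) = i X ` carrier (grp M X)"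
    using * unfolding short_exact_sequence_iff
    by (auto elim: exact_seq.cases)
qed (use assms in \<open>auto simp: short_exact_def\<close>)

section \<open>Submodules, products and transport of structure\<close>

definition submod :: "('o, 'm, 'g) cmod \<Rightarrow> ('o \<Rightarrow> 'g set) \<Rightarrow> ('o, 'm, 'g) cmod" where
  "submod N S = \<lparr>grp = (\<lambda>X. (grp N X)\<lparr>carrier := S X\<rparr>), act = act N\<rparr>"

lemma submod_simps [simp]:
  "carrier (grp (submod N S) X) = S X"
  "mult (grp (submod N S) X) = mult (grp N X)"
  "one (grp (submod N S) X) = one (grp N X)"
  "act (submod N S) = act N"
  "grp (submod N S) X = (grp N X)\<lparr>carrier := S X\<rparr>"
  by (simp_all add: submod_def)

lemma cmodule_submod:
  assumes N: "cmodule C N" and S: "\<And>X. X \<in> Ob C \<Longrightarrow> subgroup (S X) (grp N X)"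
    and act: "\<And>X Y u y. \<lbrakk>X \<in> Ob C; Y \<in> Ob C; u \<in> Hom C X Y; y \<in> S Y\<rbrakk> \<Longrightarrow> act N X Y u y \<in> S X"
  shows "cmodule C (submod N S)"
proof -
  have sub: "y \<in> carrier (grp N X)" if "X \<in> Ob C" "y \<in> S X" for X y
    using subgroup.mem_carrier[OF S] that by blast
  have "comm_group ((grp N X)\<lparr>carrier := S X\<rparr>)" if "X \<in> Ob C" for X
  proof (rule group.group_comm_groupI)
    show "group ((grp N X)\<lparr>carrier := S X\<rparr>)"
      using group.subgroup_imp_group[OF cmodule_group[OF N that] S[OF that]] .
    show "x \<otimes>\<^bsub>(grp N X)\<lparr>carrier := S X\<rparr>\<^esub> y = y \<otimes>\<^bsub>(grp N X)\<lparr>carrier := S X\<rparr>\<^esub> x"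
      if "x \<in> carrier ((grp N X)\<lparr>carrier := S X\<rparr>)" "y \<in> carrier ((grp N X)\<lparr>carrier := S X\<rparr>)" for x y
      using that comm_groupE(4)[OF cmodule_comm_group[OF N \<open>X \<in> Ob C\<close>]] sub[OF \<open>X \<in> Ob C\<close>] by simp
  qed
  moreover have "act N X Y u \<in> hom ((grp N Y)\<lparr>carrier := S Y\<rparr>) ((grp N X)\<lparr>carrier := S X\<rparr>)"
    if "X \<in> Ob C" "Y \<in> Ob C" "u \<in> Hom C X Y" for X Y u
    using that act by (auto simp: hom_def cmodule_act_mult[OF N] sub)
  ultimately show ?thesis
    unfolding cmodule_def using sub
    by (auto simp: cmodule_act_Ident[OF N] cmodule_act_Comp[OF N] cmodule_act_Add[OF N])
qed

lemma comm_group_product_group: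
  assumes "\<And>i. i \<in> I \<Longrightarrow> comm_group (G i)"
  shows "comm_group (product_group I G)"
proof (rule group.group_comm_groupI)
  show "group (product_group I G)"
    using assms by (auto simp: comm_group_def)
  show "x \<otimes>\<^bsub>product_group I G\<^esub> y = y \<otimes>\<^bsub>product_group I G\<^esub> x"
    if "x \<in> carrier (product_group I G)" "y \<in> carrier (product_group I G)" for x y
    using that assms by (auto simp: PiE_iff intro!: restrict_ext comm_groupE(4))
qed

text \<open>Transport of structure along a map that is injective on the carrier. The values of the
  operation off the image of \<open>c\<close> are arbitrary and never enter.\<close>

definition transport_group :: "('h \<Rightarrow> 'g) \<Rightarrow> 'h monoid \<Rightarrow> 'g monoid" where
  "transport_group c G = \<lparr>carrier = c ` carrier G,
     mult = (\<lambda>x y. c (inv_into (carrier G) c x \<otimes>\<^bsub>G\<^esub> inv_into (carrier G) c y)), one = c \<one>\<^bsub>G\<^esub>\<rparr>"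

lemma carrier_transport_group [simp]: "carrier (transport_group c G) = c ` carrier G"
  by (simp add: transport_group_def)

lemma mult_transport_group:
  assumes "inj_on c (carrier G)" "x \<in> carrier G" "y \<in> carrier G"
  shows "c x \<otimes>\<^bsub>transport_group c G\<^esub> c y = c (x \<otimes>\<^bsub>G\<^esub> y)"
  using assms by (simp add: transport_group_def)

lemma transport_group_iso:
  assumes "group G" "inj_on c (carrier G)"
  shows "c \<in> iso G (transport_group c G)"
  using assms by (auto simp: iso_def hom_def bij_betw_def mult_transport_group)

lemma comm_group_transport_group:
  assumes "comm_group G" "inj_on c (carrier G)"
  shows "comm_group (transport_group c G)"
proof -
  interpret comm_group G by fact
  \<comment> \<open>The general result on isomorphic images speaks of the target with its unit
    replaced by the image of the unit; here this update changes nothing.\<close>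
  have "comm_group (transport_group c G\<lparr>one := c \<one>\<^bsub>G\<^esub>\<rparr>)"
    using iso_imp_img_comm_group transport_group_iso[OF _ assms(2)] group_axioms by blast
  then show ?thesis
    by (simp add: transport_group_def)
qed

definition transport_mod ::
    "('o \<Rightarrow> 'h \<Rightarrow> 'g) \<Rightarrow> ('o, 'm, 'h) cmod \<Rightarrow> ('o, 'm, 'g) cmod" where
  "transport_mod c N = \<lparr>grp = (\<lambda>X. transport_group (c X) (grp N X)),
     act = (\<lambda>X Y u g. c X (act N X Y u (inv_into (carrier (grp N Y)) (c Y) g)))\<rparr>"

lemma transport_mod_simps [simp]:
  "grp (transport_mod c N) X = transport_group (c X) (grp N X)"
  by (simp_all add: transport_mod_def)

lemma act_transport_mod:
  assumes "inj_on (c Y) (carrier (grp N Y))" "y \<in> carrier (grp N Y)"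
  shows "act (transport_mod c N) X Y u (c Y y) = c X (act N X Y u y)"
  using assms by (simp add: transport_mod_def)

lemma cmodule_transport_mod:
  assumes N: "cmodule C N" and c: "\<And>X. X \<in> Ob C \<Longrightarrow> inj_on (c X) (carrier (grp N X))"
  shows "cmodule C (transport_mod c N)"
proof -
  have "act (transport_mod c N) X Y u \<in> hom (transport_group (c Y) (grp N Y)) (transport_group (c X) (grp N X))"
    if "X \<in> Ob C" "Y \<in> Ob C" "u \<in> Hom C X Y" for X Y u
    using that group.is_monoid[OF cmodule_group[OF N]]
    by (auto simp: hom_def act_transport_mod c mult_transport_group cmodule_act_closed[OF N]
        cmodule_act_mult[OF N] monoid.m_closed)
  then show ?thesis
    unfolding cmodule_def using c
    by (auto simp: comm_group_transport_group cmodule_comm_group[OF N] cmodule_act_closed[OF N]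
        act_transport_mod cmodule_act_Ident[OF N] cmodule_act_Comp[OF N] cmodule_act_Add[OF N]
        mult_transport_group)
qed

section \<open>Left Kan extension along a fully faithful functor\<close>

locale preadditive_category =
  fixes D :: "('p, 'm) preadd_cat"
  assumes Ident_closed: "X \<in> Ob D \<Longrightarrow> Ident D X \<in> Hom D X X"
    and Comp_closed: "\<lbrakk>X \<in> Ob D; Y \<in> Ob D; Z \<in> Ob D; u \<in> Hom D X Y; v \<in> Hom D Y Z\<rbrakk>
      \<Longrightarrow> Comp D X Y Z v u \<in> Hom D X Z"
    and Add_closed: "\<lbrakk>X \<in> Ob D; Y \<in> Ob D; u \<in> Hom D X Y; v \<in> Hom D X Y\<rbrakk> \<Longrightarrow> Add D X Y u v \<in> Hom D X Y"
    and Comp_assoc: "\<lbrakk>X \<in> Ob D; Y \<in> Ob D; Z \<in> Ob D; W \<in> Ob D;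
      u \<in> Hom D X Y; v \<in> Hom D Y Z; w \<in> Hom D Z W\<rbrakk>
      \<Longrightarrow> Comp D X Z W w (Comp D X Y Z v u) = Comp D X Y W (Comp D Y Z W w v) u"
    and Comp_Ident_left: "\<lbrakk>X \<in> Ob D; Y \<in> Ob D; u \<in> Hom D X Y\<rbrakk> \<Longrightarrow> Comp D X Y Y (Ident D Y) u = u"
    and Comp_Ident_right: "\<lbrakk>X \<in> Ob D; Y \<in> Ob D; u \<in> Hom D X Y\<rbrakk> \<Longrightarrow> Comp D X X Y u (Ident D X) = u"
    and Comp_Add_left: "\<lbrakk>X \<in> Ob D; Y \<in> Ob D; Z \<in> Ob D; u \<in> Hom D X Y; v \<in> Hom D Y Z; w \<in> Hom D Y Z\<rbrakk>
      \<Longrightarrow> Comp D X Y Z (Add D Y Z v w) u = Add D X Z (Comp D X Y Z v u) (Comp D X Y Z w u)"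
    and Comp_Add_right: "\<lbrakk>X \<in> Ob D; Y \<in> Ob D; Z \<in> Ob D; u \<in> Hom D X Y; v \<in> Hom D X Y; w \<in> Hom D Y Z\<rbrakk>
      \<Longrightarrow> Comp D X Y Z w (Add D X Y u v) = Add D X Z (Comp D X Y Z w u) (Comp D X Y Z w v)"

text \<open>
  \<open>F\<close> is the object map of a functor which is the identity on Hom-sets. The factorisation axiom
  says that the objects \<open>F X\<close> which are retracts of \<open>X'\<close> are cofinal among all maps from \<open>X'\<close>
  to the image of \<open>F\<close>.
\<close>

locale retract_cofinal = preadditive_category D
  for D :: "('p, 'm) preadd_cat" +
  fixes C :: "('o, 'm) preadd_cat" and F :: "'o \<Rightarrow> 'p"
  assumes F_closed: "X \<in> Ob C \<Longrightarrow> F X \<in> Ob D"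
    and Hom_F: "\<lbrakk>X \<in> Ob C; Y \<in> Ob C\<rbrakk> \<Longrightarrow> Hom C X Y = Hom D (F X) (F Y)"
    and Comp_F: "\<lbrakk>X \<in> Ob C; Y \<in> Ob C; Z \<in> Ob C\<rbrakk> \<Longrightarrow> Comp C X Y Z = Comp D (F X) (F Y) (F Z)"
    and Ident_F: "X \<in> Ob C \<Longrightarrow> Ident C X = Ident D (F X)"
    and Add_F: "\<lbrakk>X \<in> Ob C; Y \<in> Ob C\<rbrakk> \<Longrightarrow> Add C X Y = Add D (F X) (F Y)"
    and factorisation:
      "\<lbrakk>X' \<in> Ob D; X1 \<in> Ob C; X2 \<in> Ob C; u1 \<in> Hom D X' (F X1); u2 \<in> Hom D X' (F X2)\<rbrakk> \<Longrightarrow>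
        \<exists>X\<in>Ob C. \<exists>p\<in>Hom D X' (F X). \<exists>s\<in>Hom D (F X) X'. \<exists>w1\<in>Hom C X X1. \<exists>w2\<in>Hom C X X2.
          Comp D (F X) X' (F X) p s = Ident D (F X) \<and>
          u1 = Comp D X' (F X) (F X1) w1 p \<and> u2 = Comp D X' (F X) (F X2) w2 p"
    and inhabited: "X' \<in> Ob D \<Longrightarrow> \<exists>X\<in>Ob C. \<exists>u. u \<in> Hom D X' (F X)"
begin

abbreviation Fun :: "('o, 'm, 'p, 'm) functor_data" where
  "Fun \<equiv> \<lparr>on_ob = F, on_hom = (\<lambda>_ _ u. u)\<rparr>"

abbreviation G :: "(('p, 'm, 'g) cmod, 'p \<Rightarrow> 'g \<Rightarrow> 'g, ('o, 'm, 'g) cmod, 'o \<Rightarrow> 'g \<Rightarrow> 'g) functor_data" where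
  "G \<equiv> precomp C Fun"

lemma G_simps [simp]:
  "grp (on_ob G N) X = grp N (F X)"
  "act (on_ob G N) X Y u = act N (F X) (F Y) u"
  "on_hom G N N' \<eta> = (\<lambda>X\<in>Ob C. \<eta> (F X))"
  by (simp_all add: precomp_def)

text \<open>Since \<open>F\<close> is the identity on Hom-sets, morphisms of \<open>D\<close>
  between objects in its image act on modules over \<open>C\<close>. Composites formed in
  \<open>D\<close> may thus be split when they act on \<open>M\<close>.\<close>

lemma Comp_act:
  assumes M: "cmodule C M" and "Y \<in> Ob C" "X \<in> Ob C" "X1 \<in> Ob C" "t \<in> Hom D (F Y) (F X)" "w \<in> Hom C X X1"
    and "m \<in> carrier (grp M X1)"
  shows "act M Y X1 (Comp D (F Y) (F X) (F X1) w t) m = act M Y X t (act M X X1 w m)"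
  using assms cmodule_act_Comp[OF M, of Y X X1 t w m] by (simp add: Hom_F Comp_F)

text \<open>
  The image of the left Kan extension in the right Kan extension: a pair \<open>u: X' \<rightarrow> F X\<close>, \<open>m \<in> M X\<close>
  acts on \<open>s: F Y \<rightarrow> X'\<close> by pulling \<open>m\<close> back along \<open>u s\<close>.
\<close>

definition Idx :: "'p \<Rightarrow> ('o \<times> 'm) set" where
  "Idx X' = (SIGMA Y:Ob C. Hom D (F Y) X')"

definition kan_elt :: "('o, 'm, 'g) cmod \<Rightarrow> 'p \<Rightarrow> 'o \<Rightarrow> 'm \<Rightarrow> 'g \<Rightarrow> ('o \<times> 'm \<Rightarrow> 'g)" where
  "kan_elt M X' X u m = (\<lambda>(Y, s)\<in>Idx X'. act M Y X (Comp D (F Y) X' (F X) u s) m)"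

definition kan_set :: "('o, 'm, 'g) cmod \<Rightarrow> 'p \<Rightarrow> ('o \<times> 'm \<Rightarrow> 'g) set" where
  "kan_set M X' = {kan_elt M X' X u m |X u m. X \<in> Ob C \<and> u \<in> Hom D X' (F X) \<and> m \<in> carrier (grp M X)}"

definition ran :: "('o, 'm, 'g) cmod \<Rightarrow> ('p, 'm, 'o \<times> 'm \<Rightarrow> 'g) cmod" where
  "ran M = \<lparr>grp = (\<lambda>X'. product_group (Idx X') (\<lambda>i. grp M (fst i))\<lparr>carrier := kan_set M X'\<rparr>),
     act = (\<lambda>X'' X' v k. \<lambda>(Y, s)\<in>Idx X''. k (Y, Comp D (F Y) X'' X' v s))\<rparr>"

lemma kan_elt_apply:
  assumes "Y \<in> Ob C" "s \<in> Hom D (F Y) X'"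
  shows "kan_elt M X' X u m (Y, s) = act M Y X (Comp D (F Y) X' (F X) u s) m"
  using assms by (simp add: kan_elt_def Idx_def)

lemma kan_elt_ext: "kan_elt M X' X u m \<in> extensional (Idx X')"
  by (simp add: kan_elt_def)

lemma kan_elt_comp_closed:
  assumes "X' \<in> Ob D" "X \<in> Ob C" "u \<in> Hom D X' (F X)" "Y \<in> Ob C" "s \<in> Hom D (F Y) X'"
  shows "Comp D (F Y) X' (F X) u s \<in> Hom C Y X"
  using assms by (simp add: Hom_F Comp_closed F_closed)

lemma kan_elt_carrier:
  assumes "cmodule C M" "X' \<in> Ob D" "X \<in> Ob C" "u \<in> Hom D X' (F X)" "m \<in> carrier (grp M X)"
  shows "kan_elt M X' X u m \<in> (\<Pi>\<^sub>E i\<in>Idx X'. carrier (grp M (fst i)))"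
  using assms by (auto simp: kan_elt_def Idx_def cmodule_act_closed kan_elt_comp_closed)

text \<open>This is the relation that defines the left Kan extension as a colimit: a morphism
  \<open>w\<close> of \<open>C\<close> may be moved from the map out of \<open>X'\<close> to the
  module element.\<close>

lemma kan_elt_Comp:
  assumes M: "cmodule C M" and "X' \<in> Ob D" "X \<in> Ob C" "X1 \<in> Ob C" "p \<in> Hom D X' (F X)" "w \<in> Hom C X X1"
    "m \<in> carrier (grp M X1)"
  shows "kan_elt M X' X1 (Comp D X' (F X) (F X1) w p) m = kan_elt M X' X p (act M X X1 w m)"
  unfolding kan_elt_def
proof (rule restrict_ext, clarsimp simp: Idx_def)
  fix Y s assume "Y \<in> Ob C" "s \<in> Hom D (F Y) X'"
  then show "act M Y X1 (Comp D (F Y) X' (F X1) (Comp D X' (F X) (F X1) w p) s) m =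
    act M Y X (Comp D (F Y) X' (F X) p s) (act M X X1 w m)"
    using assms by (simp add: Comp_assoc[symmetric] F_closed Hom_F Comp_closed flip: Comp_act)
qed

lemma kan_elt_mult:
  assumes M: "cmodule C M" and "X' \<in> Ob D" "X \<in> Ob C" "u \<in> Hom D X' (F X)"
    "m \<in> carrier (grp M X)" "n \<in> carrier (grp M X)"
  shows "(\<lambda>i\<in>Idx X'. kan_elt M X' X u m i \<otimes>\<^bsub>grp M (fst i)\<^esub> kan_elt M X' X u n i) =
    kan_elt M X' X u (m \<otimes>\<^bsub>grp M X\<^esub> n)"
  using assms
  by (auto simp: kan_elt_def fun_eq_iff restrict_def Idx_def cmodule_act_mult[OF M] kan_elt_comp_closed)

text \<open>The factorisation axiom supplies a common object and a common map for two elements, and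
  \<open>kan_elt_Comp\<close> moves the remaining morphisms into the module. This is the
  directedness that makes \<open>kan_set\<close> closed under products.\<close>

lemma kan_set_pair:
  assumes M: "cmodule C M" and "X' \<in> Ob D" and k: "k \<in> kan_set M X'" "l \<in> kan_set M X'"
  obtains X u m n where "X \<in> Ob C" "u \<in> Hom D X' (F X)" "m \<in> carrier (grp M X)" "n \<in> carrier (grp M X)"
    "k = kan_elt M X' X u m" "l = kan_elt M X' X u n"
proof -
  obtain X1 u1 m1 X2 u2 m2 where
    1: "X1 \<in> Ob C" "u1 \<in> Hom D X' (F X1)" "m1 \<in> carrier (grp M X1)" "k = kan_elt M X' X1 u1 m1" and
    2: "X2 \<in> Ob C" "u2 \<in> Hom D X' (F X2)" "m2 \<in> carrier (grp M X2)" "l = kan_elt M X' X2 u2 m2"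
    using k unfolding kan_set_def by blast
  obtain X p w1 w2 where *: "X \<in> Ob C" "p \<in> Hom D X' (F X)" "w1 \<in> Hom C X X1" "w2 \<in> Hom C X X2"
    "u1 = Comp D X' (F X) (F X1) w1 p" "u2 = Comp D X' (F X) (F X2) w2 p"
    using factorisation[OF \<open>X' \<in> Ob D\<close> 1(1) 2(1) 1(2) 2(2)] by blast
  show thesis
    using that[OF *(1,2), of "act M X X1 w1 m1" "act M X X2 w2 m2"] 1 2 * \<open>X' \<in> Ob D\<close>
    by (simp add: kan_elt_Comp[OF M] cmodule_act_closed[OF M])
qed

lemma subgroup_kan_set:
  assumes M: "cmodule C M" and X': "X' \<in> Ob D"
  shows "subgroup (kan_set M X') (product_group (Idx X') (\<lambda>i. grp M (fst i)))" (is "subgroup _ ?P")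
proof -
  have gi: "i \<in> Idx X' \<Longrightarrow> group (grp M (fst i))" for i
    using cmodule_group[OF M] by (auto simp: Idx_def)
  then have gP: "group ?P" by simp
  show ?thesis
  proof (rule group.subgroupI[OF gP])
    show "kan_set M X' \<subseteq> carrier ?P"
      using kan_elt_carrier[OF M X'] unfolding kan_set_def carrier_product_group by blast
    obtain X u where "X \<in> Ob C" "u \<in> Hom D X' (F X)"
      using inhabited[OF X'] by blast
    then show "kan_set M X' \<noteq> {}"
      using cmodule_group[OF M, THEN group.is_monoid, THEN monoid.one_closed] unfolding kan_set_def by blast
    show "k \<otimes>\<^bsub>?P\<^esub> l \<in> kan_set M X'" if kl: "k \<in> kan_set M X'" "l \<in> kan_set M X'" for k l
      using kan_set_pair[OF M X' kl]
    proof cases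
      case (1 X u m n)
      then show ?thesis
        using kan_elt_mult[OF M X' 1(1-4)] group.is_monoid[OF cmodule_group[OF M 1(1)], THEN monoid.m_closed]
        unfolding kan_set_def by simp metis
    qed
    show "inv\<^bsub>?P\<^esub> k \<in> kan_set M X'" if k: "k \<in> kan_set M X'" for k
    proof -
      obtain X u m where *: "X \<in> Ob C" "u \<in> Hom D X' (F X)" "m \<in> carrier (grp M X)" "k = kan_elt M X' X u m"
        using k unfolding kan_set_def by blast
      have "k \<in> (\<Pi>\<^sub>E i\<in>Idx X'. carrier (grp M (fst i)))"
        using * kan_elt_carrier[OF M X'] by simp
      then have "inv\<^bsub>?P\<^esub> k = (\<lambda>i\<in>Idx X'. inv\<^bsub>grp M (fst i)\<^esub> k i)"
        by (rule inv_product_group) (rule gi)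
      also have "\<dots> = kan_elt M X' X u (inv\<^bsub>grp M X\<^esub> m)"
        using * X'
        by (auto simp: kan_elt_def fun_eq_iff restrict_def Idx_def kan_elt_comp_closed
            group_hom.hom_inv[OF cmodule_act_group_hom[OF M]])
      finally show ?thesis
        using * group.inv_closed[OF cmodule_group[OF M *(1)]] unfolding kan_set_def by auto
    qed
  qed
qed

lemma act_ran_kan_elt:
  assumes "X' \<in> Ob D" "X'' \<in> Ob D" "X \<in> Ob C" "u \<in> Hom D X' (F X)" "v \<in> Hom D X'' X'"
  shows "act (ran M) X'' X' v (kan_elt M X' X u m) = kan_elt M X'' X (Comp D X'' X' (F X) u v) m"
  using assms
  by (auto simp: ran_def kan_elt_def fun_eq_iff restrict_def Idx_def Comp_assoc F_closed Comp_closed)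

text \<open>Acting by \<open>v\<close> replaces the representing map \<open>u\<close> by the
  composite of \<open>v\<close> and \<open>u\<close>, so the functor laws follow from the category
  laws of \<open>D\<close>. Additivity combines bilinearity of composition with additivity of
  \<open>M\<close>.\<close>

lemma cmodule_ran:
  assumes M: "cmodule C M"
  shows "cmodule D (ran M)"
proof -
  let ?P = "\<lambda>X'. product_group (Idx X') (\<lambda>i. grp M (fst i))"
  have "comm_group (?P X')" for X'
    by (rule comm_group_product_group) (use cmodule_comm_group[OF M] in \<open>auto simp: Idx_def\<close>)
  have "comm_group (grp (ran M) X')" if "X' \<in> Ob D" for X'
  proof (rule group.group_comm_groupI)
    have sg: "subgroup (kan_set M X') (?P X')"
      by (rule subgroup_kan_set[OF M that])
    show "group (grp (ran M) X')"
      using group.subgroup_imp_group[OF _ sg] \<open>\<And>X'. comm_group (?P X')\<close> by (simp add: ran_def comm_group_def)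
    show "x \<otimes>\<^bsub>grp (ran M) X'\<^esub> y = y \<otimes>\<^bsub>grp (ran M) X'\<^esub> x"
      if "x \<in> carrier (grp (ran M) X')" "y \<in> carrier (grp (ran M) X')" for x y
    proof -
      have "x \<in> carrier (?P X')" "y \<in> carrier (?P X')"
        using that subgroup.mem_carrier[OF sg] by (simp_all add: ran_def)
      from comm_groupE(4)[OF \<open>comm_group (?P X')\<close> this] show ?thesis
        by (simp add: ran_def)
    qed
  qed
  moreover have "act (ran M) X'' X' v \<in> hom (grp (ran M) X') (grp (ran M) X'')"
    if *: "X'' \<in> Ob D" "X' \<in> Ob D" "v \<in> Hom D X'' X'" for X'' X' v
  proof -
    have "act (ran M) X'' X' v k \<in> kan_set M X''" if "k \<in> kan_set M X'" for k
      using that * unfolding kan_set_def by (auto simp: act_ran_kan_elt) (metis Comp_closed F_closed)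
    then show ?thesis
      using * by (auto simp: hom_def ran_def fun_eq_iff Idx_def restrict_def Comp_closed F_closed)
  qed
  moreover have "act (ran M) X' X' (Ident D X') k = k"
    if "X' \<in> Ob D" "k \<in> kan_set M X'" for X' k
    using that unfolding kan_set_def by (auto simp: act_ran_kan_elt Ident_closed Comp_Ident_right F_closed)
  moreover have "act (ran M) X Z (Comp D X Y Z v u) k = act (ran M) X Y u (act (ran M) Y Z v k)"
    if "X \<in> Ob D" "Y \<in> Ob D" "Z \<in> Ob D" "u \<in> Hom D X Y" "v \<in> Hom D Y Z" "k \<in> kan_set M Z" for X Y Z u v k
    using that unfolding kan_set_def by (auto simp: act_ran_kan_elt Comp_closed F_closed Comp_assoc)
  moreover have "act (ran M) X Y (Add D X Y u v) k = act (ran M) X Y u k \<otimes>\<^bsub>grp (ran M) X\<^esub> act (ran M) X Y v k"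
    if *: "X \<in> Ob D" "Y \<in> Ob D" "u \<in> Hom D X Y" "v \<in> Hom D X Y" "k \<in> kan_set M Y" for X Y u v k
  proof -
    obtain Z t m where k: "Z \<in> Ob C" "t \<in> Hom D Y (F Z)" "m \<in> carrier (grp M Z)" "k = kan_elt M Y Z t m"
      using * unfolding kan_set_def by blast
    have "kan_elt M X Z (Comp D X Y (F Z) t (Add D X Y u v)) m (W, s) =
        kan_elt M X Z (Comp D X Y (F Z) t u) m (W, s) \<otimes>\<^bsub>grp M W\<^esub> kan_elt M X Z (Comp D X Y (F Z) t v) m (W, s)"
      if "W \<in> Ob C" "s \<in> Hom D (F W) X" for W s
      using that * k
      by (simp add: kan_elt_apply Comp_Add_left Comp_Add_right Comp_closed F_closed Hom_F
          flip: Add_F cmodule_act_Add[OF M])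
    then have "kan_elt M X Z (Comp D X Y (F Z) t (Add D X Y u v)) m =
        (\<lambda>i\<in>Idx X. kan_elt M X Z (Comp D X Y (F Z) t u) m i \<otimes>\<^bsub>grp M (fst i)\<^esub> kan_elt M X Z (Comp D X Y (F Z) t v) m i)"
      by (intro extensionalityI[of _ "Idx X"] kan_elt_ext) (auto simp: Idx_def)
    moreover have "(\<otimes>\<^bsub>grp (ran M) X\<^esub>) = (\<lambda>x y. \<lambda>i\<in>Idx X. x i \<otimes>\<^bsub>grp M (fst i)\<^esub> y i)"
      by (simp add: ran_def)
    ultimately show ?thesis
      using * k by (simp add: act_ran_kan_elt Add_closed)
  qed
  ultimately show ?thesis
    unfolding cmodule_def by (simp add: ran_def)
qed

text \<open>With the identity as representing map, \<open>kan_elt\<close> becomes the component at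
  \<open>X\<close> of the comparison map from \<open>M\<close> to the restriction of
  \<open>ran M\<close>.\<close>

lemma kan_elt_Ident_hom:
  assumes M: "cmodule C M" and "X \<in> Ob C"
  shows "kan_elt M (F X) X (Ident D (F X)) \<in> hom (grp M X) (grp (ran M) (F X))"
proof -
  have "(\<otimes>\<^bsub>grp (ran M) (F X)\<^esub>) = (\<lambda>x y. \<lambda>i\<in>Idx (F X). x i \<otimes>\<^bsub>grp M (fst i)\<^esub> y i)"
    by (simp add: ran_def)
  moreover have "carrier (grp (ran M) (F X)) = kan_set M (F X)"
    by (simp add: ran_def)
  ultimately show ?thesis
    using assms kan_elt_mult[OF M F_closed[OF assms(2)] assms(2) Ident_closed[OF F_closed[OF assms(2)]]]
    by (auto simp: hom_def kan_set_def intro!: Ident_closed F_closed)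
qed

lemma kan_elt_Ident_natural:
  assumes M: "cmodule C M" and *: "X \<in> Ob C" "Y \<in> Ob C" "u \<in> Hom C X Y" "m \<in> carrier (grp M Y)"
  shows "kan_elt M (F X) X (Ident D (F X)) (act M X Y u m) =
    act (ran M) (F X) (F Y) u (kan_elt M (F Y) Y (Ident D (F Y)) m)"
proof -
  have u: "u \<in> Hom D (F X) (F Y)"
    using * by (simp add: Hom_F)
  have "kan_elt M (F X) X (Ident D (F X)) (act M X Y u m) =
      kan_elt M (F X) Y (Comp D (F X) (F X) (F Y) u (Ident D (F X))) m"
    using * by (simp add: kan_elt_Comp[OF M] F_closed Ident_closed)
  also have "\<dots> = kan_elt M (F X) Y (Comp D (F X) (F Y) (F Y) (Ident D (F Y)) u) m"
    using * u by (simp add: Comp_Ident_left Comp_Ident_right F_closed)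
  also have "\<dots> = act (ran M) (F X) (F Y) u (kan_elt M (F Y) Y (Ident D (F Y)) m)"
    using * u by (simp add: act_ran_kan_elt F_closed Ident_closed)
  finally show ?thesis .
qed

text \<open>As in the Yoneda lemma, evaluation at the identity recovers \<open>m\<close>.\<close>

lemma inj_on_kan_elt_Ident:
  assumes M: "cmodule C M" and "X \<in> Ob C"
  shows "inj_on (kan_elt M (F X) X (Ident D (F X))) (carrier (grp M X))"
proof (rule inj_on_inverseI)
  show "kan_elt M (F X) X (Ident D (F X)) m (X, Ident D (F X)) = m" if "m \<in> carrier (grp M X)" for m
    using assms that cmodule_act_Ident[OF assms that]
    by (simp add: kan_elt_apply Ident_closed F_closed Comp_Ident_left Ident_F)
qed

text \<open>Elements are represented by triples of an object, a morphism and a module element. Each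
  of the three ranges over at most as many values as \<open>'g\<close> has elements, and an infinite
  cardinal equals its square.\<close>

lemma kan_set_lepoll:
  fixes M :: "('o, 'm, 'g) cmod"
  assumes inf: "infinite (UNIV :: 'g set)" and "Ob C \<lesssim> (UNIV :: 'g set)"
    and "\<And>Y. Y \<in> Ob C \<Longrightarrow> Hom D X' (F Y) \<lesssim> (UNIV :: 'g set)"
  shows "kan_set M X' \<lesssim> (UNIV :: 'g set)"
proof -
  let ?U = "UNIV :: 'g set"
  have sq: "?U \<times> ?U \<lesssim> ?U"
    using card_of_Times_same_infinite[OF inf]
    unfolding card_of_ordIso[symmetric] eqpoll_def[symmetric] by (rule eqpoll_imp_lepoll)
  have 1: "Hom D X' (F X) \<times> carrier (grp M X) \<lesssim> ?U" if "X \<in> Ob C" for X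
    by (rule lepoll_trans[OF times_lepoll_mono[OF assms(3)[OF that] subset_imp_lepoll[OF subset_UNIV]] sq])
  have "(SIGMA X:Ob C. Hom D X' (F X) \<times> carrier (grp M X)) \<lesssim> Ob C \<times> ?U"
    by (rule Sigma_lepoll_mono) (use 1 in auto)
  also have "\<dots> \<lesssim> ?U \<times> ?U"
    by (rule times_lepoll_mono[OF assms(2) lepoll_refl])
  also note sq
  finally have "(SIGMA X:Ob C. Hom D X' (F X) \<times> carrier (grp M X)) \<lesssim> ?U" .
  moreover have "kan_set M X' = (\<lambda>(X, u, m). kan_elt M X' X u m) ` (SIGMA X:Ob C. Hom D X' (F X) \<times> carrier (grp M X))"
    by (force simp: kan_set_def)
  ultimately show ?thesis
    by (simp only:) (rule lepoll_trans[OF image_lepoll])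
qed

text \<open>
  The adjunction only sees modules with values in \<open>'g\<close>, so \<open>ran M\<close>, whose elements are functions,
  is re-encoded there; this is the only use of smallness.
\<close>

lemma ex_injective_nat_trans_to_restriction:
  fixes M :: "('o, 'm, 'g) cmod"
  assumes M: "cmodule C M" and inf: "infinite (UNIV :: 'g set)" and "Ob C \<lesssim> (UNIV :: 'g set)"
    and "\<And>X' Y'. \<lbrakk>X' \<in> Ob D; Y' \<in> Ob D\<rbrakk> \<Longrightarrow> Hom D X' Y' \<lesssim> (UNIV :: 'g set)"
  obtains K :: "('p, 'm, 'g) cmod" and \<theta> where "cmodule D K" "\<theta> \<in> nat_trans C M (on_ob G K)"
    "\<And>X. X \<in> Ob C \<Longrightarrow> inj_on (\<theta> X) (carrier (grp M X))"
proof -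
  have "\<exists>c :: ('o \<times> 'm \<Rightarrow> 'g) \<Rightarrow> 'g. inj_on c (carrier (grp (ran M) X'))" if "X' \<in> Ob D" for X'
    using kan_set_lepoll[OF inf assms(3), of X' M] assms(4)[OF that F_closed]
    by (auto simp: ran_def lepoll_def)
  then obtain c :: "'p \<Rightarrow> ('o \<times> 'm \<Rightarrow> 'g) \<Rightarrow> 'g"
    where c: "\<And>X'. X' \<in> Ob D \<Longrightarrow> inj_on (c X') (carrier (grp (ran M) X'))"
    by metis
  let ?K = "transport_mod c (ran M)"
  define \<eta> where "\<eta> = (\<lambda>X. kan_elt M (F X) X (Ident D (F X)))"
  have \<eta>_hom: "\<eta> X \<in> hom (grp M X) (grp (ran M) (F X))" if "X \<in> Ob C" for X
    using kan_elt_Ident_hom[OF M that] by (simp add: \<eta>_def)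
  have \<eta>_closed: "\<eta> X m \<in> carrier (grp (ran M) (F X))" if "X \<in> Ob C" "m \<in> carrier (grp M X)" for X m
    using \<eta>_hom that by (meson hom_in_carrier)
  define \<theta> where "\<theta> = (\<lambda>X\<in>Ob C. \<lambda>m\<in>carrier (grp M X). c (F X) (\<eta> X m))"
  show thesis
  proof
    show "cmodule D ?K"
      by (rule cmodule_transport_mod[OF cmodule_ran[OF M] c])
    show "\<theta> \<in> nat_trans C M (on_ob G ?K)"
      unfolding \<theta>_def
    proof (rule nat_transI[OF _ _ M])
      show "(\<lambda>m. c (F X) (\<eta> X m)) \<in> hom (grp M X) (grp (on_ob G ?K) X)" if "X \<in> Ob C" for X
        using that \<eta>_hom[OF that] by (auto simp: hom_def mult_transport_group c F_closed Pi_iff)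
      show "c (F X) (\<eta> X (act M X Y u m)) = act (on_ob G ?K) X Y u (c (F Y) (\<eta> Y m))"
        if "X \<in> Ob C" "Y \<in> Ob C" "u \<in> Hom C X Y" "m \<in> carrier (grp M Y)" for X Y u m
      proof -
        have "\<eta> X (act M X Y u m) = act (ran M) (F X) (F Y) u (\<eta> Y m)"
          using kan_elt_Ident_natural[OF M that] by (simp add: \<eta>_def)
        then show ?thesis
          using that by (simp add: act_transport_mod c F_closed \<eta>_closed)
      qed
    qed
    show "inj_on (\<theta> X) (carrier (grp M X))" if "X \<in> Ob C" for X
      using inj_on_kan_elt_Ident[OF M that] inj_onD[OF c[OF F_closed[OF that]]] \<eta>_closed[OF that] that
      by (auto simp: \<theta>_def inj_on_def \<eta>_def)
  qed
qed

end

section \<open>A left adjoint of restriction, studied through its unit\<close>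

locale retract_cofinal_adjoint = retract_cofinal D C F
  for D :: "('p, 'm) preadd_cat" and C :: "('o, 'm) preadd_cat" and F :: "'o \<Rightarrow> 'p" +
  fixes L :: "(('o, 'm, 'g) cmod, 'o \<Rightarrow> 'g \<Rightarrow> 'g, ('p, 'm, 'g) cmod, 'p \<Rightarrow> 'g \<Rightarrow> 'g) functor_data"
    and \<Phi>
  assumes L: "is_functor (mod_cat C) (mod_cat D) L"
    and \<Phi>_bij: "\<And>M N. \<lbrakk>cmodule C M; cmodule D N\<rbrakk> \<Longrightarrow>
      bij_betw (\<Phi> M N) (nat_trans D (on_ob L M) N) (nat_trans C M (on_ob G N))"
    and \<Phi>_natural: "\<And>M' M N N' u h v. \<lbrakk>cmodule C M'; cmodule C M; cmodule D N; cmodule D N';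
        u \<in> nat_trans C M' M; h \<in> nat_trans D (on_ob L M) N; v \<in> nat_trans D N N'\<rbrakk> \<Longrightarrow>
        \<Phi> M' N' (Comp (mod_cat D) (on_ob L M') N N' v
                      (Comp (mod_cat D) (on_ob L M') (on_ob L M) N h (on_hom L M' M u))) =
        Comp (mod_cat C) M' (on_ob G N) (on_ob G N') (on_hom G N N' v)
                      (Comp (mod_cat C) M' M (on_ob G N) (\<Phi> M N h) u)"
begin

lemma L_closed: "cmodule C M \<Longrightarrow> cmodule D (on_ob L M)"
  using L by (simp add: is_functor_def)

lemma L_hom_closed:
  "\<lbrakk>cmodule C M; cmodule C N; j \<in> nat_trans C M N\<rbrakk> \<Longrightarrow> on_hom L M N j \<in> nat_trans D (on_ob L M) (on_ob L N)"
  using L by (simp add: is_functor_def)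

lemma L_Ident: "cmodule C M \<Longrightarrow> on_hom L M M (Ident (mod_cat C) M) = Ident (mod_cat D) (on_ob L M)"
  using L by (simp add: is_functor_def)

definition unit :: "('o, 'm, 'g) cmod \<Rightarrow> 'o \<Rightarrow> 'g \<Rightarrow> 'g" where
  "unit M = \<Phi> M (on_ob L M) (Ident (mod_cat D) (on_ob L M))"

lemma unit_nat_trans: "cmodule C M \<Longrightarrow> unit M \<in> nat_trans C M (on_ob G (on_ob L M))"
  unfolding unit_def by (rule bij_betw_apply[OF \<Phi>_bij Ident_nat_trans]) (auto intro: L_closed)

lemma unit_closed:
  "cmodule C M \<Longrightarrow> X \<in> Ob C \<Longrightarrow> m \<in> carrier (grp M X) \<Longrightarrow> unit M X m \<in> carrier (grp (on_ob L M) (F X))"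
  using nat_trans_closed[OF unit_nat_trans] by fastforce

lemma unit_hom: "cmodule C M \<Longrightarrow> X \<in> Ob C \<Longrightarrow> unit M X \<in> hom (grp M X) (grp (on_ob L M) (F X))"
  using nat_trans_hom[OF unit_nat_trans] by fastforce

lemma unit_natural:
  "\<lbrakk>cmodule C M; X \<in> Ob C; Y \<in> Ob C; w \<in> Hom C X Y; m \<in> carrier (grp M Y)\<rbrakk> \<Longrightarrow>
   unit M X (act M X Y w m) = act (on_ob L M) (F X) (F Y) w (unit M Y m)"
  using nat_trans_natural[OF unit_nat_trans] by fastforce

text \<open>An adjunction bijection is composition with its value at the identity. The composites
  with identities only bring \<open>h\<close> into the shape to which \<open>\<Phi>_natural\<close>
  applies, with \<open>h\<close> in the role of the outer map.\<close>

lemma \<Phi>_eq_unit: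
  assumes M: "cmodule C M" and N: "cmodule D N" and h: "h \<in> nat_trans D (on_ob L M) N"
    and X: "X \<in> Ob C" "m \<in> carrier (grp M X)"
  shows "\<Phi> M N h X m = h (F X) (unit M X m)"
proof -
  note LM = L_closed[OF M]
  have "\<Phi> M N h = \<Phi> M N (Comp (mod_cat D) (on_ob L M) (on_ob L M) N h
      (Comp (mod_cat D) (on_ob L M) (on_ob L M) (on_ob L M) (Ident (mod_cat D) (on_ob L M))
      (on_hom L M M (Ident (mod_cat C) M))))"
    using mod_Comp_Ident_right[OF LM h] mod_Comp_Ident_right[OF LM Ident_nat_trans[OF LM]] L_Ident[OF M]
    by argo
  also have "\<dots> = Comp (mod_cat C) M (on_ob G (on_ob L M)) (on_ob G N) (on_hom G (on_ob L M) N h)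
      (Comp (mod_cat C) M M (on_ob G (on_ob L M)) (unit M) (Ident (mod_cat C) M))"
    unfolding unit_def by (rule \<Phi>_natural[OF M M LM N Ident_nat_trans[OF M] Ident_nat_trans[OF LM] h])
  finally show ?thesis
    using X by (simp add: compose_def)
qed

text \<open>Naturality of the unit, obtained by comparing two descriptions of the adjunct of
  \<open>on_hom L M N j\<close>: as that map after the unit of \<open>M\<close>, and, by naturality
  in the first argument, as the unit of \<open>N\<close> after \<open>j\<close>.\<close>

lemma L_hom_unit:
  assumes M: "cmodule C M" and N: "cmodule C N" and j: "j \<in> nat_trans C M N"
    and X: "X \<in> Ob C" "m \<in> carrier (grp M X)"
  shows "on_hom L M N j (F X) (unit M X m) = unit N X (j X m)"
proof -
  note LM = L_closed[OF M] and LN = L_closed[OF N] and Lj = L_hom_closed[OF M N j]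
  have "on_hom L M N j (F X) (unit M X m) = \<Phi> M (on_ob L N) (on_hom L M N j) X m"
    using \<Phi>_eq_unit[OF M LN Lj X] by simp
  also have "\<Phi> M (on_ob L N) (on_hom L M N j) = \<Phi> M (on_ob L N)
      (Comp (mod_cat D) (on_ob L M) (on_ob L N) (on_ob L N) (Ident (mod_cat D) (on_ob L N))
      (Comp (mod_cat D) (on_ob L M) (on_ob L N) (on_ob L N) (Ident (mod_cat D) (on_ob L N)) (on_hom L M N j)))"
    using mod_Comp_Ident_left[OF LM LN Lj] by argo
  also have "\<dots> = Comp (mod_cat C) M (on_ob G (on_ob L N)) (on_ob G (on_ob L N))
      (on_hom G (on_ob L N) (on_ob L N) (Ident (mod_cat D) (on_ob L N)))
      (Comp (mod_cat C) M N (on_ob G (on_ob L N)) (unit N) j)"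
    unfolding unit_def
    by (rule \<Phi>_natural[OF M N LN LN j Ident_nat_trans[OF LN] Ident_nat_trans[OF LN]])
  also have "\<dots> X m = unit N X (j X m)"
    using X by (simp add: compose_def F_closed unit_closed[OF N] nat_trans_closed[OF j])
  finally show ?thesis .
qed

text \<open>The submodule generated by the image of the unit. No sums are formed because the
  factorisation axiom makes the single pullbacks already closed under the group operation.\<close>

definition gen :: "('o, 'm, 'g) cmod \<Rightarrow> 'p \<Rightarrow> 'g set" where
  "gen M X' = {act (on_ob L M) X' (F X) u (unit M X m) |X u m.
     X \<in> Ob C \<and> u \<in> Hom D X' (F X) \<and> m \<in> carrier (grp M X)}"

lemma gen_subset:
  assumes M: "cmodule C M" and "X' \<in> Ob D"
  shows "gen M X' \<subseteq> carrier (grp (on_ob L M) X')"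
  using assms by (auto simp: gen_def intro!: cmodule_act_closed[OF L_closed[OF M]] F_closed unit_closed)

lemma gen_factor:
  assumes M: "cmodule C M" and X': "X' \<in> Ob D" and "X \<in> Ob C" "p \<in> Hom D X' (F X)" "X1 \<in> Ob C"
    "w \<in> Hom C X X1" "m \<in> carrier (grp M X1)"
  shows "act (on_ob L M) X' (F X1) (Comp D X' (F X) (F X1) w p) (unit M X1 m) =
    act (on_ob L M) X' (F X) p (unit M X (act M X X1 w m))"
  using assms by (simp add: unit_natural unit_closed cmodule_act_Comp[OF L_closed[OF M]] F_closed Hom_F)

lemma act_gen_closed:
  assumes M: "cmodule C M" and "X'' \<in> Ob D" "X' \<in> Ob D" "v \<in> Hom D X'' X'" "y \<in> gen M X'"
  shows "act (on_ob L M) X'' X' v y \<in> gen M X''"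
proof -
  obtain X u m where *: "X \<in> Ob C" "u \<in> Hom D X' (F X)" "m \<in> carrier (grp M X)"
    "y = act (on_ob L M) X' (F X) u (unit M X m)"
    using assms(5) unfolding gen_def by blast
  then have "act (on_ob L M) X'' X' v y = act (on_ob L M) X'' (F X) (Comp D X'' X' (F X) u v) (unit M X m)"
    using assms by (simp add: cmodule_act_Comp[OF L_closed[OF M]] F_closed unit_closed)
  then show ?thesis
    using * assms Comp_closed F_closed unfolding gen_def by blast
qed

text \<open>Inverses can be taken inside \<open>M X\<close>. For products both elements are
  rewritten as pullbacks along the same \<open>p\<close>, with \<open>gen_factor\<close> absorbing
  \<open>w1\<close> and \<open>w2\<close>, and are then multiplied inside
  \<open>M X\<close>.\<close>

lemma subgroup_gen:
  assumes M: "cmodule C M" and X': "X' \<in> Ob D"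
  shows "subgroup (gen M X') (grp (on_ob L M) X')"
proof (rule group.subgroupI)
  note LM = L_closed[OF M]
  show "group (grp (on_ob L M) X')"
    by (rule cmodule_group[OF LM X'])
  show "gen M X' \<subseteq> carrier (grp (on_ob L M) X')"
    by (rule gen_subset[OF M X'])
  obtain X u where "X \<in> Ob C" "u \<in> Hom D X' (F X)"
    using inhabited[OF X'] by blast
  then show "gen M X' \<noteq> {}"
    using cmodule_group[OF M, THEN group.is_monoid, THEN monoid.one_closed] unfolding gen_def by blast
  show "inv\<^bsub>grp (on_ob L M) X'\<^esub> y \<in> gen M X'" if y: "y \<in> gen M X'" for y
  proof -
    obtain X u m where *: "X \<in> Ob C" "u \<in> Hom D X' (F X)" "m \<in> carrier (grp M X)"
      "y = act (on_ob L M) X' (F X) u (unit M X m)"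
      using y unfolding gen_def by blast
    interpret a: group_hom "grp (on_ob L M) (F X)" "grp (on_ob L M) X'" "act (on_ob L M) X' (F X) u"
      using cmodule_act_group_hom[OF LM X' F_closed[OF *(1)] *(2)] .
    interpret e: group_hom "grp M X" "grp (on_ob L M) (F X)" "unit M X"
      using unit_hom[OF M *(1)] cmodule_group[OF M *(1)] a.G.is_group
      by (simp add: group_hom_def group_hom_axioms_def)
    have "inv\<^bsub>grp (on_ob L M) X'\<^esub> y = act (on_ob L M) X' (F X) u (unit M X (inv\<^bsub>grp M X\<^esub> m))"
      using * by simp
    then show ?thesis
      using * e.G.inv_closed unfolding gen_def by blast
  qed
  show "y \<otimes>\<^bsub>grp (on_ob L M) X'\<^esub> z \<in> gen M X'" if y: "y \<in> gen M X'" and z: "z \<in> gen M X'" for y z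
  proof -
    obtain X1 u1 m1 X2 u2 m2 where
      1: "X1 \<in> Ob C" "u1 \<in> Hom D X' (F X1)" "m1 \<in> carrier (grp M X1)"
         "y = act (on_ob L M) X' (F X1) u1 (unit M X1 m1)" and
      2: "X2 \<in> Ob C" "u2 \<in> Hom D X' (F X2)" "m2 \<in> carrier (grp M X2)"
         "z = act (on_ob L M) X' (F X2) u2 (unit M X2 m2)"
      using y z unfolding gen_def by blast
    obtain X p w1 w2 where *: "X \<in> Ob C" "p \<in> Hom D X' (F X)" "w1 \<in> Hom C X X1" "w2 \<in> Hom C X X2"
      "u1 = Comp D X' (F X) (F X1) w1 p" "u2 = Comp D X' (F X) (F X2) w2 p"
      using factorisation[OF X' 1(1) 2(1) 1(2) 2(2)] by blast
    define m where "m = act M X X1 w1 m1 \<otimes>\<^bsub>grp M X\<^esub> act M X X2 w2 m2"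
    have m12: "act M X X1 w1 m1 \<in> carrier (grp M X)" "act M X X2 w2 m2 \<in> carrier (grp M X)"
      using 1 2 * by (auto intro: cmodule_act_closed[OF M])
    then have m: "m \<in> carrier (grp M X)"
      using cmodule_group[OF M *(1), THEN group.is_monoid, THEN monoid.m_closed] by (simp add: m_def)
    have "y \<otimes>\<^bsub>grp (on_ob L M) X'\<^esub> z = act (on_ob L M) X' (F X) p (unit M X m)"
      using 1 2 * X' m12
      by (simp add: gen_factor[OF M] m_def hom_mult[OF unit_hom[OF M]] cmodule_act_mult[OF LM] F_closed
          unit_closed[OF M])
    then show ?thesis
      using * m unfolding gen_def by blast
  qed
qed

text \<open>
  By the universal property the identity of \<open>L M\<close> factors through the submodule generated by the
  image of the unit.
\<close>

lemma gen_eq_carrier: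
  assumes M: "cmodule C M" and X': "X' \<in> Ob D"
  shows "gen M X' = carrier (grp (on_ob L M) X')"
proof -
  note LM = L_closed[OF M]
  define S where "S = submod (on_ob L M) (gen M)"
  have S: "cmodule D S"
    unfolding S_def by (rule cmodule_submod[OF LM subgroup_gen[OF M] act_gen_closed[OF M]])
  have unit_gen: "unit M X m \<in> gen M (F X)" if "X \<in> Ob C" "m \<in> carrier (grp M X)" for X m
  proof -
    have "unit M X m = act (on_ob L M) (F X) (F X) (Ident D (F X)) (unit M X m)"
      using that by (simp add: cmodule_act_Ident[OF LM] F_closed unit_closed[OF M])
    then show ?thesis
      using that Ident_closed[OF F_closed] unfolding gen_def by blast
  qed
  have "(\<lambda>X\<in>Ob C. \<lambda>m\<in>carrier (grp M X). unit M X m) \<in> nat_trans C M (on_ob G S)"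
    by (rule nat_transI[OF _ _ M])
      (use unit_hom[OF M] unit_gen in \<open>auto simp: S_def hom_def unit_natural[OF M]\<close>)
  \<comment> \<open>The unit, viewed with values in the submodule \<open>S\<close>, has an adjunct
    \<open>h\<close> by surjectivity of the bijection. Followed by the inclusion of
    \<open>S\<close>, this \<open>h\<close> is the sought factorisation.\<close>
  then have "(\<lambda>X\<in>Ob C. \<lambda>m\<in>carrier (grp M X). unit M X m) \<in> \<Phi> M S ` nat_trans D (on_ob L M) S"
    using bij_betw_imp_surj_on[OF \<Phi>_bij[OF M S]] by simp
  then obtain h where h: "h \<in> nat_trans D (on_ob L M) S"
    and \<Phi>h: "\<Phi> M S h = (\<lambda>X\<in>Ob C. \<lambda>m\<in>carrier (grp M X). unit M X m)"
    by (auto simp del: G_simps)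
  have "(\<lambda>X\<in>Ob D. \<lambda>m\<in>carrier (grp S X). m) \<in> nat_trans D S (on_ob L M)"
    by (rule nat_transI[OF _ _ S]) (use gen_subset[OF M] in \<open>auto simp: S_def hom_def\<close>)
  then have incl_h: "Comp (mod_cat D) (on_ob L M) S (on_ob L M) (\<lambda>X\<in>Ob D. \<lambda>m\<in>carrier (grp S X). m) h
      \<in> nat_trans D (on_ob L M) (on_ob L M)" (is "?w \<in> _")
    by (rule Comp_nat_trans[OF LM h])
  \<comment> \<open>Both \<open>?w\<close> and the identity of \<open>L M\<close> correspond to the
    unit, so injectivity of the bijection will identify them.\<close>
  have "\<Phi> M (on_ob L M) ?w = unit M"
  proof (rule nat_trans_eqI[OF _ unit_nat_trans[OF M]])
    show "\<Phi> M (on_ob L M) ?w \<in> nat_trans C M (on_ob G (on_ob L M))"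
      using \<Phi>_bij[OF M LM] incl_h by (rule bij_betw_apply)
    show "\<Phi> M (on_ob L M) ?w X m = unit M X m" if "X \<in> Ob C" "m \<in> carrier (grp M X)" for X m
    proof -
      have "h (F X) (unit M X m) = unit M X m"
        using \<Phi>_eq_unit[OF M S h that] \<Phi>h that by simp
      then show ?thesis
        using that unfolding \<Phi>_eq_unit[OF M LM incl_h that]
        by (simp add: compose_def F_closed unit_closed[OF M] S_def unit_gen)
    qed
  qed
  then have "?w = Ident (mod_cat D) (on_ob L M)"
    unfolding unit_def
    by (rule inj_onD[OF bij_betw_imp_inj_on[OF \<Phi>_bij[OF M LM]] _ incl_h Ident_nat_trans[OF LM]])
  then have "?w X' y = y" if "y \<in> carrier (grp (on_ob L M) X')" for y
    using that X' by simp
  moreover have "?w X' y \<in> gen M X'" if "y \<in> carrier (grp (on_ob L M) X')" for y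
    using that X' nat_trans_closed[OF h X' that] by (simp add: compose_def S_def)
  ultimately show ?thesis
    using gen_subset[OF M X'] by fastforce
qed

text \<open>The factorisation axiom is applied to the pair consisting of \<open>u\<close> twice. The
  section \<open>s\<close> then exhibits \<open>M X\<close>, through the unit, as a place where
  \<open>y\<close> can be recovered: pulling back along \<open>s\<close> and then along
  \<open>p\<close> returns \<open>y\<close>.\<close>

lemma L_elementE:
  assumes M: "cmodule C M" and X': "X' \<in> Ob D" and y: "y \<in> carrier (grp (on_ob L M) X')"
  obtains X p s m where "X \<in> Ob C" "p \<in> Hom D X' (F X)" "s \<in> Hom D (F X) X'" "m \<in> carrier (grp M X)"
    "y = act (on_ob L M) X' (F X) p (unit M X m)" "act (on_ob L M) (F X) X' s y = unit M X m"
    "Comp D (F X) X' (F X) p s = Ident D (F X)"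
proof -
  note LM = L_closed[OF M]
  obtain X1 u m1 where 1: "X1 \<in> Ob C" "u \<in> Hom D X' (F X1)" "m1 \<in> carrier (grp M X1)"
    "y = act (on_ob L M) X' (F X1) u (unit M X1 m1)"
    using y gen_eq_carrier[OF M X'] unfolding gen_def by blast
  obtain X p s w where *: "X \<in> Ob C" "p \<in> Hom D X' (F X)" "s \<in> Hom D (F X) X'" "w \<in> Hom C X X1"
    "Comp D (F X) X' (F X) p s = Ident D (F X)" "u = Comp D X' (F X) (F X1) w p"
    using factorisation[OF X' 1(1) 1(1) 1(2) 1(2)] by metis
  define m where "m = act M X X1 w m1"
  have m: "m \<in> carrier (grp M X)"
    using 1 * cmodule_act_closed[OF M] by (simp add: m_def)
  have y: "y = act (on_ob L M) X' (F X) p (unit M X m)"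
    using 1 * X' by (simp add: gen_factor[OF M] m_def)
  have "act (on_ob L M) (F X) X' s y = act (on_ob L M) (F X) (F X) (Comp D (F X) X' (F X) p s) (unit M X m)"
    unfolding y by (rule cmodule_act_Comp[OF LM F_closed X' F_closed, symmetric])
      (use * m in \<open>auto intro: unit_closed[OF M]\<close>)
  also have "\<dots> = unit M X m"
    using * m by (simp add: cmodule_act_Ident[OF LM] F_closed unit_closed[OF M])
  finally show thesis
    using that * m y by blast
qed

text \<open>Any map from \<open>M\<close> to a restricted module factors through the unit, so a
  single injective one, as constructed above, forces the unit to be injective.\<close>

lemma inj_on_unit:
  assumes M: "cmodule C M" and X: "X \<in> Ob C"
    and small: "infinite (UNIV :: 'g set)" "Ob C \<lesssim> (UNIV :: 'g set)"
      "\<And>X' Y'. \<lbrakk>X' \<in> Ob D; Y' \<in> Ob D\<rbrakk> \<Longrightarrow> Hom D X' Y' \<lesssim> (UNIV :: 'g set)"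
  shows "inj_on (unit M X) (carrier (grp M X))"
proof -
  obtain K :: "('p, 'm, 'g) cmod" and \<theta> where K: "cmodule D K" and \<theta>: "\<theta> \<in> nat_trans C M (on_ob G K)"
    and inj: "inj_on (\<theta> X) (carrier (grp M X))"
    using ex_injective_nat_trans_to_restriction[OF M small] X by metis
  then obtain h where h: "h \<in> nat_trans D (on_ob L M) K" and "\<theta> = \<Phi> M K h"
    using bij_betw_imp_surj_on[OF \<Phi>_bij[OF M K]] by blast
  then have "\<theta> X m = h (F X) (unit M X m)" if "m \<in> carrier (grp M X)" for m
    using \<Phi>_eq_unit[OF M K h X that] by simp
  then show ?thesis
    using inj by (metis (mono_tags, lifting) inj_on_def)
qed

text \<open>
  Every element of \<open>L M X'\<close> lies in a direct summand \<open>M X\<close>, compatibly with the maps induced by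
  \<open>M \<rightarrow> N\<close>; this reduces exactness of \<open>L\<close> to exactness in \<open>mod(C)\<close>.
\<close>

theorem exact_L:
  assumes small: "infinite (UNIV :: 'g set)" "Ob C \<lesssim> (UNIV :: 'g set)"
      "\<And>X' Y'. \<lbrakk>X' \<in> Ob D; Y' \<in> Ob D\<rbrakk> \<Longrightarrow> Hom D X' Y' \<lesssim> (UNIV :: 'g set)"
  shows "exact_functor C D L"
  unfolding exact_functor_def
proof (intro allI impI)
  fix M N P :: "('o, 'm, 'g) cmod" and i q
  assume "short_exact C M N P i q"
  note M = short_exactD(1)[OF this] and N = short_exactD(2)[OF this] and P = short_exactD(3)[OF this]
    and i = short_exactD(4)[OF this] and q = short_exactD(5)[OF this] and inj_i = short_exactD(6)[OF this]
    and surj_q = short_exactD(7)[OF this] and ker_q = short_exactD(8)[OF this]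
  note LM = L_closed[OF M] and LN = L_closed[OF N] and LP = L_closed[OF P]
    and Li = L_hom_closed[OF M N i] and Lq = L_hom_closed[OF N P q]
  have L_elt: "on_hom L M' N' j X' (act (on_ob L M') X' (F X) p (unit M' X m)) =
      act (on_ob L N') X' (F X) p (unit N' X (j X m))"
    if "cmodule C M'" "cmodule C N'" "j \<in> nat_trans C M' N'" "X' \<in> Ob D" "X \<in> Ob C" "p \<in> Hom D X' (F X)"
      "m \<in> carrier (grp M' X)" for M' N' j X' X p m
    using that
    by (simp add: nat_trans_natural[OF L_hom_closed[OF that(1-3)]] F_closed unit_closed L_hom_unit)
  \<comment> \<open>An equation for \<open>y\<close> over \<open>X'\<close> is carried by the
    section \<open>s\<close> to an equation for \<open>m\<close> over \<open>X\<close>, where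
    injectivity of the unit reduces it to the given exact sequence.\<close>
  have retract: "unit N' X (j X m) = act (on_ob L N') (F X) X' s (on_hom L M' N' j X' y)"
    if "cmodule C M'" "cmodule C N'" "j \<in> nat_trans C M' N'" "X' \<in> Ob D" "X \<in> Ob C" "s \<in> Hom D (F X) X'"
      "m \<in> carrier (grp M' X)" "y \<in> carrier (grp (on_ob L M') X')"
      "act (on_ob L M') (F X) X' s y = unit M' X m" for M' N' j X' X s m y
    using that nat_trans_natural[OF L_hom_closed[OF that(1-3)] F_closed[OF that(5)] that(4,6,8)]
    by (simp add: L_hom_unit)
  have unit_eq_one: "m = \<one>\<^bsub>grp M' X\<^esub>"
    if "cmodule C M'" "X \<in> Ob C" "m \<in> carrier (grp M' X)" "unit M' X m = \<one>\<^bsub>grp (on_ob L M') (F X)\<^esub>" for M' X m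
  proof -
    have "group_hom (grp M' X) (grp (on_ob L M') (F X)) (unit M' X)"
      using that cmodule_group[OF L_closed[OF that(1)] F_closed[OF that(2)]]
      by (simp add: group_hom_def group_hom_axioms_def cmodule_group unit_hom)
    then show ?thesis
      using group_hom.inj_on_one_iff inj_on_unit[OF that(1,2) small] that(3,4) by blast
  qed
  have act_one: "act K X Y u \<one>\<^bsub>grp K Y\<^esub> = \<one>\<^bsub>grp K X\<^esub>"
    if "cmodule D K" "X \<in> Ob D" "Y \<in> Ob D" "u \<in> Hom D X Y" for K :: "('p, 'm, 'g) cmod" and X Y u
    using group_hom.hom_one[OF cmodule_act_group_hom[OF that]] .
  show "short_exact D (on_ob L M) (on_ob L N) (on_ob L P) (on_hom L M N i) (on_hom L N P q)"
  proof (rule short_exactI[OF LM LN LP Li Lq])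
    fix X' assume X': "X' \<in> Ob D"
    interpret i: group_hom "grp (on_ob L M) X'" "grp (on_ob L N) X'" "on_hom L M N i X'"
      by (rule nat_trans_group_hom[OF Li LM LN X'])
    interpret q: group_hom "grp (on_ob L N) X'" "grp (on_ob L P) X'" "on_hom L N P q X'"
      by (rule nat_trans_group_hom[OF Lq LN LP X'])
    show "inj_on (on_hom L M N i X') (carrier (grp (on_ob L M) X'))"
      unfolding i.inj_on_one_iff
    proof (intro allI impI)
      fix y assume y: "y \<in> carrier (grp (on_ob L M) X')" and "on_hom L M N i X' y = \<one>\<^bsub>grp (on_ob L N) X'\<^esub>"
      obtain X p s m where *: "X \<in> Ob C" "p \<in> Hom D X' (F X)" "s \<in> Hom D (F X) X'" "m \<in> carrier (grp M X)"
        "y = act (on_ob L M) X' (F X) p (unit M X m)" "act (on_ob L M) (F X) X' s y = unit M X m"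
        using L_elementE[OF M X' y] by metis
      have "unit N X (i X m) = \<one>\<^bsub>grp (on_ob L N) (F X)\<^esub>"
        using retract[OF M N i X' *(1,3,4) y *(6)] act_one[OF LN F_closed[OF *(1)] X' *(3)]
          \<open>on_hom L M N i X' y = _\<close> by simp
      then have "i X m = \<one>\<^bsub>grp N X\<^esub>"
        by (rule unit_eq_one[OF N *(1) nat_trans_closed[OF i *(1,4)]])
      then have "m = \<one>\<^bsub>grp M X\<^esub>"
        using group_hom.inj_on_one_iff[OF nat_trans_group_hom[OF i M N *(1)]] inj_i[OF *(1)] *(4) by blast
      then have "unit M X m = \<one>\<^bsub>grp (on_ob L M) (F X)\<^esub>"
        using hom_one[OF unit_hom[OF M *(1)] cmodule_group[OF M *(1)] cmodule_group[OF LM F_closed[OF *(1)]]]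
        by simp
      then show "y = \<one>\<^bsub>grp (on_ob L M) X'\<^esub>"
        using act_one[OF LM X' F_closed[OF *(1)] *(2)] *(5) by simp
    qed
    show "on_hom L N P q X' ` carrier (grp (on_ob L N) X') = carrier (grp (on_ob L P) X')"
    proof (intro equalityI subsetI)
      fix z assume z: "z \<in> carrier (grp (on_ob L P) X')"
      obtain X p m where *: "X \<in> Ob C" "p \<in> Hom D X' (F X)" "m \<in> carrier (grp P X)"
        "z = act (on_ob L P) X' (F X) p (unit P X m)"
        using L_elementE[OF P X' z] by metis
      then obtain n where n: "n \<in> carrier (grp N X)" "m = q X n"
        using surj_q[OF *(1)] by blast
      have "z = on_hom L N P q X' (act (on_ob L N) X' (F X) p (unit N X n))"
        using L_elt[OF N P q X' *(1,2) n(1)] * n by simp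
      then show "z \<in> on_hom L N P q X' ` carrier (grp (on_ob L N) X')"
        using cmodule_act_closed[OF LN X' F_closed[OF *(1)] *(2) unit_closed[OF N *(1) n(1)]] by blast
    qed auto
    show "kernel (grp (on_ob L N) X') (grp (on_ob L P) X') (on_hom L N P q X') =
        on_hom L M N i X' ` carrier (grp (on_ob L M) X')"
    proof (intro equalityI subsetI)
      fix y assume "y \<in> kernel (grp (on_ob L N) X') (grp (on_ob L P) X') (on_hom L N P q X')"
      then have y: "y \<in> carrier (grp (on_ob L N) X')" "on_hom L N P q X' y = \<one>\<^bsub>grp (on_ob L P) X'\<^esub>"
        by (auto simp: kernel_def)
      obtain X p s n where *: "X \<in> Ob C" "p \<in> Hom D X' (F X)" "s \<in> Hom D (F X) X'" "n \<in> carrier (grp N X)"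
        "y = act (on_ob L N) X' (F X) p (unit N X n)" "act (on_ob L N) (F X) X' s y = unit N X n"
        using L_elementE[OF N X' y(1)] by metis
      have "unit P X (q X n) = \<one>\<^bsub>grp (on_ob L P) (F X)\<^esub>"
        using retract[OF N P q X' *(1,3,4) y(1) *(6)] act_one[OF LP F_closed[OF *(1)] X' *(3)] y(2) by simp
      then have "q X n = \<one>\<^bsub>grp P X\<^esub>"
        by (rule unit_eq_one[OF P *(1) nat_trans_closed[OF q *(1,4)]])
      then have "n \<in> kernel (grp N X) (grp P X) (q X)"
        using * by (simp add: kernel_def)
      then obtain m where m: "m \<in> carrier (grp M X)" "n = i X m"
        unfolding ker_q[OF *(1)] by blast
      have "y = on_hom L M N i X' (act (on_ob L M) X' (F X) p (unit M X m))"
        using L_elt[OF M N i X' *(1,2) m(1)] * m by simp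
      then show "y \<in> on_hom L M N i X' ` carrier (grp (on_ob L M) X')"
        using cmodule_act_closed[OF LM X' F_closed[OF *(1)] *(2) unit_closed[OF M *(1) m(1)]] by blast
    next
      fix y assume "y \<in> on_hom L M N i X' ` carrier (grp (on_ob L M) X')"
      then obtain x where x: "x \<in> carrier (grp (on_ob L M) X')" "y = on_hom L M N i X' x"
        by blast
      obtain X p m where *: "X \<in> Ob C" "p \<in> Hom D X' (F X)" "m \<in> carrier (grp M X)"
        "x = act (on_ob L M) X' (F X) p (unit M X m)"
        using L_elementE[OF M X' x(1)] by metis
      have "i X m \<in> kernel (grp N X) (grp P X) (q X)"
        using ker_q[OF *(1)] *(3) by blast
      then have qi: "i X m \<in> carrier (grp N X)" "q X (i X m) = \<one>\<^bsub>grp P X\<^esub>"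
        by (auto simp: kernel_def)
      have "on_hom L N P q X' y = act (on_ob L P) X' (F X) p (unit P X (q X (i X m)))"
        using L_elt[OF M N i X' *(1,2,3)] L_elt[OF N P q X' *(1,2) qi(1)] x *(4) by simp
      also have "unit P X (q X (i X m)) = \<one>\<^bsub>grp (on_ob L P) (F X)\<^esub>"
        using hom_one[OF unit_hom[OF P *(1)] cmodule_group[OF P *(1)] cmodule_group[OF LP F_closed[OF *(1)]]]
        by (simp add: qi)
      finally show "y \<in> kernel (grp (on_ob L N) X') (grp (on_ob L P) X') (on_hom L N P q X')"
        using act_one[OF LP X' F_closed[OF *(1)] *(2)] x by (simp add: kernel_def)
    qed
  qed
qed

end

lemma (in retract_cofinal) exact_left_adjoint:
  fixes L :: "(('o, 'm, 'g) cmod, 'o \<Rightarrow> 'g \<Rightarrow> 'g, ('p, 'm, 'g) cmod, 'p \<Rightarrow> 'g \<Rightarrow> 'g) functor_data"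
  assumes adj: "left_adjoint (mod_cat C) (mod_cat D) L G"
    and small: "infinite (UNIV :: 'g set)" "Ob C \<lesssim> (UNIV :: 'g set)"
      "\<And>X' Y'. \<lbrakk>X' \<in> Ob D; Y' \<in> Ob D\<rbrakk> \<Longrightarrow> Hom D X' Y' \<lesssim> (UNIV :: 'g set)"
  shows "exact_functor C D L"
proof -
  from adj[unfolded left_adjoint_def mod_cat_simps(1,2)] have "\<exists>\<Phi>. retract_cofinal_adjoint D C F L \<Phi>"
    by (elim conjE exE, rename_tac \<Phi>, rule_tac x = \<Phi> in exI)
      (rule retract_cofinal_adjoint.intro[OF retract_cofinal_axioms retract_cofinal_adjoint_axioms.intro],
        simp_all only: mem_Collect_eq Ball_def)
  then show ?thesis
    using retract_cofinal_adjoint.exact_L small by blast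
qed

section \<open>One-dimensional CW-complexes\<close>

lemma cw_Hausdorff: "cw_complex_1_on X V E \<Longrightarrow> Hausdorff_space X"
  by (simp add: cw_complex_1_on_def)

lemma cw_edge_cont: "cw_complex_1_on X V E \<Longrightarrow> e \<in> E \<Longrightarrow> continuous_map (top_of_set {0..1}) X e"
  by (simp add: cw_complex_1_on_def)

lemma cw_edge_in: "cw_complex_1_on X V E \<Longrightarrow> e \<in> E \<Longrightarrow> t \<in> {0..1} \<Longrightarrow> e t \<in> topspace X"
  using continuous_map_image_subset_topspace[OF cw_edge_cont] by fastforce

lemma cw_compactin_edge:
  assumes "cw_complex_1_on X V E" "e \<in> E" "compact A" "A \<subseteq> {0..1}"
  shows "compactin X (e ` A)"
  using image_compactin[OF _ cw_edge_cont[OF assms(1,2)]] assms(3,4) by (simp add: compactin_subtopology)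

lemma cw_weak_topology:
  assumes "cw_complex_1_on X V E" "C \<subseteq> topspace X" "\<And>e. e \<in> E \<Longrightarrow> closedin X (C \<inter> e ` {0..1})"
  shows "closedin X C"
proof -
  have "\<forall>C. C \<subseteq> topspace X \<longrightarrow> (closedin X C \<longleftrightarrow> (\<forall>e\<in>E. closedin X (C \<inter> e ` {0..1})))"
    using assms(1) unfolding cw_complex_1_on_def by (elim conjE)
  then show ?thesis
    using assms(2,3) by blast
qed

text \<open>A closed subset of the unit interval is compact, so its image under an edge is compact
  and hence closed in the Hausdorff space \<open>X\<close>. This lets the weak topology be tested on
  preimages in the interval.\<close>

lemma cw_closedin_iff:
  assumes cw: "cw_complex_1_on X V E" and C: "C \<subseteq> topspace X"
  shows "closedin X C \<longleftrightarrow> (\<forall>e\<in>E. closedin (top_of_set {0..1}) {t\<in>{0..1}. e t \<in> C})"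
proof
  assume "closedin X C"
  show "\<forall>e\<in>E. closedin (top_of_set {0..1}) {t\<in>{0..1}. e t \<in> C}"
  proof
    fix e assume "e \<in> E"
    note cw_edge_cont[OF cw this]
    from closedin_continuous_map_preimage[OF this \<open>closedin X C\<close>]
    show "closedin (top_of_set {0..1}) {t\<in>{0..1}. e t \<in> C}"
      by simp
  qed
next
  assume R: "\<forall>e\<in>E. closedin (top_of_set {0..1}) {t\<in>{0..1}. e t \<in> C}"
  have "closedin X (C \<inter> e ` {0..1})" if "e \<in> E" for e
  proof -
    have "compact {t\<in>{0..1}. e t \<in> C}"
      using R that closedin_compact[OF compact_Icc] by blast
    then have "compactin X (e ` {t\<in>{0..1}. e t \<in> C})"
      by (rule cw_compactin_edge[OF cw that]) auto
    moreover have "e ` {t\<in>{0..1}. e t \<in> C} = C \<inter> e ` {0..1}"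
      by auto
    ultimately show ?thesis
      using compactin_imp_closedin[OF cw_Hausdorff[OF cw]] by simp
  qed
  then show "closedin X C"
    by (rule cw_weak_topology[OF cw C])
qed

lemma cw_openin_iff:
  assumes cw: "cw_complex_1_on X V E" and U: "U \<subseteq> topspace X"
  shows "openin X U \<longleftrightarrow> (\<forall>e\<in>E. openin (top_of_set {0..1}) {t\<in>{0..1}. e t \<in> U})"
proof -
  have "{t\<in>{0..1}. e t \<in> topspace X - U} = {0..1} - {t\<in>{0..1}. e t \<in> U}" if "e \<in> E" for e
    using cw_edge_in[OF cw that] by auto
  moreover have "openin (top_of_set {0..1}) {t\<in>{0..1}. e t \<in> U} \<longleftrightarrow>
      closedin (top_of_set {0..1}) ({0..1} - {t\<in>{0..1}. e t \<in> U})" for e :: "real \<Rightarrow> 'a"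
    by (subst openin_closedin_eq) auto
  moreover have "openin X U \<longleftrightarrow> closedin X (topspace X - U)"
    using U by (simp add: openin_closedin_eq)
  ultimately show ?thesis
    using cw_closedin_iff[OF cw, of "topspace X - U"] by simp
qed

text \<open>A path component of an open set is open because its preimage under each edge is: around
  every point of that preimage an interval is mapped into the open set, and its image is a path
  connected set meeting the component.\<close>

lemma cw_locally_path_connected:
  assumes cw: "cw_complex_1_on X V E"
  shows "locally_path_connected_space X"
  unfolding locally_path_connected_space_open_path_components
proof (intro allI impI, elim conjE)
  fix U C
  assume U: "openin X U" and C: "C \<in> path_components_of (subtopology X U)"
  have CU: "C \<subseteq> U" and CX: "C \<subseteq> topspace X"
    using path_components_of_subset[OF C] by auto
  have "openin (top_of_set {0..1}) {t\<in>{0..1}. e t \<in> C}" if e: "e \<in> E" for e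
  proof (subst openin_subopen, intro ballI)
    note cont = cw_edge_cont[OF cw e]
    fix t assume "t \<in> {t\<in>{0..1}. e t \<in> C}"
    then have t: "t \<in> {0..1}" "e t \<in> C" by auto
    have "openin (top_of_set {0..1}) {s\<in>{0..1}. e s \<in> U}"
      using openin_continuous_map_preimage[OF cont U] by simp
    then obtain d where d: "0 < d" "ball t d \<inter> {0..1} \<subseteq> {s\<in>{0..1}. e s \<in> U}"
      using t CU unfolding openin_contains_ball by blast
    have "path_connected (ball t d \<inter> {0..1})"
      by (intro convex_imp_path_connected convex_Int convex_ball convex_closed_interval)
    then have "path_connectedin (top_of_set {0..1}) (ball t d \<inter> {0..1})"
      by (simp add: path_connectedin_subtopology)
    from path_connectedin_continuous_map_image[OF cont this]
    have "path_connectedin (subtopology X U) (e ` (ball t d \<inter> {0..1}))"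
      using d by (auto simp: path_connectedin_subtopology)
    moreover have "\<not> disjnt C (e ` (ball t d \<inter> {0..1}))"
      using t d by (auto simp: disjnt_iff)
    ultimately have "e ` (ball t d \<inter> {0..1}) \<subseteq> C"
      using path_components_of_maximal[OF C] by blast
    then show "\<exists>T. openin (top_of_set {0..1}) T \<and> t \<in> T \<and> T \<subseteq> {t\<in>{0..1}. e t \<in> C}"
      using t d by (intro exI[of _ "ball t d \<inter> {0..1}"]) (auto simp: openin_open intro!: exI[of _ "ball t d"])
  qed
  then show "openin X C"
    using cw_openin_iff[OF cw CX] by blast
qed

text \<open>One point of \<open>L\<close> is chosen in each open cell that meets \<open>L\<close>.
  Each edge contains at most one of these points, so by the weak topology every subset of the set
  \<open>D\<close> of chosen points is closed. A set of this kind inside a compact set has no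
  accumulation point and is finite.\<close>

lemma cw_compactin_finite_edges:
  assumes cw: "cw_complex_1_on X V E" and L: "compactin X L"
  shows "finite {e\<in>E. e ` {0<..<1} \<inter> L \<noteq> {}}"
proof -
  define Q where "Q = {e\<in>E. e ` {0<..<1} \<inter> L \<noteq> {}}"
  have "\<forall>e\<in>Q. \<exists>t. 0 < t \<and> t < 1 \<and> e t \<in> L"
    unfolding Q_def by fastforce
  from bchoice[OF this] obtain \<tau> where \<tau>: "\<And>e. e \<in> Q \<Longrightarrow> 0 < \<tau> e \<and> \<tau> e < 1 \<and> e (\<tau> e) \<in> L"
    by blast
  have cells: "\<forall>d\<in>E. \<forall>e\<in>E. d \<noteq> e \<longrightarrow> d ` {0<..<1} \<inter> e ` {0<..<1} = {}"
    using cw unfolding cw_complex_1_on_def by (elim conjE)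
  have disj: "d = e" if "d \<in> E" "e \<in> E" "s \<in> {0<..<1}" "t \<in> {0<..<1}" "d s = e t" for d e s t
  proof (rule ccontr)
    assume "d \<noteq> e"
    then have "d ` {0<..<1} \<inter> e ` {0<..<1} = {}"
      using cells that(1,2) by simp
    moreover have "d s \<in> d ` {0<..<1}" "d s \<in> e ` {0<..<1}"
      using imageI[OF that(3), of d] imageI[OF that(4), of e] that(5) by simp_all
    ultimately show False
      by blast
  qed
  have endp: "e t \<noteq> d s" if "d \<in> E" "e \<in> E" "s = 0 \<or> s = 1" "t \<in> {0<..<1}" for d e s t
  proof -
    have "d s \<in> V" "e ` {0<..<1} \<inter> V = {}"
      using cw that by (auto simp: cw_complex_1_on_def)
    moreover have "e t \<in> e ` {0<..<1}"
      using that(4) by (rule imageI)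
    ultimately show ?thesis
      by (metis IntI empty_iff)
  qed
  have inj: "s = t" if "e \<in> E" "s \<in> {0<..<1}" "t \<in> {0<..<1}" "e s = e t" for e s t
  proof -
    have "embedding_map (top_of_set {0<..<1}) X e"
      using cw that by (simp add: cw_complex_1_on_def)
    from homeomorphic_imp_injective_map[OF this[unfolded embedding_map_def]]
    have "inj_on e {0<..<1}"
      by simp
    then show ?thesis
      using that by (auto dest: inj_onD)
  qed
  define D where "D = (\<lambda>e. e (\<tau> e)) ` Q"
  have D: "D \<subseteq> L"
    unfolding D_def using \<tau> by (intro image_subsetI) simp
  have closed: "closedin X D'" if "D' \<subseteq> D" for D'
  proof -
    have "closedin (top_of_set {0..1}) {t\<in>{0..1}. d t \<in> D'}" if d: "d \<in> E" for d
    proof -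
      have "t = \<tau> d" if t: "t \<in> {0..1}" "d t \<in> D" for t
      proof -
        obtain e where e: "e \<in> Q" "d t = e (\<tau> e)"
          using t(2) unfolding D_def by (rule imageE)
        then have eE: "e \<in> E" "\<tau> e \<in> {0<..<1}"
          using \<tau>[OF e(1)] by (simp_all add: Q_def)
        have "t \<noteq> 0" "t \<noteq> 1"
          using endp[OF d eE(1) _ eE(2), of t] e(2) by auto
        then have t': "t \<in> {0<..<1}"
          using t(1) by simp
        then have "d = e"
          using disj[OF d eE(1) _ eE(2)] e(2) by simp
        then show ?thesis
          using inj[OF d t'] eE(2) e(2) by simp
      qed
      then have "{t\<in>{0..1}. d t \<in> D'} \<subseteq> {\<tau> d}"
        using subsetD[OF \<open>D' \<subseteq> D\<close>] by blast
      then have "finite {t\<in>{0..1}. d t \<in> D'}"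
        by (rule finite_subset) simp
      then show ?thesis
        by (intro closed_subset finite_imp_closed) auto
    qed
    moreover have "D' \<subseteq> topspace X"
      using that D compactin_subset_topspace[OF L] by simp
    ultimately show ?thesis
      by (intro iffD2[OF cw_closedin_iff[OF cw]] ballI)
  qed
  have "finite D"
  proof (rule ccontr)
    assume "infinite D"
    then have "L \<inter> X derived_set_of D \<noteq> {}"
      using compactin_imp_Bolzano_Weierstrass[OF L, of D] D by simp
    then obtain x where x: "x \<in> X derived_set_of D"
      by auto
    let ?U = "topspace X - (D - {x})"
    have "closedin X (D - {x})"
      by (rule closed) simp
    then have "openin X ?U"
      by (intro openin_diff) auto
    moreover have "x \<in> ?U"
      using x by (simp add: in_derived_set_of)
    ultimately obtain y where "y \<noteq> x" "y \<in> D" "y \<in> ?U"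
      using x unfolding in_derived_set_of by meson
    then show False
      by simp
  qed
  moreover have "inj_on (\<lambda>e. e (\<tau> e)) Q"
  proof (rule inj_onI)
    show "d = e" if "d \<in> Q" "e \<in> Q" "d (\<tau> d) = e (\<tau> e)" for d e
      using disj[of d e "\<tau> d" "\<tau> e"] \<tau>[OF that(1)] \<tau>[OF that(2)] that by (simp add: Q_def)
  qed
  ultimately show ?thesis
    unfolding D_def Q_def[symmetric] by (rule finite_imageD)
qed

text \<open>A finite union of edges is compact and has an open neighbourhood \<open>U\<close> inside
  a compact set \<open>L\<close>. The preimage of \<open>U\<close> under an edge is open in the unit
  interval, so an edge that meets \<open>U\<close> even in an end point also meets \<open>L\<close>
  in its open cell; only finitely many edges do so.\<close>

lemma cw_step:
  assumes cw: "cw_complex_1_on X V E" and lc: "locally_compact_space X"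
    and S: "finite S" "S \<subseteq> E"
  obtains S' U where "finite S'" "S \<subseteq> S'" "S' \<subseteq> E" "openin X U" "(\<Union>e\<in>S. e ` {0..1}) \<subseteq> U"
    "\<forall>e\<in>E. e ` {0..1} \<inter> U \<noteq> {} \<longrightarrow> e \<in> S'"
proof -
  note cont = cw_edge_cont[OF cw] and cw_compactin_edge[OF cw _ compact_Icc order_refl]
  then have "compactin X (\<Union>e\<in>S. e ` {0..1})"
    using S by (intro compactin_Union) auto
  then obtain U L where U: "openin X U" "compactin X L" "(\<Union>e\<in>S. e ` {0..1}) \<subseteq> U" "U \<subseteq> L"
    using lc locally_compact_space_compact_closed_compact[OF disjI1[OF cw_Hausdorff[OF cw]]] by metis
  have "e ` {0<..<1} \<inter> L \<noteq> {}" if e: "e \<in> E" "e ` {0..1} \<inter> U \<noteq> {}" for e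
  proof -
    obtain t where t: "t \<in> {0..1}" "e t \<in> U"
      using e(2) by blast
    have "openin (top_of_set {0..1}) {s\<in>{0..1}. e s \<in> U}"
      using openin_continuous_map_preimage[OF cont[OF e(1)] U(1)] by simp
    then obtain d where d: "0 < d" "ball t d \<inter> {0..1} \<subseteq> {s\<in>{0..1}. e s \<in> U}"
      using t unfolding openin_contains_ball by blast
    have "\<exists>s. \<bar>s - t\<bar> < d \<and> 0 < s \<and> s < 1"
    proof (cases "t < 1")
      case True
      then obtain s where "t < s" "s < min 1 (t + d)"
        using d dense[of t "min 1 (t + d)"] by auto
      then show ?thesis
        using t by (intro exI[of _ s]) auto
    next
      case False
      then obtain s where "max 0 (t - d) < s" "s < 1"
        using d t dense[of "max 0 (t - d)" 1] by auto
      then show ?thesis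
        using t False by (intro exI[of _ s]) auto
    qed
    then obtain s where "s \<in> ball t d \<inter> {0..1}" "s \<in> {0<..<1}"
      by (auto simp: dist_real_def abs_minus_commute)
    then show ?thesis
      using d U(4) by blast
  qed
  then show thesis
    using that[of "S \<union> {e\<in>E. e ` {0<..<1} \<inter> L \<noteq> {}}" U] U S cw_compactin_finite_edges[OF cw U(2)] by auto
qed

text \<open>Iterating \<open>cw_step\<close> from one edge gives growing finite subcomplexes, each
  having a neighbourhood all of whose edges belong to the next stage. Their union is open and
  closed, so connectedness makes it the whole space.\<close>

lemma cw_exhaustion:
  assumes cw: "cw_complex_1_on X V E" and lc: "locally_compact_space X" and conn: "connected_space X"
  obtains K :: "nat \<Rightarrow> 'a set" where "\<And>n. compactin X (K n)" "incseq K" "\<And>C. compactin X C \<Longrightarrow> \<exists>n. C \<subseteq> K n"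
proof -
  define b where "b S = (\<Union>e\<in>S. e ` {0..1::real})" for S :: "(real \<Rightarrow> 'a) set"
  define P where "P S \<longleftrightarrow> finite S \<and> S \<subseteq> E \<and> S \<noteq> {}" for S
  define Q where "Q S S' \<longleftrightarrow>
    S \<subseteq> S' \<and> (\<exists>U. openin X U \<and> b S \<subseteq> U \<and> (\<forall>e\<in>E. e ` {0..1} \<inter> U \<noteq> {} \<longrightarrow> e \<in> S'))" for S S'
  have "\<exists>S. P S"
  proof -
    obtain e where "e \<in> E"
      using cw by (auto simp: cw_complex_1_on_def)
    then show ?thesis
      unfolding P_def by (intro exI[of _ "{e}"]) simp
  qed
  moreover have "\<exists>S'. P S' \<and> Q S S'" if "P S" for S
  proof -
    have S: "finite S" "S \<subseteq> E" "S \<noteq> {}"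
      using that by (auto simp: P_def)
    obtain S' U where 1: "finite S'" "S \<subseteq> S'" "S' \<subseteq> E" "openin X U" "(\<Union>e\<in>S. e ` {0..1}) \<subseteq> U"
      and 2: "\<forall>e\<in>E. e ` {0..1} \<inter> U \<noteq> {} \<longrightarrow> e \<in> S'"
      by (rule cw_step[OF cw lc S(1,2)])
    have "Q S S'"
      unfolding Q_def b_def by (intro exI[of _ U] conjI 1 2)
    moreover have "P S'"
      using 1 S(3) by (auto simp: P_def)
    ultimately show ?thesis
      by (intro exI[of _ S'] conjI)
  qed
  ultimately obtain S where PS: "\<And>n. P (S n)" and QS: "\<And>n. Q (S n) (S (Suc n))"
    using dependent_nat_choice[of "\<lambda>_. P" "\<lambda>_. Q"] by metis
  have SE: "S n \<subseteq> E" and fin: "finite (S n)" and ne: "S n \<noteq> {}" for n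
    using PS[of n] by (auto simp: P_def)
  have mono: "incseq S"
    using QS by (intro incseq_SucI) (simp add: Q_def)
  have "\<forall>n. \<exists>U. openin X U \<and> b (S n) \<subseteq> U \<and> (\<forall>e\<in>E. e ` {0..1} \<inter> U \<noteq> {} \<longrightarrow> e \<in> S (Suc n))"
    using QS by (simp add: Q_def)
  from choice[OF this] obtain U where U': "\<forall>n. openin X (U n) \<and> b (S n) \<subseteq> U n \<and>
      (\<forall>e\<in>E. e ` {0..1} \<inter> U n \<noteq> {} \<longrightarrow> e \<in> S (Suc n))" ..
  have U: "openin X (U n)" "b (S n) \<subseteq> U n" and US': "\<lbrakk>e \<in> E; e ` {0..1} \<inter> U n \<noteq> {}\<rbrakk> \<Longrightarrow> e \<in> S (Suc n)" for n e
    using U' by simp_all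
  have b_edge: "e t \<in> b (S n)" if "e \<in> S n" "t \<in> {0..1}" for e t n
    using that unfolding b_def by (intro UN_I[of e] imageI)
  define Z where "Z = (\<Union>n. b (S n))"
  have ZX: "Z \<subseteq> topspace X"
  proof
    fix x assume "x \<in> Z"
    then obtain n where "x \<in> b (S n)"
      unfolding Z_def by (rule UN_E)
    then show "x \<in> topspace X"
      using U[of n] openin_subset by (metis subsetD)
  qed
  \<comment> \<open>An edge that meets \<open>Z\<close> in one point belongs to a later stage and so
    lies in \<open>Z\<close> entirely. Its preimage is all or nothing, which is both open and
    closed.\<close>
  have "{t\<in>{0..1}. e t \<in> Z} = (if e \<in> (\<Union>n. S n) then {0..1} else {})" if e: "e \<in> E" for e
  proof -
    have "e \<in> (\<Union>n. S n)" if t: "t \<in> {0..1}" "e t \<in> Z" for t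
    proof -
      obtain n where "e t \<in> b (S n)"
        using t(2) unfolding Z_def by (rule UN_E)
      then have "e t \<in> e ` {0..1} \<inter> U n"
        using subsetD[OF U(2)[of n]] imageI[OF t(1), of e] by simp
      then have "e \<in> S (Suc n)"
        by (intro US'[OF e]) (metis empty_iff)
      then show ?thesis
        by (rule UN_I[OF UNIV_I])
    qed
    moreover have "e t \<in> Z" if t: "t \<in> {0..1}" "e \<in> (\<Union>n. S n)" for t
    proof -
      obtain n where "e \<in> S n"
        using t(2) by (rule UN_E)
      then show ?thesis
        unfolding Z_def by (intro UN_I[OF UNIV_I] b_edge t(1))
    qed
    ultimately show ?thesis
      by (cases "e \<in> (\<Union>n. S n)") (simp_all only: if_True if_False, blast+)
  qed
  then have "openin X Z \<and> closedin X Z"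
    using cw_openin_iff[OF cw ZX] cw_closedin_iff[OF cw ZX] by (simp add: closedin_subtopology_refl)
  moreover have "Z \<noteq> {}"
  proof -
    obtain e where "e \<in> S 0"
      using ne[of 0] by (metis ex_in_conv)
    then have "e 0 \<in> Z"
      unfolding Z_def by (intro UN_I[OF UNIV_I] b_edge) simp_all
    then show ?thesis
      by (metis empty_iff)
  qed
  ultimately have Z: "Z = topspace X"
    using conn unfolding connected_space_clopen_in by metis
  \<comment> \<open>Now that every point lies on an edge, the neighbourhood of one stage is
    contained in the next stage. A finite subcover by the sets \<open>U n\<close> therefore puts a
    compact set into a single stage.\<close>
  have bU: "U n \<subseteq> b (S (Suc n))" for n
  proof
    fix x assume x: "x \<in> U n"
    then have "x \<in> Z"
      unfolding Z by (rule subsetD[OF openin_subset[OF U(1)]])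
    then obtain m e where e: "e \<in> S m" "x \<in> e ` {0..1}"
      unfolding Z_def b_def by (elim UN_E)
    have "e ` {0..1} \<inter> U n \<noteq> {}"
      using IntI[OF e(2) x] by (metis empty_iff)
    with subsetD[OF SE e(1)] have "e \<in> S (Suc n)"
      by (rule US')
    then show "x \<in> b (S (Suc n))"
      unfolding b_def by (rule UN_I) (rule e(2))
  qed
  show thesis
  proof
    show "compactin X (b (S n))" for n
      unfolding b_def
    proof (rule compactin_Union)
      show "finite ((\<lambda>e. e ` {0..1::real}) ` S n)"
        using fin by simp
      show "compactin X T" if T: "T \<in> (\<lambda>e. e ` {0..1}) ` S n" for T
      proof -
        obtain e where "T = e ` {0..1}" "e \<in> S n"
          using T by (rule imageE)
        then show ?thesis
          using cw_compactin_edge[OF cw subsetD[OF SE] compact_Icc order_refl] by simp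
      qed
    qed
    show "incseq (\<lambda>n. b (S n))"
      using mono unfolding incseq_def b_def by (intro allI impI UN_mono) auto
    show "\<exists>n. C \<subseteq> b (S n)" if C: "compactin X C" for C
    proof -
      have "C \<subseteq> (\<Union>n. b (S n))"
        using compactin_subset_topspace[OF C] unfolding Z[symmetric] Z_def .
      also have "\<dots> \<subseteq> \<Union>(range U)"
        by (rule UN_mono) (auto simp: U(2))
      finally have "\<exists>\<F>. finite \<F> \<and> \<F> \<subseteq> range U \<and> C \<subseteq> \<Union>\<F>"
        using C U(1) unfolding compactin_def by simp
      then obtain I where I: "finite I" "C \<subseteq> (\<Union>n\<in>I. U n)"
        by (metis finite_subset_image)
      have N: "n \<le> Max I" if "n \<in> I" for n
        using I(1) that by (rule Max_ge)
      have "U n \<subseteq> b (S (Suc (Max I)))" if "n \<in> I" for n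
        by (rule order_trans[OF bU[of n]], unfold b_def)
          (intro UN_mono incseqD[OF mono] Suc_le_mono[THEN iffD2] N[OF that] order_refl)
      then show ?thesis
        using I(2) by (intro exI[of _ "Suc (Max I)"]) blast
    qed
  qed
qed

section \<open>Components of complements and ends\<close>

lemma pi0_compl_nonempty: "W \<in> pi0_compl T K \<Longrightarrow> W \<noteq> {}"
  unfolding pi0_compl_def by (rule nonempty_path_components_of)

lemma pi0_compl_subset: "W \<in> pi0_compl T K \<Longrightarrow> W \<subseteq> topspace T - K"
  using path_components_of_subset[of W "subtopology T (topspace T - K)"] by (auto simp: pi0_compl_def)

lemma pi0_compl_path_connectedin: "W \<in> pi0_compl T K \<Longrightarrow> path_connectedin T W"
  using path_connectedin_path_components_of[of W "subtopology T (topspace T - K)"]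
  by (simp add: pi0_compl_def path_connectedin_subtopology)

lemma pi0_compl_unique: "W \<in> pi0_compl T K \<Longrightarrow> W' \<in> pi0_compl T K \<Longrightarrow> x \<in> W \<Longrightarrow> x \<in> W' \<Longrightarrow> W = W'"
  unfolding pi0_compl_def using path_components_of_overlap by (metis IntI empty_iff)

lemma pi0_compl_exists: "x \<in> topspace T \<Longrightarrow> x \<notin> K \<Longrightarrow> \<exists>W\<in>pi0_compl T K. x \<in> W"
  using Union_path_components_of[of "subtopology T (topspace T - K)"] unfolding pi0_compl_def by auto

lemma pi0_compl_maximal:
  assumes "W \<in> pi0_compl T K" "path_connectedin T S" "S \<inter> K = {}" "x \<in> S" "x \<in> W"
  shows "S \<subseteq> W"
  using assms path_connectedin_subset_topspace[OF assms(2)]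
  by (intro path_components_of_maximal[of W "subtopology T (topspace T - K)"])
    (auto simp: pi0_compl_def path_connectedin_subtopology disjnt_iff)

lemma pi0_compl_mono:
  assumes "K \<subseteq> L" "W \<in> pi0_compl T L" "W' \<in> pi0_compl T K" "x \<in> W" "x \<in> W'"
  shows "W \<subseteq> W'"
  using pi0_compl_maximal[OF assms(3) pi0_compl_path_connectedin[OF assms(2)] _ assms(4,5)]
    pi0_compl_subset[OF assms(2)] assms(1) by blast

lemma ends_pi0: "\<epsilon> \<in> ends T \<Longrightarrow> compactin T K \<Longrightarrow> \<epsilon> K \<in> pi0_compl T K"
  by (auto simp: ends_def)

lemma ends_antimono: "\<epsilon> \<in> ends T \<Longrightarrow> compactin T K \<Longrightarrow> compactin T L \<Longrightarrow> K \<subseteq> L \<Longrightarrow> \<epsilon> L \<subseteq> \<epsilon> K"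
  by (auto simp: ends_def)

lemma ends_subset: "\<epsilon> \<in> ends T \<Longrightarrow> compactin T K \<Longrightarrow> \<epsilon> K \<subseteq> topspace T - K"
  by (rule pi0_compl_subset[OF ends_pi0])

lemma ends_eqI:
  assumes "\<epsilon> \<in> ends T" "\<delta> \<in> ends T" "\<And>K. compactin T K \<Longrightarrow> \<epsilon> K = \<delta> K"
  shows "\<epsilon> = \<delta>"
  by (rule PiE_ext[of _ "{K. compactin T K}" "pi0_compl T"]) (use assms in \<open>auto simp: ends_def\<close>)

lemma ends_eq_smaller:
  assumes "\<epsilon> \<in> ends T" "\<delta> \<in> ends T" "compactin T K" "compactin T L" "K \<subseteq> L" "\<epsilon> L = \<delta> L"
  shows "\<epsilon> K = \<delta> K"
proof -
  obtain x where "x \<in> \<epsilon> L"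
    using pi0_compl_nonempty[OF ends_pi0[OF assms(1,4)]] by blast
  then show ?thesis
    using ends_antimono[OF assms(1,3,4,5)] ends_antimono[OF assms(2,3,4,5)] assms(6)
      pi0_compl_unique[OF ends_pi0[OF assms(1,3)] ends_pi0[OF assms(2,3)]] by blast
qed

text \<open>The topological properties of trees on which the treatment of ends rests. The sequence
  of compact sets cofinal among all compact sets is what allows ends to be reached by
  sequences.\<close>

locale end_space =
  fixes T :: "'a topology"
  assumes Hausdorff: "Hausdorff_space T"
    and connected: "connected_space T"
    and locally_path_connected: "locally_path_connected_space T"
    and locally_compact: "locally_compact_space T"
    and ex_exhaustion: "\<exists>K :: nat \<Rightarrow> 'a set.
      (\<forall>n. compactin T (K n)) \<and> incseq K \<and> (\<forall>C. compactin T C \<longrightarrow> (\<exists>n. C \<subseteq> K n))"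
begin

lemma openin_pi0_compl:
  assumes "compactin T K" "W \<in> pi0_compl T K"
  shows "openin T W"
proof -
  have "openin T (topspace T - K)"
    using openin_diff[OF openin_topspace compactin_imp_closedin[OF Hausdorff assms(1)]] .
  then show ?thesis
    using locally_path_connected assms(2)
    unfolding locally_path_connected_space_open_path_components pi0_compl_def by simp
qed

text \<open>Choose \<open>U\<close> open and \<open>L\<close> compact with \<open>K\<close> in
  \<open>U\<close> and \<open>U\<close> in \<open>L\<close>. The components are open and disjoint
  and cover the compact set \<open>L - U\<close>, so finitely many of them meet it. A component that
  avoids \<open>L - U\<close> and leaves \<open>L\<close> avoids \<open>U\<close> by connectedness,
  hence is open and closed.\<close>

lemma finite_large_components:
  assumes K: "compactin T K"
  obtains L where "compactin T L" "K \<subseteq> L" "finite {W \<in> pi0_compl T K. \<not> W \<subseteq> L}"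
proof -
  obtain U L where U: "openin T U" "compactin T L" "K \<subseteq> U" "U \<subseteq> L"
    using locally_compact locally_compact_space_compact_closed_compact[OF disjI1[OF Hausdorff]] K by metis
  have "compactin T (L - U)"
    using closed_compactin[OF U(2)] closedin_diff[OF compactin_imp_closedin[OF Hausdorff U(2)] U(1)] by blast
  moreover have "L - U \<subseteq> \<Union>(pi0_compl T K)"
    using pi0_compl_exists[of _ T K] compactin_subset_topspace[OF U(2)] U(3) by blast
  ultimately have "\<exists>\<F>. finite \<F> \<and> \<F> \<subseteq> pi0_compl T K \<and> L - U \<subseteq> \<Union>\<F>"
    using openin_pi0_compl[OF K] unfolding compactin_def by simp
  then obtain \<F> where \<F>: "finite \<F>" "\<F> \<subseteq> pi0_compl T K" "L - U \<subseteq> \<Union>\<F>"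
    by blast
  \<comment> \<open>The additional element accounts for the clopen case; the whole space can be a
    component of the complement only when \<open>K\<close> is empty.\<close>
  have "W \<in> insert (topspace T) \<F>" if W: "W \<in> pi0_compl T K" "\<not> W \<subseteq> L" for W
  proof (cases "W \<inter> (L - U) = {}")
    case False
    then obtain W' x where x: "W' \<in> \<F>" "x \<in> W'" "x \<in> W"
      using \<F>(3) by blast
    then have "W = W'"
      using \<F>(2) by (intro pi0_compl_unique[OF W(1) _ x(3,2)]) blast
    then show ?thesis
      using x(1) by simp
  next
    case True
    have op: "openin T (U \<union> \<Union>(pi0_compl T K - {W}))"
      using U(1) openin_pi0_compl[OF K] by (intro openin_Un openin_Union) auto
    have "W \<inter> U = {}"
    proof -
      have cW: "connectedin T W"
        by (rule path_connectedin_imp_connectedin[OF pi0_compl_path_connectedin[OF W(1)]])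
      have "openin T (topspace T - L)"
        using openin_diff[OF openin_topspace compactin_imp_closedin[OF Hausdorff U(2)]] .
      moreover have "W \<subseteq> U \<union> (topspace T - L)" "U \<inter> (topspace T - L) \<inter> W = {}" "(topspace T - L) \<inter> W \<noteq> {}"
        using True W pi0_compl_subset[OF W(1)] U(4) by blast+
      ultimately show ?thesis
        using cW U(1) unfolding connectedin by (metis Int_commute)
    qed
    have "topspace T - W = U \<union> \<Union>(pi0_compl T K - {W})"
    proof (intro equalityI subsetI)
      fix y assume "y \<in> topspace T - W"
      then show "y \<in> U \<union> \<Union>(pi0_compl T K - {W})"
        using pi0_compl_exists[of y T K] U(3) by blast
    next
      fix y assume "y \<in> U \<union> \<Union>(pi0_compl T K - {W})"
      then show "y \<in> topspace T - W"
      proof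
        assume "y \<in> U"
        then show ?thesis
          using openin_subset[OF U(1)] \<open>W \<inter> U = {}\<close> by blast
      next
        assume "y \<in> \<Union>(pi0_compl T K - {W})"
        then obtain W' where "W' \<in> pi0_compl T K" "W' \<noteq> W" "y \<in> W'"
          by blast
        then show ?thesis
          using pi0_compl_unique[OF W(1), of W' y] pi0_compl_subset[of W' T K] by auto
      qed
    qed
    then have "closedin T W"
      using op pi0_compl_subset[OF W(1)] by (auto simp: closedin_def)
    then have "W = topspace T"
      using connected openin_pi0_compl[OF K W(1)] pi0_compl_nonempty[OF W(1)]
      unfolding connected_space_clopen_in by meson
    then show ?thesis
      by simp
  qed
  then have "{W \<in> pi0_compl T K. \<not> W \<subseteq> L} \<subseteq> insert (topspace T) \<F>"
    by blast
  then have "finite {W \<in> pi0_compl T K. \<not> W \<subseteq> L}"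
    using \<F>(1) by (meson finite_insert finite_subset)
  then show thesis
    using that U by blast
qed

text \<open>An end is determined along a cofinal sequence of compact sets: over any compact
  \<open>C\<close> its value is the component containing \<open>W m\<close> for some
  \<open>K m\<close> that contains \<open>C\<close>. Comparison at the larger of two indices shows
  that the choice of \<open>m\<close> is immaterial.\<close>

lemma ex_end_of_chain:
  assumes K: "\<And>n. compactin T (K n)" "incseq K" "\<And>C. compactin T C \<Longrightarrow> \<exists>n. C \<subseteq> K n"
    and W: "\<And>n. W n \<in> pi0_compl T (K n)" "decseq W"
  obtains \<epsilon> where "\<epsilon> \<in> ends T" "\<And>n C. compactin T C \<Longrightarrow> C \<subseteq> K n \<Longrightarrow> W n \<subseteq> \<epsilon> C"
proof -
  have "\<exists>W'. W' \<in> pi0_compl T C \<and> (\<forall>n. C \<subseteq> K n \<longrightarrow> W n \<subseteq> W')" if C: "compactin T C" for C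
  proof -
    obtain m where m: "C \<subseteq> K m"
      using K(3)[OF C] by blast
    obtain x where "x \<in> W m"
      using pi0_compl_nonempty[OF W(1)] by blast
    then obtain W' where W': "W' \<in> pi0_compl T C" "x \<in> W'"
      using pi0_compl_exists[of x T C] pi0_compl_subset[OF W(1)[of m]] m by blast
    have "W n \<subseteq> W'" if n: "C \<subseteq> K n" for n
    proof -
      obtain y where y: "y \<in> W (max m n)"
        using pi0_compl_nonempty[OF W(1)] by blast
      have "W (max m n) \<subseteq> W m" "W (max m n) \<subseteq> W n"
        by (simp_all add: decseqD[OF W(2)])
      moreover have "W m \<subseteq> W'"
        by (rule pi0_compl_mono[OF m W(1) W'(1) \<open>x \<in> W m\<close> W'(2)])
      ultimately show ?thesis
        using y by (intro pi0_compl_mono[OF n W(1) W'(1), of y]) blast+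
    qed
    then show ?thesis
      using W'(1) by blast
  qed
  then obtain \<epsilon> where \<epsilon>: "\<And>C. compactin T C \<Longrightarrow> \<epsilon> C \<in> pi0_compl T C"
    "\<And>C n. compactin T C \<Longrightarrow> C \<subseteq> K n \<Longrightarrow> W n \<subseteq> \<epsilon> C"
    by metis
  have "\<epsilon> D \<subseteq> \<epsilon> C" if CD: "compactin T C" "compactin T D" "C \<subseteq> D" for C D
  proof -
    obtain n where n: "D \<subseteq> K n"
      using K(3)[OF CD(2)] by blast
    obtain x where "x \<in> W n"
      using pi0_compl_nonempty[OF W(1)] by blast
    then show ?thesis
      using \<epsilon>(2)[OF CD(1), of n] \<epsilon>(2)[OF CD(2) n] CD n
      by (intro pi0_compl_mono[OF CD(3) \<epsilon>(1)[OF CD(2)] \<epsilon>(1)[OF CD(1)], of x]) auto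
  qed
  then have "(\<lambda>C\<in>{C. compactin T C}. \<epsilon> C) \<in> ends T"
    using \<epsilon>(1) by (auto simp: ends_def)
  then show thesis
    by (rule that) (simp add: \<epsilon>(2))
qed

text \<open>Sequential compactness of the Freudenthal compactification.\<close>

lemma ex_end_accumulation:
  assumes I: "infinite I" "\<And>i. i \<in> I \<Longrightarrow> x i \<in> topspace T"
    and fin: "\<And>K. compactin T K \<Longrightarrow> finite {i\<in>I. x i \<in> K}"
  shows "\<exists>\<epsilon>\<in>ends T. \<forall>K. compactin T K \<longrightarrow> infinite {i\<in>I. x i \<in> \<epsilon> K}"
proof -
  obtain K :: "nat \<Rightarrow> 'a set" where K: "\<And>n. compactin T (K n)" "incseq K" "\<And>C. compactin T C \<Longrightarrow> \<exists>n. C \<subseteq> K n"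
    using ex_exhaustion by blast
  define P where "P n J W \<longleftrightarrow> infinite J \<and> J \<subseteq> I \<and> W \<in> pi0_compl T (K n) \<and> x ` J \<subseteq> W" for n J W
  \<comment> \<open>Pigeonhole: after discarding the finitely many indices with \<open>x i\<close>
    in \<open>L\<close>, each remaining point lies in one of the finitely many components that leave
    \<open>L\<close>, so one of these contains infinitely many of them.\<close>
  have refine: "\<exists>J' W. P n J' W \<and> J' \<subseteq> J" if J: "infinite J" "J \<subseteq> I" for n J
  proof -
    obtain L where L: "compactin T L" "K n \<subseteq> L" "finite {W \<in> pi0_compl T (K n). \<not> W \<subseteq> L}"
      using finite_large_components[OF K(1)] by blast
    let ?J = "J - {i\<in>I. x i \<in> L}"
    let ?\<W> = "{W \<in> pi0_compl T (K n). \<not> W \<subseteq> L}"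
    have inf: "infinite ?J"
      using J(1) fin[OF L(1)] by (rule Diff_infinite_finite[rotated])
    have "?J \<subseteq> (\<Union>W\<in>?\<W>. {i \<in> ?J. x i \<in> W})"
    proof
      fix i assume i: "i \<in> ?J"
      then have "x i \<in> topspace T" "x i \<notin> L"
        using I(2) J(2) by auto
      then obtain W where W: "W \<in> pi0_compl T (K n)" "x i \<in> W"
        using pi0_compl_exists[of "x i" T "K n"] L(2) by blast
      then have "W \<in> ?\<W>"
        using \<open>x i \<notin> L\<close> by blast
      then show "i \<in> (\<Union>W\<in>?\<W>. {i \<in> ?J. x i \<in> W})"
        by (rule UN_I) (simp add: i W(2) del: Diff_iff)
    qed
    then have "infinite (\<Union>W\<in>?\<W>. {i \<in> ?J. x i \<in> W})"
      by (rule infinite_super) (rule inf)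
    then have "\<exists>W\<in>?\<W>. infinite {i \<in> ?J. x i \<in> W}"
      unfolding finite_UN[OF L(3)] by simp
    then obtain W where "W \<in> ?\<W>" "infinite {i \<in> ?J. x i \<in> W}" ..
    then have "P n {i \<in> ?J. x i \<in> W} W"
      using J(2) unfolding P_def by (simp add: image_subset_iff) (simp add: subset_iff)
    then show ?thesis
      by (intro exI[of _ "{i \<in> ?J. x i \<in> W}"] exI[of _ W]) simp
  qed
  have "\<exists>JW. P 0 (fst JW) (snd JW)"
    using refine[OF I(1) order_refl, of 0] by (metis fst_conv snd_conv)
  moreover have "\<exists>JW'. P (Suc n) (fst JW') (snd JW') \<and> fst JW' \<subseteq> fst JW" if JW: "P n (fst JW) (snd JW)" for n JW
  proof -
    have "infinite (fst JW)" "fst JW \<subseteq> I"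
      using JW by (simp_all add: P_def)
    from refine[OF this, of "Suc n"] show ?thesis
      by (metis fst_conv snd_conv)
  qed
  ultimately obtain JW where JW: "\<And>n. P n (fst (JW n)) (snd (JW n))" "\<And>n. fst (JW (Suc n)) \<subseteq> fst (JW n)"
    using dependent_nat_choice[of "\<lambda>n JW. P n (fst JW) (snd JW)" "\<lambda>_ JW JW'. fst JW' \<subseteq> fst JW"] by metis
  define W where "W n = snd (JW n)" for n
  have W: "W n \<in> pi0_compl T (K n)" for n
    using JW(1)[of n] by (simp add: P_def W_def)
  have xW: "x i \<in> W n" "i \<in> I" if "i \<in> fst (JW n)" for i n
    using JW(1)[of n] that by (auto simp: P_def W_def)
  have "W (Suc n) \<subseteq> W n" for n
  proof -
    obtain i where "i \<in> fst (JW (Suc n))"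
      using JW(1)[of "Suc n"] unfolding P_def by (metis finite.emptyI ex_in_conv)
    then show ?thesis
      using xW JW(2)[of n] incseq_SucD[OF K(2)]
      by (intro pi0_compl_mono[OF _ W W, of "n" "Suc n" "x i"]) auto
  qed
  then have "decseq W"
    by (rule decseq_SucI)
  then obtain \<epsilon> where \<epsilon>: "\<epsilon> \<in> ends T" "\<And>n C. compactin T C \<Longrightarrow> C \<subseteq> K n \<Longrightarrow> W n \<subseteq> \<epsilon> C"
    using ex_end_of_chain[OF K W] by blast
  show ?thesis
  proof (intro bexI[OF _ \<epsilon>(1)] allI impI)
    show "infinite {i\<in>I. x i \<in> \<epsilon> C}" if C: "compactin T C" for C
    proof -
      obtain n where "C \<subseteq> K n"
        using K(3)[OF C] by blast
      then have "fst (JW n) \<subseteq> {i\<in>I. x i \<in> \<epsilon> C}"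
        using xW[of _ n] \<epsilon>(2)[OF C, of n] by blast
      then show ?thesis
        using JW(1)[of n] unfolding P_def by (meson finite_subset)
    qed
  qed
qed

end

lemma tree_end_space:
  assumes "tree T"
  shows "end_space T"
proof -
  obtain V E where cw: "cw_complex_1_on T V E"
    using assms by (auto simp: tree_def cw_complex_1_def)
  have lc: "locally_compact_space T" and conn: "connected_space T"
    using assms by (auto simp: tree_def intro: path_connected_imp_connected_space contractible_imp_path_connected_space)
  obtain K :: "nat \<Rightarrow> 'a set" where "\<And>n. compactin T (K n)" "incseq K" "\<And>C. compactin T C \<Longrightarrow> \<exists>n. C \<subseteq> K n"
    using cw_exhaustion[OF cw lc conn] by blast
  then show ?thesis
    using cw_Hausdorff[OF cw] cw_locally_path_connected[OF cw] lc conn by unfold_locales blast+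
qed

lemma tree_nonempty: "tree T \<Longrightarrow> topspace T \<noteq> {}"
  by (auto simp: tree_def compact_space_def)

section \<open>Proper maps and ends\<close>

lemma proper_cont_preimage:
  "proper_cont T T' f \<Longrightarrow> compactin T' K \<Longrightarrow> compactin T {x \<in> topspace T. f x \<in> K}"
  unfolding proper_cont_def by (elim conjE) (rule compactin_proper_map_preimage)

lemma proper_cont_in: "proper_cont T T' f \<Longrightarrow> x \<in> topspace T \<Longrightarrow> f x \<in> topspace T'"
  unfolding proper_cont_def using continuous_map_image_subset_topspace[of T T' f] by blast

text \<open>The image of a path component over the preimage of \<open>K\<close> is path connected
  and avoids \<open>K\<close>, so it lies in exactly one component. This justifies the definite
  description in \<open>ends_map\<close>.\<close>

lemma ends_map_pi0:
  assumes f: "proper_cont T T' f" and \<epsilon>: "\<epsilon> \<in> ends T" and K: "compactin T' K"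
  shows "ends_map T T' f \<epsilon> K \<in> pi0_compl T' K \<and> f ` \<epsilon> {x \<in> topspace T. f x \<in> K} \<subseteq> ends_map T T' f \<epsilon> K"
proof -
  let ?K = "{x \<in> topspace T. f x \<in> K}"
  let ?W = "\<epsilon> ?K"
  note cK = proper_cont_preimage[OF f K]
  note W = ends_pi0[OF \<epsilon> cK]
  have pc: "path_connectedin T' (f ` ?W)"
    using f by (intro path_connectedin_continuous_map_image[OF _ pi0_compl_path_connectedin[OF W]])
      (simp add: proper_cont_def)
  obtain x where x: "x \<in> ?W"
    using pi0_compl_nonempty[OF W] by blast
  have disj: "f ` ?W \<inter> K = {}"
    using pi0_compl_subset[OF W] by blast
  have "f x \<in> f ` ?W"
    using x by (rule imageI)
  then have "f x \<in> topspace T'" "f x \<notin> K"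
    using disj path_connectedin_subset_topspace[OF pc] by (meson subsetD, meson disjoint_iff)
  then obtain W' where W': "W' \<in> pi0_compl T' K" "f x \<in> W'"
    using pi0_compl_exists[of "f x" T' K] by blast
  have sub: "f ` ?W \<subseteq> W'"
    by (rule pi0_compl_maximal[OF W'(1) pc disj \<open>f x \<in> f ` ?W\<close> W'(2)])
  have "(THE W'. W' \<in> pi0_compl T' K \<and> f ` ?W \<subseteq> W') = W'"
  proof (rule the_equality)
    show "W' \<in> pi0_compl T' K \<and> f ` ?W \<subseteq> W'"
      using W' sub by blast
    show "W'' = W'" if "W'' \<in> pi0_compl T' K \<and> f ` ?W \<subseteq> W''" for W''
    proof (rule pi0_compl_unique)
      show "f x \<in> W''"
        using that \<open>f x \<in> f ` ?W\<close> by (meson subsetD)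
    qed (use that W' in simp_all)
  qed
  then show ?thesis
    using W' sub K by (simp add: ends_map_def)
qed

lemma ends_map_in_ends:
  assumes f: "proper_cont T T' f" and \<epsilon>: "\<epsilon> \<in> ends T"
  shows "ends_map T T' f \<epsilon> \<in> ends T'"
proof -
  have "ends_map T T' f \<epsilon> L \<subseteq> ends_map T T' f \<epsilon> K"
    if KL: "compactin T' K" "compactin T' L" "K \<subseteq> L" for K L
  proof -
    let ?K = "{x \<in> topspace T. f x \<in> K}" and ?L = "{x \<in> topspace T. f x \<in> L}"
    note c = proper_cont_preimage[OF f KL(1)] proper_cont_preimage[OF f KL(2)]
    obtain x where "x \<in> \<epsilon> ?L"
      using pi0_compl_nonempty[OF ends_pi0[OF \<epsilon> c(2)]] by blast
    moreover have "\<epsilon> ?L \<subseteq> \<epsilon> ?K"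
      using KL(3) by (intro ends_antimono[OF \<epsilon> c]) auto
    ultimately show ?thesis
      using ends_map_pi0[OF f \<epsilon> KL(1)] ends_map_pi0[OF f \<epsilon> KL(2)]
      by (intro pi0_compl_mono[OF KL(3), of _ T' _ "f x"]) (simp_all, blast+)
  qed
  moreover have "ends_map T T' f \<epsilon> \<in> (\<Pi>\<^sub>E K\<in>{K. compactin T' K}. pi0_compl T' K)"
  proof (rule PiE_I)
    show "ends_map T T' f \<epsilon> K = undefined" if "K \<notin> {K. compactin T' K}" for K
      using that by (simp add: ends_map_def)
  qed (simp add: ends_map_pi0[OF f \<epsilon>])
  ultimately show ?thesis
    by (simp add: ends_def)
qed

section \<open>Neighbourhoods of ends\<close>

definition end_nbhd :: "'a topology \<Rightarrow> ('a set \<Rightarrow> 'a set) \<Rightarrow> 'a set \<Rightarrow> ('a + ('a set \<Rightarrow> 'a set)) set" where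
  "end_nbhd T \<epsilon> K = Inl ` \<epsilon> K \<union> Inr ` {\<delta> \<in> ends T. \<delta> K = \<epsilon> K}"

lemma Inl_in_end_nbhd [simp]: "Inl x \<in> end_nbhd T \<epsilon> K \<longleftrightarrow> x \<in> \<epsilon> K"
  by (auto simp: end_nbhd_def)

lemma end_nbhd_antimono:
  assumes "\<epsilon> \<in> ends T" "compactin T K" "compactin T L" "K \<subseteq> L"
  shows "end_nbhd T \<epsilon> L \<subseteq> end_nbhd T \<epsilon> K"
proof -
  have "\<delta> K = \<epsilon> K" if "\<delta> \<in> ends T" "\<delta> L = \<epsilon> L" for \<delta>
    by (rule ends_eq_smaller[OF that(1) assms that(2)])
  then have "{\<delta> \<in> ends T. \<delta> L = \<epsilon> L} \<subseteq> {\<delta> \<in> ends T. \<delta> K = \<epsilon> K}"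
    by (intro Collect_mono impI) simp
  then show ?thesis
    unfolding end_nbhd_def by (intro Un_mono image_mono ends_antimono[OF assms])
qed

lemma openin_end_nbhd:
  assumes "\<epsilon> \<in> ends T" "compactin T K"
  shows "openin (freudenthal T) (end_nbhd T \<epsilon> K)"
  unfolding freudenthal_def end_nbhd_def
  by (intro topology_generated_by_Basis UnI2 CollectI exI[of _ K] exI[of _ "\<epsilon> K"] conjI refl assms(2)
      ends_pi0[OF assms])

text \<open>Induction over the generated topology. A generator coming from an open set of
  \<open>T\<close> contains no end, a generator containing \<epsilon> is already a basic
  neighbourhood of \<epsilon>, and for intersections the union of the two compact sets
  serves.\<close>

lemma freudenthal_end_basis:
  assumes \<epsilon>: "\<epsilon> \<in> ends T" and N: "openin (freudenthal T) N" "Inr \<epsilon> \<in> N"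
  shows "\<exists>K. compactin T K \<and> end_nbhd T \<epsilon> K \<subseteq> N"
proof -
  have "generate_topology_on ({Inl ` U |U. openin T U} \<union>
      {Inl ` W \<union> Inr ` {\<epsilon> \<in> ends T. \<epsilon> K = W} |K W. compactin T K \<and> W \<in> pi0_compl T K}) N"
    using N(1) unfolding freudenthal_def openin_topology_generated_by_iff .
  then show ?thesis
    using N(2)
  proof induction
    case (Int A B)
    then obtain K L where KL: "compactin T K" "end_nbhd T \<epsilon> K \<subseteq> A" "compactin T L" "end_nbhd T \<epsilon> L \<subseteq> B"
      by blast
    note c = compactin_Un[OF KL(1,3)]
    have "end_nbhd T \<epsilon> (K \<union> L) \<subseteq> A" "end_nbhd T \<epsilon> (K \<union> L) \<subseteq> B"
      using order_trans[OF end_nbhd_antimono[OF \<epsilon> KL(1) c] KL(2)]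
        order_trans[OF end_nbhd_antimono[OF \<epsilon> KL(3) c] KL(4)] by simp_all
    then show ?case
      using c by (intro exI[of _ "K \<union> L"]) simp
  next
    case (UN \<U>)
    then obtain A where "A \<in> \<U>" "Inr \<epsilon> \<in> A"
      by blast
    then show ?case
      using UN.IH[of A] by blast
  next
    case (Basis A)
    then obtain K where "compactin T K" "\<epsilon> \<in> ends T" "A = Inl ` \<epsilon> K \<union> Inr ` {\<delta> \<in> ends T. \<delta> K = \<epsilon> K}"
      by auto
    then show ?case
      unfolding end_nbhd_def by (intro exI[of _ K]) simp
  qed simp
qed

lemma nbhd_end_iff:
  assumes \<epsilon>: "\<epsilon> \<in> ends T"
  shows "nbhd (freudenthal T) (Inr \<epsilon>) U \<longleftrightarrow>
    U \<subseteq> topspace (freudenthal T) \<and> (\<exists>K. compactin T K \<and> end_nbhd T \<epsilon> K \<subseteq> U)"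
proof -
  have "Inr \<epsilon> \<in> end_nbhd T \<epsilon> K" for K
    using \<epsilon> by (simp add: end_nbhd_def)
  then show ?thesis
    unfolding nbhd_def
  proof (intro conj_cong iffI refl)
    assume "\<exists>N. openin (freudenthal T) N \<and> Inr \<epsilon> \<in> N \<and> N \<subseteq> U"
    then obtain N where N: "openin (freudenthal T) N" "Inr \<epsilon> \<in> N" "N \<subseteq> U"
      by blast
    then show "\<exists>K. compactin T K \<and> end_nbhd T \<epsilon> K \<subseteq> U"
      using freudenthal_end_basis[OF \<epsilon> N(1,2)] by (meson order_trans)
  next
    assume "\<exists>K. compactin T K \<and> end_nbhd T \<epsilon> K \<subseteq> U"
    then obtain K where "compactin T K" "end_nbhd T \<epsilon> K \<subseteq> U"
      by blast
    then show "\<exists>N. openin (freudenthal T) N \<and> Inr \<epsilon> \<in> N \<and> N \<subseteq> U"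
      using openin_end_nbhd[OF \<epsilon>] \<open>Inr \<epsilon> \<in> end_nbhd T \<epsilon> K\<close> by (intro exI[of _ "end_nbhd T \<epsilon> K"]) simp
  qed
qed

lemma nbhd_end_nbhd:
  assumes "\<epsilon> \<in> ends T" "compactin T K"
  shows "nbhd (freudenthal T) (Inr \<epsilon>) (end_nbhd T \<epsilon> K)"
  unfolding nbhd_end_iff[OF assms(1)] using openin_subset[OF openin_end_nbhd[OF assms]] assms(2) by blast

section \<open>Free modules\<close>

lemma free_mod_simps [simp]:
  "zero (free_mod R A) = (\<lambda>b. \<zero>\<^bsub>R\<^esub>)"
  "add (free_mod R A) = (\<lambda>v w b. v b \<oplus>\<^bsub>R\<^esub> w b)"
  "smult (free_mod R A) = (\<lambda>r v b. r \<otimes>\<^bsub>R\<^esub> v b)"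
  by (simp_all add: free_mod_def)

lemma carrier_free_mod:
  "v \<in> carrier (free_mod R A) \<longleftrightarrow>
    (\<forall>b. v b \<in> carrier R) \<and> (\<forall>b. b \<notin> A \<longrightarrow> v b = \<zero>\<^bsub>R\<^esub>) \<and> finite {b. v b \<noteq> \<zero>\<^bsub>R\<^esub>}"
  by (simp add: free_mod_def)

lemma free_mod_mono: "A \<subseteq> B \<Longrightarrow> carrier (free_mod R A) \<subseteq> carrier (free_mod R B)"
  unfolding carrier_free_mod subset_iff by metis

lemma free_mod_empty: "v \<in> carrier (free_mod R {}) \<Longrightarrow> v = (\<lambda>b. \<zero>\<^bsub>R\<^esub>)"
  by (auto simp: carrier_free_mod)

locale coefficient_ring = cring R for R :: "'r ring" (structure)
begin

lemma basis_vec_closed: "a \<in> A \<Longrightarrow> basis_vec R a \<in> carrier (free_mod R A)"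
  by (auto simp: carrier_free_mod basis_vec_def intro: finite_subset[of _ "{a}"])

lemma free_zero_closed: "(\<lambda>b. \<zero>) \<in> carrier (free_mod R A)"
  by (simp add: carrier_free_mod)

lemma free_add_closed:
  assumes "v \<in> carrier (free_mod R A)" "w \<in> carrier (free_mod R A)"
  shows "(\<lambda>b. v b \<oplus> w b) \<in> carrier (free_mod R A)"
proof -
  have "{b. v b \<oplus> w b \<noteq> \<zero>} \<subseteq> {b. v b \<noteq> \<zero>} \<union> {b. w b \<noteq> \<zero>}"
    by auto
  then show ?thesis
    using assms by (auto simp: carrier_free_mod intro: finite_subset)
qed

lemma free_smult_closed:
  assumes "r \<in> carrier R" "v \<in> carrier (free_mod R A)"
  shows "(\<lambda>b. r \<otimes> v b) \<in> carrier (free_mod R A)"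
proof -
  have "{b. r \<otimes> v b \<noteq> \<zero>} \<subseteq> {b. v b \<noteq> \<zero>}"
    using assms(1) by auto
  then show ?thesis
    using assms by (auto simp: carrier_free_mod intro: finite_subset)
qed

text \<open>Induction on the finite support: one nonzero coefficient is set to zero and then added
  back.\<close>

lemma free_mod_induct [consumes 1, case_names zero add]:
  assumes v: "v \<in> carrier (free_mod R A)"
    and zero: "P (\<lambda>b. \<zero>)"
    and add: "\<And>v r a. \<lbrakk>v \<in> carrier (free_mod R A); r \<in> carrier R; a \<in> A; P v\<rbrakk>
      \<Longrightarrow> P (\<lambda>b. v b \<oplus> r \<otimes> basis_vec R a b)"
  shows "P v"
proof -
  have "finite {b. v b \<noteq> \<zero>}"
    using v by (simp add: carrier_free_mod)
  then show ?thesis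
    using v
  proof (induction "{b. v b \<noteq> \<zero>}" arbitrary: v rule: finite_psubset_induct)
    case psubset
    show ?case
    proof (cases "{b. v b \<noteq> \<zero>} = {}")
      case True
      then have "v = (\<lambda>b. \<zero>)"
        by auto
      then show ?thesis
        using zero by simp
    next
      case False
      then obtain a where a: "v a \<noteq> \<zero>"
        by blast
      then have "a \<in> A"
        using psubset.prems by (auto simp: carrier_free_mod)
      let ?w = "v(a := \<zero>)"
      have supp: "{b. ?w b \<noteq> \<zero>} \<subset> {b. v b \<noteq> \<zero>}"
        using a by auto
      have w: "?w \<in> carrier (free_mod R A)"
        using psubset.prems finite_subset[OF psubset_imp_subset[OF supp]] by (simp add: carrier_free_mod)
      have "v = (\<lambda>b. ?w b \<oplus> v a \<otimes> basis_vec R a b)"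
        using psubset.prems by (auto simp: carrier_free_mod basis_vec_def fun_eq_iff)
      moreover have "P (\<lambda>b. ?w b \<oplus> v a \<otimes> basis_vec R a b)"
        using psubset.hyps(2)[OF supp w] w \<open>a \<in> A\<close> psubset.prems by (intro add) (simp_all add: carrier_free_mod del: fun_upd_apply)
      ultimately show ?thesis
        by simp
    qed
  qed
qed

lemma linear_maps_closed:
  "h \<in> linear_maps R (free_mod R A) (free_mod R B) \<Longrightarrow> v \<in> carrier (free_mod R A) \<Longrightarrow> h v \<in> carrier (free_mod R B)"
  by (auto simp: linear_maps_def)

lemma linear_maps_add:
  "h \<in> linear_maps R (free_mod R A) (free_mod R B) \<Longrightarrow> v \<in> carrier (free_mod R A) \<Longrightarrow> w \<in> carrier (free_mod R A) \<Longrightarrow>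
    h (\<lambda>b. v b \<oplus> w b) = (\<lambda>b. h v b \<oplus> h w b)"
  by (auto simp: linear_maps_def)

lemma linear_maps_smult:
  "h \<in> linear_maps R (free_mod R A) (free_mod R B) \<Longrightarrow> r \<in> carrier R \<Longrightarrow> v \<in> carrier (free_mod R A) \<Longrightarrow>
    h (\<lambda>b. r \<otimes> v b) = (\<lambda>b. r \<otimes> h v b)"
  by (auto simp: linear_maps_def)

lemma linear_maps_zero:
  assumes "h \<in> linear_maps R (free_mod R A) (free_mod R B)"
  shows "h (\<lambda>b. \<zero>) = (\<lambda>b. \<zero>)"
  using linear_maps_smult[OF assms zero_closed free_zero_closed] linear_maps_closed[OF assms free_zero_closed]
  by (simp add: carrier_free_mod)

lemma linear_mapsI:
  assumes "\<And>v. v \<in> carrier (free_mod R A) \<Longrightarrow> h v \<in> carrier (free_mod R B)"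
    and "\<And>v w. \<lbrakk>v \<in> carrier (free_mod R A); w \<in> carrier (free_mod R A)\<rbrakk> \<Longrightarrow> h (\<lambda>b. v b \<oplus> w b) = (\<lambda>b. h v b \<oplus> h w b)"
    and "\<And>r v. \<lbrakk>r \<in> carrier R; v \<in> carrier (free_mod R A)\<rbrakk> \<Longrightarrow> h (\<lambda>b. r \<otimes> v b) = (\<lambda>b. r \<otimes> h v b)"
  shows "(\<lambda>v\<in>carrier (free_mod R A). h v) \<in> linear_maps R (free_mod R A) (free_mod R B)"
  using assms by (simp add: linear_maps_def free_add_closed free_smult_closed)

lemma linear_maps_ext: "h \<in> linear_maps R (free_mod R A) (free_mod R B) \<Longrightarrow> h \<in> extensional (carrier (free_mod R A))"
  by (auto simp: linear_maps_def PiE_def)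

lemma linear_maps_supported:
  assumes h: "h \<in> linear_maps R (free_mod R A) (free_mod R B)" and v: "v \<in> carrier (free_mod R A')" and "A' \<subseteq> A"
    and basis: "\<And>a. a \<in> A' \<Longrightarrow> h (basis_vec R a) \<in> carrier (free_mod R B')"
  shows "h v \<in> carrier (free_mod R B')"
  using v
proof (induction rule: free_mod_induct)
  case zero
  then show ?case
    by (simp add: linear_maps_zero[OF h] free_zero_closed)
next
  case (add v r a)
  have "v \<in> carrier (free_mod R A)" "basis_vec R a \<in> carrier (free_mod R A)"
    using add free_mod_mono[OF \<open>A' \<subseteq> A\<close>] basis_vec_closed[of a A'] by blast+
  then show ?case
    using add basis
    by (simp add: linear_maps_add[OF h] linear_maps_smult[OF h] free_smult_closed free_add_closed)
qed

lemma linear_maps_eqI: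
  assumes h: "h \<in> linear_maps R (free_mod R A) (free_mod R B)"
    and k: "k \<in> linear_maps R (free_mod R A) (free_mod R B')"
    and basis: "\<And>a. a \<in> A \<Longrightarrow> h (basis_vec R a) = k (basis_vec R a)"
  shows "h = k"
proof (rule extensionalityI[OF linear_maps_ext[OF h] linear_maps_ext[OF k]])
  fix v assume "v \<in> carrier (free_mod R A)"
  then show "h v = k v"
  proof (induction rule: free_mod_induct)
    case (add v r a)
    then show ?case
      using basis basis_vec_closed[OF add(3)]
      by (simp add: linear_maps_add[OF h] linear_maps_smult[OF h] linear_maps_add[OF k] linear_maps_smult[OF k]
          free_smult_closed)
  qed (simp add: linear_maps_zero[OF h] linear_maps_zero[OF k])
qed

lemma linear_maps_compose:
  assumes h: "h \<in> linear_maps R (free_mod R A) (free_mod R B)" and k: "k \<in> linear_maps R (free_mod R B) (free_mod R C)"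
  shows "compose (carrier (free_mod R A)) k h \<in> linear_maps R (free_mod R A) (free_mod R C)"
  unfolding compose_def using linear_maps_closed[OF h]
  by (intro linear_mapsI)
    (simp_all add: linear_maps_closed[OF k] linear_maps_add[OF h] linear_maps_add[OF k]
      linear_maps_smult[OF h] linear_maps_smult[OF k])

end

section \<open>Controlled homomorphisms\<close>

text \<open>Basic neighbourhoods of an end are cofinal among all its neighbourhoods, so control can
  be tested on compact sets. The inclusion of \<open>V\<close> in \<open>U\<close>, absent on the
  right, is restored by replacing \<open>L\<close> with \<open>K \<union> L\<close>.\<close>

lemma ctrl_hom_iff:
  "\<phi> \<in> ctrl_hom R T (A, \<alpha>) (B, \<beta>) \<longleftrightarrow>
    \<phi> \<in> linear_maps R (free_mod R A) (free_mod R B) \<and>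
    (\<forall>\<epsilon>\<in>ends T. \<forall>K. compactin T K \<longrightarrow> (\<exists>L. compactin T L \<and>
      (\<forall>a\<in>A. \<alpha> a \<in> \<epsilon> L \<longrightarrow> \<phi> (basis_vec R a) \<in> carrier (free_mod R {b\<in>B. \<beta> b \<in> \<epsilon> K}))))"
  (is "?l \<longleftrightarrow> ?lin \<and> ?r")
proof -
  let ?N = "\<lambda>\<epsilon> U. nbhd (freudenthal T) (Inr \<epsilon>) U"
  let ?S = "\<lambda>U. carrier (free_mod R {b\<in>B. Inl (\<beta> b) \<in> U})"
  have "(\<forall>U. ?N \<epsilon> U \<longrightarrow> (\<exists>V\<subseteq>U. ?N \<epsilon> V \<and> (\<forall>a\<in>A. Inl (\<alpha> a) \<in> V \<longrightarrow> \<phi> (basis_vec R a) \<in> ?S U))) \<longleftrightarrow>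
    (\<forall>K. compactin T K \<longrightarrow> (\<exists>L. compactin T L \<and>
      (\<forall>a\<in>A. \<alpha> a \<in> \<epsilon> L \<longrightarrow> \<phi> (basis_vec R a) \<in> carrier (free_mod R {b\<in>B. \<beta> b \<in> \<epsilon> K}))))"
    (is "?nbhds \<longleftrightarrow> ?compacts") if \<epsilon>: "\<epsilon> \<in> ends T" for \<epsilon>
  proof
    assume L: ?nbhds
    show ?compacts
    proof (intro allI impI)
      fix K assume K: "compactin T K"
      obtain V where V: "?N \<epsilon> V" "\<forall>a\<in>A. Inl (\<alpha> a) \<in> V \<longrightarrow> \<phi> (basis_vec R a) \<in> ?S (end_nbhd T \<epsilon> K)"
        using L nbhd_end_nbhd[OF \<epsilon> K] by blast
      obtain L where L: "compactin T L" "end_nbhd T \<epsilon> L \<subseteq> V"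
        using V(1) nbhd_end_iff[OF \<epsilon>] by blast
      have "\<phi> (basis_vec R a) \<in> carrier (free_mod R {b\<in>B. \<beta> b \<in> \<epsilon> K})" if a: "a \<in> A" "\<alpha> a \<in> \<epsilon> L" for a
      proof -
        have "Inl (\<alpha> a) \<in> V"
          using L(2) a(2) Inl_in_end_nbhd by (metis subsetD)
        then show ?thesis
          using V(2) a(1) by simp
      qed
      then show "\<exists>L. compactin T L \<and> (\<forall>a\<in>A. \<alpha> a \<in> \<epsilon> L \<longrightarrow>
          \<phi> (basis_vec R a) \<in> carrier (free_mod R {b\<in>B. \<beta> b \<in> \<epsilon> K}))"
        using L(1) by blast
    qed
  next
    assume R: ?compacts
    show ?nbhds
    proof (intro allI impI)
      fix U assume "?N \<epsilon> U"
      then obtain K where K: "compactin T K" "end_nbhd T \<epsilon> K \<subseteq> U"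
        using nbhd_end_iff[OF \<epsilon>] by blast
      obtain L where L: "compactin T L"
        "\<forall>a\<in>A. \<alpha> a \<in> \<epsilon> L \<longrightarrow> \<phi> (basis_vec R a) \<in> carrier (free_mod R {b\<in>B. \<beta> b \<in> \<epsilon> K})"
        using R K(1) by blast
      have KL: "compactin T (K \<union> L)"
        using K L by (intro compactin_Un)
      have "{b\<in>B. \<beta> b \<in> \<epsilon> K} \<subseteq> {b\<in>B. Inl (\<beta> b) \<in> U}"
        using K(2) by auto
      note S = free_mod_mono[OF this, of R]
      have "\<phi> (basis_vec R a) \<in> ?S U" if a: "a \<in> A" "Inl (\<alpha> a) \<in> end_nbhd T \<epsilon> (K \<union> L)" for a
      proof -
        have "\<alpha> a \<in> \<epsilon> L"
          using a(2) ends_antimono[OF \<epsilon> L(1) KL] by auto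
        then show ?thesis
          using L(2) a(1) S by blast
      qed
      moreover have "end_nbhd T \<epsilon> (K \<union> L) \<subseteq> U"
        using end_nbhd_antimono[OF \<epsilon> K(1) KL] K(2) by blast
      ultimately show "\<exists>V\<subseteq>U. ?N \<epsilon> V \<and> (\<forall>a\<in>A. Inl (\<alpha> a) \<in> V \<longrightarrow> \<phi> (basis_vec R a) \<in> ?S U)"
        using nbhd_end_nbhd[OF \<epsilon> KL] by blast
    qed
  qed
  then show ?thesis
    unfolding ctrl_hom_def by simp
qed

lemma ctrl_cat_simps:
  "Ob (ctrl_cat R T) = ctrl_ob T"
  "Hom (ctrl_cat R T) = ctrl_hom R T"
  "Ident (ctrl_cat R T) (A, \<alpha>) = (\<lambda>v\<in>carrier (free_mod R A). v)"
  "Comp (ctrl_cat R T) (A, \<alpha>) Y Z \<psi> \<phi> = compose (carrier (free_mod R A)) \<psi> \<phi>"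
  "Add (ctrl_cat R T) (A, \<alpha>) (B, \<beta>) \<phi> \<psi> = (\<lambda>v\<in>carrier (free_mod R A). \<phi> v \<oplus>\<^bsub>free_mod R B\<^esub> \<psi> v)"
  by (simp_all add: ctrl_cat_def)

text \<open>Compact subsets of a discrete space are finite. Conversely, finite preimages of compact
  sets suffice for properness because \<open>T\<close> is locally compact Hausdorff, hence a k-space
  in which compact sets are closed.\<close>

lemma (in end_space) ctrl_ob_iff:
  "(A, \<alpha>) \<in> ctrl_ob T \<longleftrightarrow>
    \<alpha> \<in> extensional A \<and> \<alpha> \<in> A \<rightarrow> topspace T \<and> (\<forall>K. compactin T K \<longrightarrow> finite {a\<in>A. \<alpha> a \<in> K})"
proof -
  have "proper_cont (discrete_topology A) T \<alpha> \<longleftrightarrow>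
      \<alpha> \<in> A \<rightarrow> topspace T \<and> (\<forall>K. compactin T K \<longrightarrow> finite {a\<in>A. \<alpha> a \<in> K})" (is "_ \<longleftrightarrow> _ \<and> ?fin")
  proof
    assume p: "proper_cont (discrete_topology A) T \<alpha>"
    have "finite {a\<in>A. \<alpha> a \<in> K}" if "compactin T K" for K
      using proper_cont_preimage[OF p that] by (simp add: compactin_discrete_topology)
    then show "\<alpha> \<in> A \<rightarrow> topspace T \<and> ?fin"
      using proper_cont_in[OF p] by simp
  next
    assume R: "\<alpha> \<in> A \<rightarrow> topspace T \<and> ?fin"
    have "proper_map (discrete_topology A) T \<alpha>"
    proof (rule compact_imp_proper_map)
      show "k_space T" "kc_space T"
        using locally_compact_imp_k_space[OF locally_compact] Hausdorff_imp_kc_space[OF Hausdorff] by simp_all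
      show "compactin (discrete_topology A) {a \<in> topspace (discrete_topology A). \<alpha> a \<in> K}" if "compactin T K" for K
        using R that by (simp add: compactin_discrete_topology)
    qed (use R in auto)
    then show "proper_cont (discrete_topology A) T \<alpha>"
      using R by (simp add: proper_cont_def)
  qed
  then show ?thesis
    by (simp add: ctrl_ob_def)
qed

context coefficient_ring
begin

lemma ctrl_hom_linear: "\<phi> \<in> ctrl_hom R T (A, \<alpha>) (B, \<beta>) \<Longrightarrow> \<phi> \<in> linear_maps R (free_mod R A) (free_mod R B)"
  by (simp add: ctrl_hom_iff)

lemma ctrl_hom_control:
  assumes "\<phi> \<in> ctrl_hom R T (A, \<alpha>) (B, \<beta>)" "\<epsilon> \<in> ends T" "compactin T K"
  shows "\<exists>L. compactin T L \<and>
    (\<forall>a\<in>A. \<alpha> a \<in> \<epsilon> L \<longrightarrow> \<phi> (basis_vec R a) \<in> carrier (free_mod R {b\<in>B. \<beta> b \<in> \<epsilon> K}))"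
  using assms by (simp add: ctrl_hom_iff)

lemma ctrl_Ident_closed: "(\<lambda>v\<in>carrier (free_mod R A). v) \<in> ctrl_hom R T (A, \<alpha>) (A, \<alpha>)"
  unfolding ctrl_hom_iff
proof (intro conjI ballI allI impI)
  show "(\<lambda>v\<in>carrier (free_mod R A). v) \<in> linear_maps R (free_mod R A) (free_mod R A)"
    by (rule linear_mapsI) simp_all
  fix \<epsilon> K assume "compactin T K"
  then show "\<exists>L. compactin T L \<and> (\<forall>a\<in>A. \<alpha> a \<in> \<epsilon> L \<longrightarrow>
      (\<lambda>v\<in>carrier (free_mod R A). v) (basis_vec R a) \<in> carrier (free_mod R {b\<in>A. \<alpha> b \<in> \<epsilon> K}))"
    by (intro exI[of _ K]) (simp add: basis_vec_closed)
qed

lemma ctrl_Comp_closed: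
  assumes \<phi>: "\<phi> \<in> ctrl_hom R T (A, \<alpha>) (B, \<beta>)" and \<psi>: "\<psi> \<in> ctrl_hom R T (B, \<beta>) (C, \<gamma>)"
  shows "compose (carrier (free_mod R A)) \<psi> \<phi> \<in> ctrl_hom R T (A, \<alpha>) (C, \<gamma>)"
  unfolding ctrl_hom_iff
proof (intro conjI ballI allI impI)
  show "compose (carrier (free_mod R A)) \<psi> \<phi> \<in> linear_maps R (free_mod R A) (free_mod R C)"
    by (rule linear_maps_compose[OF ctrl_hom_linear[OF \<phi>] ctrl_hom_linear[OF \<psi>]])
  fix \<epsilon> K assume *: "\<epsilon> \<in> ends T" "compactin T K"
  obtain L where L: "compactin T L"
    "\<forall>b\<in>B. \<beta> b \<in> \<epsilon> L \<longrightarrow> \<psi> (basis_vec R b) \<in> carrier (free_mod R {c\<in>C. \<gamma> c \<in> \<epsilon> K})"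
    using ctrl_hom_control[OF \<psi> *] by blast
  obtain M where M: "compactin T M"
    "\<forall>a\<in>A. \<alpha> a \<in> \<epsilon> M \<longrightarrow> \<phi> (basis_vec R a) \<in> carrier (free_mod R {b\<in>B. \<beta> b \<in> \<epsilon> L})"
    using ctrl_hom_control[OF \<phi> *(1) L(1)] by blast
  have "compose (carrier (free_mod R A)) \<psi> \<phi> (basis_vec R a) \<in> carrier (free_mod R {c\<in>C. \<gamma> c \<in> \<epsilon> K})"
    if a: "a \<in> A" "\<alpha> a \<in> \<epsilon> M" for a
    unfolding compose_eq[OF basis_vec_closed[OF a(1)]]
    by (rule linear_maps_supported[OF ctrl_hom_linear[OF \<psi>] M(2)[rule_format, OF a]]) (use L(2) in auto)
  then show "\<exists>M. compactin T M \<and> (\<forall>a\<in>A. \<alpha> a \<in> \<epsilon> M \<longrightarrow>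
      compose (carrier (free_mod R A)) \<psi> \<phi> (basis_vec R a) \<in> carrier (free_mod R {c\<in>C. \<gamma> c \<in> \<epsilon> K}))"
    using M(1) by blast
qed

lemma ctrl_Add_closed:
  assumes \<phi>: "\<phi> \<in> ctrl_hom R T (A, \<alpha>) (B, \<beta>)" and \<psi>: "\<psi> \<in> ctrl_hom R T (A, \<alpha>) (B, \<beta>)"
  shows "(\<lambda>v\<in>carrier (free_mod R A). \<phi> v \<oplus>\<^bsub>free_mod R B\<^esub> \<psi> v) \<in> ctrl_hom R T (A, \<alpha>) (B, \<beta>)"
  unfolding ctrl_hom_iff
proof (intro conjI ballI allI impI)
  note l\<phi> = ctrl_hom_linear[OF \<phi>] and l\<psi> = ctrl_hom_linear[OF \<psi>]
  show "(\<lambda>v\<in>carrier (free_mod R A). \<phi> v \<oplus>\<^bsub>free_mod R B\<^esub> \<psi> v) \<in> linear_maps R (free_mod R A) (free_mod R B)"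
  proof (rule linear_mapsI)
    show "\<phi> v \<oplus>\<^bsub>free_mod R B\<^esub> \<psi> v \<in> carrier (free_mod R B)" if "v \<in> carrier (free_mod R A)" for v
      using that by (simp add: free_add_closed linear_maps_closed[OF l\<phi>] linear_maps_closed[OF l\<psi>])
    have c: "\<phi> v b \<in> carrier R" "\<psi> v b \<in> carrier R" if "v \<in> carrier (free_mod R A)" for v b
      using linear_maps_closed[OF l\<phi> that] linear_maps_closed[OF l\<psi> that] by (simp_all add: carrier_free_mod)
    show "\<phi> (\<lambda>b. v b \<oplus> w b) \<oplus>\<^bsub>free_mod R B\<^esub> \<psi> (\<lambda>b. v b \<oplus> w b) =
        (\<lambda>b. (\<phi> v \<oplus>\<^bsub>free_mod R B\<^esub> \<psi> v) b \<oplus> (\<phi> w \<oplus>\<^bsub>free_mod R B\<^esub> \<psi> w) b)"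
      if "v \<in> carrier (free_mod R A)" "w \<in> carrier (free_mod R A)" for v w
      using that by (simp add: linear_maps_add[OF l\<phi>] linear_maps_add[OF l\<psi>] c a_ac)
    show "\<phi> (\<lambda>b. r \<otimes> v b) \<oplus>\<^bsub>free_mod R B\<^esub> \<psi> (\<lambda>b. r \<otimes> v b) = (\<lambda>b. r \<otimes> (\<phi> v \<oplus>\<^bsub>free_mod R B\<^esub> \<psi> v) b)"
      if "r \<in> carrier R" "v \<in> carrier (free_mod R A)" for r v
      using that by (simp add: linear_maps_smult[OF l\<phi>] linear_maps_smult[OF l\<psi>] c r_distr)
  qed
  fix \<epsilon> K assume *: "\<epsilon> \<in> ends T" "compactin T K"
  obtain L where L: "compactin T L"
    "\<forall>a\<in>A. \<alpha> a \<in> \<epsilon> L \<longrightarrow> \<phi> (basis_vec R a) \<in> carrier (free_mod R {b\<in>B. \<beta> b \<in> \<epsilon> K})"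
    using ctrl_hom_control[OF \<phi> *] by blast
  obtain M where M: "compactin T M"
    "\<forall>a\<in>A. \<alpha> a \<in> \<epsilon> M \<longrightarrow> \<psi> (basis_vec R a) \<in> carrier (free_mod R {b\<in>B. \<beta> b \<in> \<epsilon> K})"
    using ctrl_hom_control[OF \<psi> *] by blast
  note LM = compactin_Un[OF L(1) M(1)]
  have "(\<lambda>v\<in>carrier (free_mod R A). \<phi> v \<oplus>\<^bsub>free_mod R B\<^esub> \<psi> v) (basis_vec R a)
      \<in> carrier (free_mod R {b\<in>B. \<beta> b \<in> \<epsilon> K})" if a: "a \<in> A" "\<alpha> a \<in> \<epsilon> (L \<union> M)" for a
  proof -
    have "\<alpha> a \<in> \<epsilon> L" "\<alpha> a \<in> \<epsilon> M"
      using a(2) ends_antimono[OF *(1) L(1) LM] ends_antimono[OF *(1) M(1) LM] by auto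
    then show ?thesis
      using L(2) M(2) a(1) by (simp add: basis_vec_closed free_add_closed)
  qed
  then show "\<exists>L. compactin T L \<and> (\<forall>a\<in>A. \<alpha> a \<in> \<epsilon> L \<longrightarrow>
      (\<lambda>v\<in>carrier (free_mod R A). \<phi> v \<oplus>\<^bsub>free_mod R B\<^esub> \<psi> v) (basis_vec R a)
      \<in> carrier (free_mod R {b\<in>B. \<beta> b \<in> \<epsilon> K}))"
    using LM by blast
qed

lemma preadditive_ctrl_cat: "preadditive_category (ctrl_cat R T)"
proof (rule preadditive_category.intro)
  show "Ident (ctrl_cat R T) X \<in> Hom (ctrl_cat R T) X X" for X
    by (cases X) (simp add: ctrl_cat_simps ctrl_Ident_closed)
next
  fix X Y Z and u v
  assume "u \<in> Hom (ctrl_cat R T) X Y" "v \<in> Hom (ctrl_cat R T) Y Z"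
  then show "Comp (ctrl_cat R T) X Y Z v u \<in> Hom (ctrl_cat R T) X Z"
    by (cases X, cases Y, cases Z) (simp add: ctrl_cat_simps ctrl_Comp_closed)
next
  fix X Y and u v
  assume "u \<in> Hom (ctrl_cat R T) X Y" "v \<in> Hom (ctrl_cat R T) X Y"
  then show "Add (ctrl_cat R T) X Y u v \<in> Hom (ctrl_cat R T) X Y"
    by (cases X, cases Y) (simp only: ctrl_cat_simps ctrl_Add_closed)
next
  fix X Y Z W and u v w
  assume "u \<in> Hom (ctrl_cat R T) X Y"
  then show "Comp (ctrl_cat R T) X Z W w (Comp (ctrl_cat R T) X Y Z v u) =
      Comp (ctrl_cat R T) X Y W (Comp (ctrl_cat R T) Y Z W w v) u"
    by (cases X, cases Y)
      (auto simp: ctrl_cat_simps compose_def linear_maps_closed[OF ctrl_hom_linear] intro!: restrict_ext)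
next
  fix X Y and u
  assume "u \<in> Hom (ctrl_cat R T) X Y"
  then show "Comp (ctrl_cat R T) X Y Y (Ident (ctrl_cat R T) Y) u = u"
    by (cases X, cases Y, intro extensionalityI[OF _ linear_maps_ext[OF ctrl_hom_linear]])
      (auto simp: ctrl_cat_simps compose_def linear_maps_closed[OF ctrl_hom_linear])
next
  fix X Y and u
  assume "u \<in> Hom (ctrl_cat R T) X Y"
  then show "Comp (ctrl_cat R T) X X Y u (Ident (ctrl_cat R T) X) = u"
    by (cases X, cases Y, intro extensionalityI[OF _ linear_maps_ext[OF ctrl_hom_linear]])
      (auto simp: ctrl_cat_simps compose_def)
next
  fix X Y Z and u v w
  assume "u \<in> Hom (ctrl_cat R T) X Y"
  then show "Comp (ctrl_cat R T) X Y Z (Add (ctrl_cat R T) Y Z v w) u =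
      Add (ctrl_cat R T) X Z (Comp (ctrl_cat R T) X Y Z v u) (Comp (ctrl_cat R T) X Y Z w u)"
    by (cases X, cases Y, cases Z)
      (auto simp: ctrl_cat_simps compose_def linear_maps_closed[OF ctrl_hom_linear] intro!: restrict_ext)
next
  fix X Y Z and u v w
  assume "u \<in> Hom (ctrl_cat R T) X Y" "v \<in> Hom (ctrl_cat R T) X Y" "w \<in> Hom (ctrl_cat R T) Y Z"
  then show "Comp (ctrl_cat R T) X Y Z w (Add (ctrl_cat R T) X Y u v) =
      Add (ctrl_cat R T) X Z (Comp (ctrl_cat R T) X Y Z w u) (Comp (ctrl_cat R T) X Y Z w v)"
    by (cases X, cases Y, cases Z)
      (auto simp: ctrl_cat_simps compose_def linear_maps_closed[OF ctrl_hom_linear]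
        linear_maps_add[OF ctrl_hom_linear] intro!: restrict_ext)
qed

end

section \<open>Change of tree\<close>

locale proper_map_end_spaces = T: end_space T + T': end_space T'
  for T :: "'a topology" and T' :: "'c topology" +
  fixes f :: "'a \<Rightarrow> 'c"
  assumes f: "proper_cont T T' f"
begin

lemma lift_end:
  assumes \<epsilon>': "\<epsilon>' \<in> ends T'" and P: "\<And>L. compactin T' L \<Longrightarrow> \<exists>x\<in>topspace T. f x \<in> \<epsilon>' L \<and> P x"
  shows "\<exists>\<epsilon>\<in>ends T. ends_map T T' f \<epsilon> = \<epsilon>' \<and> (\<forall>C. compactin T C \<longrightarrow> (\<exists>x\<in>\<epsilon> C. P x))"
proof -
  obtain K :: "nat \<Rightarrow> 'c set" where K: "\<And>n. compactin T' (K n)" "incseq K" "\<And>C. compactin T' C \<Longrightarrow> \<exists>n. C \<subseteq> K n"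
    using T'.ex_exhaustion by blast
  have "\<forall>n. \<exists>x. x \<in> topspace T \<and> f x \<in> \<epsilon>' (K n) \<and> P x"
    using P[OF K(1)] by blast
  from choice[OF this] obtain x where x: "\<And>n. x n \<in> topspace T" "\<And>n. f (x n) \<in> \<epsilon>' (K n)" "\<And>n. P (x n)"
    by blast
  have "finite {i \<in> UNIV. x i \<in> C}" if C: "compactin T C" for C
  proof -
    have "compactin T' (f ` C)"
      using f by (intro image_compactin[OF C]) (simp add: proper_cont_def)
    then obtain m where m: "f ` C \<subseteq> K m"
      using K(3) by blast
    have "n < m" if n: "x n \<in> C" for n
    proof (rule ccontr)
      assume "\<not> n < m"
      then have "K m \<subseteq> K n"
        using incseqD[OF K(2)] by simp
      then have "f (x n) \<in> K n"
        using m imageI[OF n, of f] by blast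
      then show False
        using x(2)[of n] ends_subset[OF \<epsilon>' K(1)[of n]] by blast
    qed
    then have "{i \<in> UNIV. x i \<in> C} \<subseteq> {..<m}"
      by blast
    then show ?thesis
      by (rule finite_subset) simp
  qed
  then have "\<exists>\<epsilon>\<in>ends T. \<forall>C. compactin T C \<longrightarrow> infinite {i \<in> UNIV. x i \<in> \<epsilon> C}"
    by (intro T.ex_end_accumulation infinite_UNIV_nat x(1))
  then obtain \<epsilon> where \<epsilon>: "\<epsilon> \<in> ends T" "\<And>C. compactin T C \<Longrightarrow> infinite {i \<in> UNIV. x i \<in> \<epsilon> C}"
    by blast
  have "ends_map T T' f \<epsilon> C = \<epsilon>' C" if C: "compactin T' C" for C
  proof -
    obtain m where m: "C \<subseteq> K m"
      using K(3)[OF C] by blast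
    let ?C = "{x \<in> topspace T. f x \<in> C}"
    have "\<exists>n\<ge>m. n \<in> {i \<in> UNIV. x i \<in> \<epsilon> ?C}"
      using \<epsilon>(2)[OF proper_cont_preimage[OF f C]] unfolding infinite_nat_iff_unbounded_le by blast
    then obtain n where n: "m \<le> n" "x n \<in> \<epsilon> ?C"
      by blast
    have "C \<subseteq> K n"
      using m incseqD[OF K(2) n(1)] by blast
    then have "f (x n) \<in> \<epsilon>' C"
      using x(2) ends_antimono[OF \<epsilon>' C K(1)] by blast
    moreover have "f (x n) \<in> ends_map T T' f \<epsilon> C"
      using ends_map_pi0[OF f \<epsilon>(1) C] imageI[OF n(2), of f] by blast
    ultimately show ?thesis
      using pi0_compl_unique[OF _ ends_pi0[OF \<epsilon>' C]] ends_map_pi0[OF f \<epsilon>(1) C] by blast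
  qed
  then have "ends_map T T' f \<epsilon> = \<epsilon>'"
    by (rule ends_eqI[OF ends_map_in_ends[OF f \<epsilon>(1)] \<epsilon>'])
  moreover have "\<exists>y\<in>\<epsilon> C. P y" if C: "compactin T C" for C
  proof -
    obtain n where "x n \<in> \<epsilon> C"
      using \<epsilon>(2)[OF C] by (metis (mono_tags, lifting) Collect_empty_eq UNIV_I finite.emptyI)
    then show ?thesis
      using x(3) by blast
  qed
  ultimately show ?thesis
    using \<epsilon>(1) by (intro bexI[of _ \<epsilon>]) simp_all
qed

section \<open>Full faithfulness of the change of tree\<close>

abbreviation push :: "'b set \<times> ('b \<Rightarrow> 'a) \<Rightarrow> 'b set \<times> ('b \<Rightarrow> 'c)" where
  "push \<equiv> \<lambda>(A, \<alpha>). (A, compose A f \<alpha>)"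

lemma push_closed:
  assumes "X \<in> ctrl_ob T"
  shows "push X \<in> ctrl_ob T'"
proof -
  obtain A \<alpha> where X: "X = (A, \<alpha>)"
    by (cases X)
  have *: "\<alpha> \<in> A \<rightarrow> topspace T" "\<And>K. compactin T K \<Longrightarrow> finite {a\<in>A. \<alpha> a \<in> K}"
    using assms unfolding X T.ctrl_ob_iff by blast+
  have "finite {a\<in>A. compose A f \<alpha> a \<in> K}" if K: "compactin T' K" for K
  proof -
    have "{a\<in>A. compose A f \<alpha> a \<in> K} = {a\<in>A. \<alpha> a \<in> {x \<in> topspace T. f x \<in> K}}"
      using *(1) by (auto simp: compose_def)
    then show ?thesis
      using *(2)[OF proper_cont_preimage[OF f K]] by simp
  qed
  moreover have "compose A f \<alpha> \<in> A \<rightarrow> topspace T'"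
    using *(1) proper_cont_in[OF f] by (auto simp: compose_def)
  ultimately show ?thesis
    by (simp add: X T'.ctrl_ob_iff compose_extensional)
qed

text \<open>If control failed at \<epsilon>', the offending basis elements would accumulate at an
  end \<epsilon> over \<epsilon>', where \<phi> is controlled. This treats uniformly the cases of
  no, one or several ends over \<epsilon>'.\<close>

lemma ctrl_hom_push:
  assumes \<alpha>: "\<alpha> \<in> A \<rightarrow> topspace T" and \<beta>: "\<beta> \<in> B \<rightarrow> topspace T" and \<phi>: "\<phi> \<in> ctrl_hom R T (A, \<alpha>) (B, \<beta>)"
  shows "\<phi> \<in> ctrl_hom R T' (A, compose A f \<alpha>) (B, compose B f \<beta>)"
  unfolding ctrl_hom_iff
proof (intro conjI ballI allI impI)
  show "\<phi> \<in> linear_maps R (free_mod R A) (free_mod R B)"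
    using \<phi> by (simp add: ctrl_hom_iff)
  fix \<epsilon>' K assume \<epsilon>': "\<epsilon>' \<in> ends T'" and K: "compactin T' K"
  let ?S = "carrier (free_mod R {b\<in>B. compose B f \<beta> b \<in> \<epsilon>' K})"
  let ?K = "{x \<in> topspace T. f x \<in> K}"
  show "\<exists>L. compactin T' L \<and> (\<forall>a\<in>A. compose A f \<alpha> a \<in> \<epsilon>' L \<longrightarrow> \<phi> (basis_vec R a) \<in> ?S)"
  proof (rule ccontr)
    assume neg: "\<not> ?thesis"
    have "\<exists>x\<in>topspace T. f x \<in> \<epsilon>' L \<and> (\<exists>a\<in>A. x = \<alpha> a \<and> \<phi> (basis_vec R a) \<notin> ?S)" if "compactin T' L" for L
    proof -
      obtain a where "a \<in> A" "f (\<alpha> a) \<in> \<epsilon>' L" "\<phi> (basis_vec R a) \<notin> ?S"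
        using neg \<open>compactin T' L\<close> by (auto simp: compose_eq)
      then show ?thesis
        using \<alpha> by (intro bexI[of _ "\<alpha> a"]) auto
    qed
    from lift_end[OF \<epsilon>' this] obtain \<epsilon> where \<epsilon>: "\<epsilon> \<in> ends T" "ends_map T T' f \<epsilon> = \<epsilon>'"
      "\<forall>C. compactin T C \<longrightarrow> (\<exists>x\<in>\<epsilon> C. \<exists>a\<in>A. x = \<alpha> a \<and> \<phi> (basis_vec R a) \<notin> ?S)"
      by blast
    obtain L where L: "compactin T L"
      "\<forall>a\<in>A. \<alpha> a \<in> \<epsilon> L \<longrightarrow> \<phi> (basis_vec R a) \<in> carrier (free_mod R {b\<in>B. \<beta> b \<in> \<epsilon> ?K})"
      using \<phi> \<epsilon>(1) proper_cont_preimage[OF f K] unfolding ctrl_hom_iff by blast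
    obtain a where a: "a \<in> A" "\<alpha> a \<in> \<epsilon> L" "\<phi> (basis_vec R a) \<notin> ?S"
      using \<epsilon>(3) L(1) by blast
    have "f x \<in> \<epsilon>' K" if "x \<in> \<epsilon> ?K" for x
      using ends_map_pi0[OF f \<epsilon>(1) K] imageI[OF that, of f] unfolding \<epsilon>(2) by blast
    then have "{b\<in>B. \<beta> b \<in> \<epsilon> ?K} \<subseteq> {b\<in>B. compose B f \<beta> b \<in> \<epsilon>' K}"
      by (auto simp: compose_eq)
    then show False
      using L(2) a free_mod_mono by blast
  qed
qed

text \<open>Here injectivity on ends is used. If every \<open>K'\<close> failed, points outside
  \<open>\<epsilon> K\<close> would accumulate at an end \<delta> with the same image as \<epsilon>.
  Then \<delta> equals \<epsilon>, although \<open>\<delta> K\<close> contains a point outside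
  \<open>\<epsilon> K\<close>.\<close>

lemma end_nbhd_preimage:
  assumes inj: "inj_on (ends_map T T' f) (ends T)" and \<epsilon>: "\<epsilon> \<in> ends T" and K: "compactin T K"
  shows "\<exists>K'. compactin T' K' \<and> (\<forall>x\<in>topspace T. f x \<in> ends_map T T' f \<epsilon> K' \<longrightarrow> x \<in> \<epsilon> K)"
proof (rule ccontr)
  assume neg: "\<not> ?thesis"
  have "\<exists>x\<in>topspace T. f x \<in> ends_map T T' f \<epsilon> L \<and> x \<notin> \<epsilon> K" if "compactin T' L" for L
    using neg \<open>compactin T' L\<close> by blast
  from lift_end[OF ends_map_in_ends[OF f \<epsilon>] this]
  obtain \<delta> where \<delta>: "\<delta> \<in> ends T" "ends_map T T' f \<delta> = ends_map T T' f \<epsilon>"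
    "\<forall>C. compactin T C \<longrightarrow> (\<exists>x\<in>\<delta> C. x \<notin> \<epsilon> K)"
    by blast
  have "\<delta> = \<epsilon>"
    by (rule inj_onD[OF inj \<delta>(2,1) \<epsilon>])
  then show False
    using \<delta>(3) K by blast
qed

text \<open>Control at \<epsilon> follows from control at its image. On the source side
  \<open>f\<close> maps the component of \<epsilon> over the preimage of \<open>L'\<close> into that
  of the image end; on the target side \<open>end_nbhd_preimage\<close> leads back to
  \<open>T\<close>.\<close>

lemma ctrl_hom_pull:
  assumes inj: "inj_on (ends_map T T' f) (ends T)"
    and \<alpha>: "\<alpha> \<in> A \<rightarrow> topspace T" and \<beta>: "\<beta> \<in> B \<rightarrow> topspace T"
    and \<phi>: "\<phi> \<in> ctrl_hom R T' (A, compose A f \<alpha>) (B, compose B f \<beta>)"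
  shows "\<phi> \<in> ctrl_hom R T (A, \<alpha>) (B, \<beta>)"
  unfolding ctrl_hom_iff
proof (intro conjI ballI allI impI)
  show "\<phi> \<in> linear_maps R (free_mod R A) (free_mod R B)"
    using \<phi> by (simp add: ctrl_hom_iff)
  fix \<epsilon> K assume \<epsilon>: "\<epsilon> \<in> ends T" and K: "compactin T K"
  obtain K' where K': "compactin T' K'" "\<forall>x\<in>topspace T. f x \<in> ends_map T T' f \<epsilon> K' \<longrightarrow> x \<in> \<epsilon> K"
    using end_nbhd_preimage[OF inj \<epsilon> K] by blast
  obtain L' where L': "compactin T' L'" "\<forall>a\<in>A. compose A f \<alpha> a \<in> ends_map T T' f \<epsilon> L' \<longrightarrow>
      \<phi> (basis_vec R a) \<in> carrier (free_mod R {b\<in>B. compose B f \<beta> b \<in> ends_map T T' f \<epsilon> K'})"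
    using \<phi> ends_map_in_ends[OF f \<epsilon>] K'(1) unfolding ctrl_hom_iff by blast
  let ?L = "{x \<in> topspace T. f x \<in> L'}"
  have "{b\<in>B. compose B f \<beta> b \<in> ends_map T T' f \<epsilon> K'} \<subseteq> {b\<in>B. \<beta> b \<in> \<epsilon> K}"
    using K'(2) \<beta> by (auto simp: compose_eq)
  note S = free_mod_mono[OF this, of R]
  have "\<phi> (basis_vec R a) \<in> carrier (free_mod R {b\<in>B. \<beta> b \<in> \<epsilon> K})" if a: "a \<in> A" "\<alpha> a \<in> \<epsilon> ?L" for a
  proof -
    have "compose A f \<alpha> a \<in> ends_map T T' f \<epsilon> L'"
      using ends_map_pi0[OF f \<epsilon> L'(1)] imageI[OF a(2), of f] a(1) by (auto simp: compose_eq)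
    then show ?thesis
      using L'(2) a(1) S by blast
  qed
  then show "\<exists>L. compactin T L \<and> (\<forall>a\<in>A. \<alpha> a \<in> \<epsilon> L \<longrightarrow> \<phi> (basis_vec R a) \<in> carrier (free_mod R {b\<in>B. \<beta> b \<in> \<epsilon> K}))"
    using proper_cont_preimage[OF f L'(1)] by blast
qed

end

section \<open>Factorisation through the image of the change of tree functor\<close>

text \<open>Asymptotic equality of two families: over each compact set all but finitely many indices
  have both points in the same component. This is the form in which moving basis elements is
  negligible near the ends.\<close>

definition close_on :: "'c topology \<Rightarrow> 'b set \<Rightarrow> ('b \<Rightarrow> 'c) \<Rightarrow> ('b \<Rightarrow> 'c) \<Rightarrow> bool" where
  "close_on T A \<alpha> \<gamma> \<longleftrightarrow>
     (\<forall>K. compactin T K \<longrightarrow> finite {a\<in>A. \<not> (\<exists>W\<in>pi0_compl T K. \<alpha> a \<in> W \<and> \<gamma> a \<in> W)})"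

lemma close_on_sym: "close_on T A \<alpha> \<gamma> \<Longrightarrow> close_on T A \<gamma> \<alpha>"
  unfolding close_on_def by (simp add: conj_commute)

lemma close_on_cong:
  assumes "\<And>a. a \<in> A \<Longrightarrow> \<gamma> a = \<gamma>' a"
  shows "close_on T A \<alpha> \<gamma> \<longleftrightarrow> close_on T A \<alpha> \<gamma>'"
proof -
  have "{a\<in>A. \<not> (\<exists>W\<in>pi0_compl T K. \<alpha> a \<in> W \<and> \<gamma> a \<in> W)} =
      {a\<in>A. \<not> (\<exists>W\<in>pi0_compl T K. \<alpha> a \<in> W \<and> \<gamma>' a \<in> W)}" for K
    using assms by auto
  then show ?thesis
    by (simp add: close_on_def)
qed

text \<open>Off a finite set of indices \<alpha> and \<gamma> lie in the same component of
  \<open>T - K\<close>; the finitely many exceptional points are absorbed into the compact set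
  \<open>?L\<close>. The subset \<open>M\<close> lets one statement cover a projection, an inclusion
  and the zero map.\<close>

lemma (in coefficient_ring) ctrl_hom_of_close:
  assumes \<phi>: "\<phi> \<in> linear_maps R (free_mod R A) (free_mod R B)" and M: "M \<subseteq> A" "M \<subseteq> B"
    and \<alpha>: "\<alpha> \<in> A \<rightarrow> topspace T" and close: "close_on T M \<alpha> \<gamma>"
    and basis: "\<And>a. a \<in> A \<Longrightarrow> \<phi> (basis_vec R a) = (if a \<in> M then basis_vec R a else (\<lambda>b. \<zero>))"
  shows "\<phi> \<in> ctrl_hom R T (A, \<alpha>) (B, \<gamma>)"
  unfolding ctrl_hom_iff
proof (intro conjI ballI allI impI)
  show "\<phi> \<in> linear_maps R (free_mod R A) (free_mod R B)" by fact
  fix \<epsilon> K assume \<epsilon>: "\<epsilon> \<in> ends T" and K: "compactin T K"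
  let ?E = "{a\<in>M. \<not> (\<exists>W\<in>pi0_compl T K. \<alpha> a \<in> W \<and> \<gamma> a \<in> W)}"
  let ?L = "K \<union> \<alpha> ` ?E"
  have "finite ?E"
    using close K by (simp add: close_on_def)
  then have L: "compactin T ?L"
    using \<alpha> M(1) by (intro compactin_Un K finite_imp_compactin) auto
  have "\<phi> (basis_vec R a) \<in> carrier (free_mod R {b\<in>B. \<gamma> b \<in> \<epsilon> K})" if a: "a \<in> A" "\<alpha> a \<in> \<epsilon> ?L" for a
  proof (cases "a \<in> M")
    case True
    have "\<alpha> a \<notin> \<alpha> ` ?E"
      using a(2) ends_subset[OF \<epsilon> L] by blast
    then have "a \<notin> ?E"
      by blast
    then obtain W where W: "W \<in> pi0_compl T K" "\<alpha> a \<in> W" "\<gamma> a \<in> W"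
      using True by blast
    have "\<alpha> a \<in> \<epsilon> K"
      using a(2) ends_antimono[OF \<epsilon> K L] by blast
    then have "W = \<epsilon> K"
      by (rule pi0_compl_unique[OF W(1) ends_pi0[OF \<epsilon> K] W(2)])
    then show ?thesis
      using W(3) True M(2) basis[OF a(1)] by (auto intro!: basis_vec_closed)
  next
    case False
    then show ?thesis
      by (simp add: basis[OF a(1)] free_zero_closed)
  qed
  then show "\<exists>L. compactin T L \<and> (\<forall>a\<in>A. \<alpha> a \<in> \<epsilon> L \<longrightarrow> \<phi> (basis_vec R a) \<in> carrier (free_mod R {b\<in>B. \<gamma> b \<in> \<epsilon> K}))"
    using L by blast
qed

lemma (in coefficient_ring) inclusion_linear:
  assumes "A \<subseteq> B"
  shows "(\<lambda>v\<in>carrier (free_mod R A). v) \<in> linear_maps R (free_mod R A) (free_mod R B)"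
  by (rule linear_mapsI) (use free_mod_mono[OF assms] in auto)

lemma (in coefficient_ring) projection_linear:
  shows "(\<lambda>v\<in>carrier (free_mod R A). \<lambda>b. if b \<in> B then v b else \<zero>) \<in> linear_maps R (free_mod R A) (free_mod R B)"
proof (rule linear_mapsI)
  show "(\<lambda>b. if b \<in> B then v b else \<zero>) \<in> carrier (free_mod R B)" if "v \<in> carrier (free_mod R A)" for v
  proof -
    have "{b. (if b \<in> B then v b else \<zero>) \<noteq> \<zero>} \<subseteq> {b. v b \<noteq> \<zero>}"
      by auto
    then show ?thesis
      using that by (auto simp: carrier_free_mod intro: finite_subset)
  qed
qed (auto simp: fun_eq_iff)

context proper_map_end_spaces
begin

text \<open>
  Each \<open>\<alpha> a\<close> is moved into \<open>f(T)\<close> within its component of \<open>T' - K\<^sub>n\<close>, where \<open>n\<close> is the largest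
  index in an exhaustion for which this component meets \<open>f(T)\<close>.
\<close>

lemma ex_close_lift:
  assumes ne: "topspace T \<noteq> {}" and \<alpha>: "\<alpha> \<in> A \<rightarrow> topspace T'"
    and near: "\<And>K. compactin T' K \<Longrightarrow> finite {a\<in>A. \<not> (\<exists>W\<in>pi0_compl T' K. \<alpha> a \<in> W \<and> W \<inter> f ` topspace T \<noteq> {})}"
  shows "\<exists>\<tau>. \<tau> \<in> A \<rightarrow> topspace T \<and> close_on T' A \<alpha> (\<lambda>a. f (\<tau> a))"
proof -
  obtain K :: "nat \<Rightarrow> 'c set" where K: "\<And>n. compactin T' (K n)" "incseq K" "\<And>C. compactin T' C \<Longrightarrow> \<exists>n. C \<subseteq> K n"
    using T'.ex_exhaustion by blast
  define P where "P a n \<longleftrightarrow> (\<exists>W\<in>pi0_compl T' (K n). \<alpha> a \<in> W \<and> W \<inter> f ` topspace T \<noteq> {})" for a n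
  have "\<exists>t\<in>topspace T. \<forall>n. P a n \<longrightarrow> (\<exists>W\<in>pi0_compl T' (K n). \<alpha> a \<in> W \<and> f t \<in> W)" if a: "a \<in> A" for a
  proof (cases "\<exists>n. P a n")
    case False
    \<comment> \<open>No component of \<alpha> a in the exhaustion meets the image, so nothing is
      demanded of the new position and any point of \<open>T\<close> serves.\<close>
    obtain t where "t \<in> topspace T"
      using ne by blast
    then show ?thesis
      using False by (intro bexI[of _ t]) simp_all
  next
    case True
    have "compactin T' {\<alpha> a}"
      using \<alpha> a by (intro finite_imp_compactin) auto
    then obtain m where m: "\<alpha> a \<in> K m"
      using K(3) by blast
    \<comment> \<open>A largest index exists because \<alpha> a itself eventually belongs to the
      exhausting sets and then lies in no component of their complements.\<close>
    have bound: "n \<le> m" if "P a n" for n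
    proof (rule ccontr)
      assume "\<not> n \<le> m"
      then have "\<alpha> a \<in> K n"
        using m incseqD[OF K(2), of m n] by auto
      then show False
        using \<open>P a n\<close> pi0_compl_subset[of _ T' "K n"] unfolding P_def by blast
    qed
    define N where "N = (GREATEST n. P a n)"
    have N: "P a N" "\<And>n. P a n \<Longrightarrow> n \<le> N"
      unfolding N_def using GreatestI_ex_nat[OF True] Greatest_le_nat[of "P a"] bound by blast+
    obtain W t where W: "W \<in> pi0_compl T' (K N)" "\<alpha> a \<in> W" "t \<in> topspace T" "f t \<in> W"
      using N(1) unfolding P_def by auto
    \<comment> \<open>The components containing \<alpha> a shrink as the index grows, so the point
      found for the largest index \<open>N\<close> also serves for every smaller one.\<close>
    have "\<exists>W\<in>pi0_compl T' (K n). \<alpha> a \<in> W \<and> f t \<in> W" if n: "P a n" for n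
    proof -
      obtain V where V: "V \<in> pi0_compl T' (K n)" "\<alpha> a \<in> V"
        using n unfolding P_def by blast
      have "W \<subseteq> V"
        by (rule pi0_compl_mono[OF incseqD[OF K(2) N(2)[OF n]] W(1) V(1) W(2) V(2)])
      then show ?thesis
        using V W(4) by blast
    qed
    then show ?thesis
      using W(3) by blast
  qed
  then have "\<forall>a\<in>A. \<exists>t. t \<in> topspace T \<and> (\<forall>n. P a n \<longrightarrow> (\<exists>W\<in>pi0_compl T' (K n). \<alpha> a \<in> W \<and> f t \<in> W))"
    by blast
  from bchoice[OF this] obtain \<tau> where \<tau>: "\<forall>a\<in>A. \<tau> a \<in> topspace T \<and>
      (\<forall>n. P a n \<longrightarrow> (\<exists>W\<in>pi0_compl T' (K n). \<alpha> a \<in> W \<and> f (\<tau> a) \<in> W))" ..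
  have "close_on T' A \<alpha> (\<lambda>a. f (\<tau> a))"
    unfolding close_on_def
  proof (intro allI impI)
    fix C assume C: "compactin T' C"
    obtain n where n: "C \<subseteq> K n"
      using K(3)[OF C] by blast
    have "\<exists>W\<in>pi0_compl T' C. \<alpha> a \<in> W \<and> f (\<tau> a) \<in> W" if a: "a \<in> A" "P a n" for a
    proof -
      obtain V where V: "V \<in> pi0_compl T' (K n)" "\<alpha> a \<in> V" "f (\<tau> a) \<in> V"
        using \<tau> a by blast
      obtain W where W: "W \<in> pi0_compl T' C" "\<alpha> a \<in> W"
        using pi0_compl_exists[of "\<alpha> a" T' C] pi0_compl_subset[OF V(1)] V(2) n by blast
      have "V \<subseteq> W"
        by (rule pi0_compl_mono[OF n V(1) W(1) V(2) W(2)])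
      then show ?thesis
        using V(3) W by blast
    qed
    then have "{a\<in>A. \<not> (\<exists>W\<in>pi0_compl T' C. \<alpha> a \<in> W \<and> f (\<tau> a) \<in> W)} \<subseteq> {a\<in>A. \<not> P a n}"
      by blast
    then show "finite {a\<in>A. \<not> (\<exists>W\<in>pi0_compl T' C. \<alpha> a \<in> W \<and> f (\<tau> a) \<in> W)}"
      by (rule finite_subset) (use near[OF K(1)] in \<open>simp add: P_def\<close>)
  qed
  then show ?thesis
    using \<tau> by (intro exI[of _ \<tau>]) auto
qed

lemma ctrl_ob_of_close:
  assumes \<tau>: "\<tau> \<in> A \<rightarrow> topspace T" and close: "close_on T' A \<alpha> (\<lambda>a. f (\<tau> a))"
  shows "(A, restrict \<tau> A) \<in> ctrl_ob T"
proof -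
  have "finite {a\<in>A. restrict \<tau> A a \<in> K}" if K: "compactin T K" for K
  proof -
    have fK: "compactin T' (f ` K)"
      using f by (intro image_compactin[OF K]) (simp add: proper_cont_def)
    have "a \<in> {a\<in>A. \<not> (\<exists>W\<in>pi0_compl T' (f ` K). \<alpha> a \<in> W \<and> f (\<tau> a) \<in> W)}" if a: "a \<in> A" "\<tau> a \<in> K" for a
      using a imageI[OF a(2), of f] pi0_compl_subset[of _ T' "f ` K"] by blast
    then have "{a\<in>A. restrict \<tau> A a \<in> K} \<subseteq> {a\<in>A. \<not> (\<exists>W\<in>pi0_compl T' (f ` K). \<alpha> a \<in> W \<and> f (\<tau> a) \<in> W)}"
      by auto
    then show ?thesis
      by (rule finite_subset) (use close fK in \<open>simp add: close_on_def\<close>)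
  qed
  then show ?thesis
    using \<tau> by (auto simp: T.ctrl_ob_iff)
qed

text \<open>Infinitely many exceptional indices would accumulate at an end \<epsilon> of
  \<open>T'\<close> whose component over \<open>K\<close> misses the image of \<open>f\<close>. No
  basis element of either target lies in that component, so control forces \<open>u1\<close> and
  \<open>u2\<close> to vanish on the basis elements near \<epsilon>, contrary to the choice of
  \<open>A0\<close>.\<close>

lemma finite_support_away:
  assumes ob: "(A, \<alpha>) \<in> ctrl_ob T'"
    and u1: "u1 \<in> ctrl_hom R T' (A, \<alpha>) (push (B1, \<beta>1))" and \<beta>1: "\<beta>1 \<in> B1 \<rightarrow> topspace T"
    and u2: "u2 \<in> ctrl_hom R T' (A, \<alpha>) (push (B2, \<beta>2))" and \<beta>2: "\<beta>2 \<in> B2 \<rightarrow> topspace T"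
    and A0: "A0 \<subseteq> {a\<in>A. u1 (basis_vec R a) \<noteq> (\<lambda>b. \<zero>\<^bsub>R\<^esub>) \<or> u2 (basis_vec R a) \<noteq> (\<lambda>b. \<zero>\<^bsub>R\<^esub>)}"
    and K: "compactin T' K"
  shows "finite {a\<in>A0. \<not> (\<exists>W\<in>pi0_compl T' K. \<alpha> a \<in> W \<and> W \<inter> f ` topspace T \<noteq> {})}" (is "finite ?I")
proof (rule ccontr)
  assume inf: "infinite ?I"
  have \<alpha>: "\<alpha> a \<in> topspace T'" "a \<in> A" if "a \<in> ?I" for a
  proof -
    show "a \<in> A"
      using that A0 by blast
    then show "\<alpha> a \<in> topspace T'"
      using ob unfolding T'.ctrl_ob_iff by (metis PiE)
  qed
  have "finite {a\<in>?I. \<alpha> a \<in> C}" if "compactin T' C" for C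
  proof (rule finite_subset)
    show "{a\<in>?I. \<alpha> a \<in> C} \<subseteq> {a\<in>A. \<alpha> a \<in> C}"
      using A0 by blast
    show "finite {a\<in>A. \<alpha> a \<in> C}"
      using ob that by (simp add: T'.ctrl_ob_iff)
  qed
  then have "\<exists>\<epsilon>\<in>ends T'. \<forall>C. compactin T' C \<longrightarrow> infinite {a\<in>?I. \<alpha> a \<in> \<epsilon> C}"
    by (intro T'.ex_end_accumulation inf \<alpha>(1))
  then obtain \<epsilon> where \<epsilon>: "\<epsilon> \<in> ends T'" "\<forall>C. compactin T' C \<longrightarrow> infinite {a\<in>?I. \<alpha> a \<in> \<epsilon> C}"
    by blast
  have ex: "\<exists>a\<in>?I. \<alpha> a \<in> \<epsilon> C" if "compactin T' C" for C
  proof -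
    have "{a\<in>?I. \<alpha> a \<in> \<epsilon> C} \<noteq> {}"
      using \<epsilon>(2) that by (metis (no_types, lifting) finite.emptyI)
    then show ?thesis
      by blast
  qed
  have disj: "\<epsilon> K \<inter> f ` topspace T = {}"
    using ex[OF K] ends_pi0[OF \<epsilon>(1) K] by blast
  have none: "{b\<in>B. compose B f \<beta> b \<in> \<epsilon> K} = {}" if "\<beta> \<in> B \<rightarrow> topspace T" for B and \<beta> :: "'b \<Rightarrow> 'a"
  proof -
    have "compose B f \<beta> b \<in> f ` topspace T" if b: "b \<in> B" for b
      using \<open>\<beta> \<in> _\<close> b by (auto simp: compose_eq)
    then show ?thesis
      using disj by blast
  qed
  have vanish: "\<exists>L. compactin T' L \<and> (\<forall>a\<in>A. \<alpha> a \<in> \<epsilon> L \<longrightarrow> u (basis_vec R a) = (\<lambda>b. \<zero>\<^bsub>R\<^esub>))"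
    if "u \<in> ctrl_hom R T' (A, \<alpha>) (push (B, \<beta>))" "\<beta> \<in> B \<rightarrow> topspace T" for u B and \<beta> :: "'b \<Rightarrow> 'a"
  proof -
    have "\<exists>L. compactin T' L \<and> (\<forall>a\<in>A. \<alpha> a \<in> \<epsilon> L \<longrightarrow>
        u (basis_vec R a) \<in> carrier (free_mod R {b\<in>B. compose B f \<beta> b \<in> \<epsilon> K}))"
      using that(1) \<epsilon>(1) K by (simp add: ctrl_hom_iff)
    note this[unfolded none[OF that(2)]]
    then obtain L where "compactin T' L" "\<forall>a\<in>A. \<alpha> a \<in> \<epsilon> L \<longrightarrow> u (basis_vec R a) \<in> carrier (free_mod R {})"
      by (elim exE conjE)
    then show ?thesis
      by (intro exI[of _ L] conjI ballI impI free_mod_empty[of _ R]) simp_all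
  qed
  obtain L1 where L1: "compactin T' L1" "\<forall>a\<in>A. \<alpha> a \<in> \<epsilon> L1 \<longrightarrow> u1 (basis_vec R a) = (\<lambda>b. \<zero>\<^bsub>R\<^esub>)"
    using vanish[OF u1 \<beta>1] by blast
  obtain L2 where L2: "compactin T' L2" "\<forall>a\<in>A. \<alpha> a \<in> \<epsilon> L2 \<longrightarrow> u2 (basis_vec R a) = (\<lambda>b. \<zero>\<^bsub>R\<^esub>)"
    using vanish[OF u2 \<beta>2] by blast
  note L = compactin_Un[OF L1(1) L2(1)]
  obtain a where a: "a \<in> ?I" "\<alpha> a \<in> \<epsilon> (L1 \<union> L2)"
    using ex[OF L] by blast
  then have "\<alpha> a \<in> \<epsilon> L1" "\<alpha> a \<in> \<epsilon> L2"
    using ends_antimono[OF \<epsilon>(1) L1(1) L] ends_antimono[OF \<epsilon>(1) L2(1) L] by auto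
  then have "u1 (basis_vec R a) = (\<lambda>b. \<zero>\<^bsub>R\<^esub>)" "u2 (basis_vec R a) = (\<lambda>b. \<zero>\<^bsub>R\<^esub>)"
    using L1(2) L2(2) \<alpha>(2)[OF a(1)] by simp_all
  moreover have "a \<in> {a\<in>A. u1 (basis_vec R a) \<noteq> (\<lambda>b. \<zero>\<^bsub>R\<^esub>) \<or> u2 (basis_vec R a) \<noteq> (\<lambda>b. \<zero>\<^bsub>R\<^esub>)}"
    by (rule subsetD[OF A0]) (use a(1) in simp)
  ultimately show False
    by simp
qed

end

text \<open>The retract is the free module on the union \<open>A0\<close> of the sets of basis
  elements not killed by \<open>u1\<close> or \<open>u2\<close>, placed in \<open>T\<close> by a
  lift close to \<alpha>. Projection and inclusion are controlled by closeness, and each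
  \<open>w\<close> is the restriction of the corresponding \<open>u\<close> to
  \<open>A0\<close>.\<close>

lemma (in proper_map_end_spaces) factorisation_through_push:
  fixes R :: "'r ring" and A :: "'b set"
  assumes R: "cring R" and ne: "topspace T \<noteq> {}" and inj: "inj_on (ends_map T T' f) (ends T)"
    and ob: "(A, \<alpha>) \<in> ctrl_ob T'" and ob1: "(B1, \<beta>1) \<in> ctrl_ob T" and ob2: "(B2, \<beta>2) \<in> ctrl_ob T"
    and u1: "u1 \<in> ctrl_hom R T' (A, \<alpha>) (push (B1, \<beta>1))" and u2: "u2 \<in> ctrl_hom R T' (A, \<alpha>) (push (B2, \<beta>2))"
  shows "\<exists>A0 \<alpha>0 p s w1 w2. (A0, \<alpha>0) \<in> ctrl_ob T \<and> p \<in> ctrl_hom R T' (A, \<alpha>) (push (A0, \<alpha>0)) \<and>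
    s \<in> ctrl_hom R T' (push (A0, \<alpha>0)) (A, \<alpha>) \<and>
    w1 \<in> ctrl_hom R T (A0, \<alpha>0) (B1, \<beta>1) \<and> w2 \<in> ctrl_hom R T (A0, \<alpha>0) (B2, \<beta>2) \<and>
    compose (carrier (free_mod R A0)) p s = (\<lambda>v\<in>carrier (free_mod R A0). v) \<and>
    u1 = compose (carrier (free_mod R A)) w1 p \<and> u2 = compose (carrier (free_mod R A)) w2 p"
proof -
  interpret coefficient_ring R
    by (simp add: coefficient_ring_def R)
  have \<alpha>: "\<alpha> \<in> A \<rightarrow> topspace T'" and \<beta>1: "\<beta>1 \<in> B1 \<rightarrow> topspace T" and \<beta>2: "\<beta>2 \<in> B2 \<rightarrow> topspace T"
    using ob ob1 ob2 by (auto simp: T.ctrl_ob_iff T'.ctrl_ob_iff)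
  define A0 where "A0 = {a\<in>A. u1 (basis_vec R a) \<noteq> (\<lambda>b. \<zero>\<^bsub>R\<^esub>) \<or> u2 (basis_vec R a) \<noteq> (\<lambda>b. \<zero>\<^bsub>R\<^esub>)}"
  have A0: "A0 \<subseteq> A"
    by (auto simp: A0_def)
  have "\<exists>\<tau>. \<tau> \<in> A0 \<rightarrow> topspace T \<and> close_on T' A0 \<alpha> (\<lambda>a. f (\<tau> a))"
  proof (rule ex_close_lift[OF ne])
    show "\<alpha> \<in> A0 \<rightarrow> topspace T'"
      using \<alpha> A0 by auto
  qed (rule finite_support_away[OF ob u1 \<beta>1 u2 \<beta>2 eq_refl[OF A0_def]])
  then obtain \<tau> where \<tau>: "\<tau> \<in> A0 \<rightarrow> topspace T" "close_on T' A0 \<alpha> (\<lambda>a. f (\<tau> a))"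
    by blast
  define \<alpha>0 where "\<alpha>0 = restrict \<tau> A0"
  have ob0: "(A0, \<alpha>0) \<in> ctrl_ob T"
    unfolding \<alpha>0_def by (rule ctrl_ob_of_close[OF \<tau>])
  have \<alpha>0: "\<alpha>0 \<in> A0 \<rightarrow> topspace T"
    using ob0 by (simp add: T.ctrl_ob_iff)
  have close: "close_on T' A0 \<alpha> (compose A0 f \<alpha>0)"
    using \<tau>(2) by (subst close_on_cong[of _ _ "\<lambda>a. f (\<tau> a)"]) (simp_all add: compose_eq \<alpha>0_def)
  define p where "p = (\<lambda>v\<in>carrier (free_mod R A). \<lambda>b. if b \<in> A0 then v b else \<zero>\<^bsub>R\<^esub>)"
  define s where "s = (\<lambda>v\<in>carrier (free_mod R A0). v)"
  have p_basis: "p (basis_vec R a) = (if a \<in> A0 then basis_vec R a else (\<lambda>b. \<zero>\<^bsub>R\<^esub>))" if "a \<in> A" for a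
    using that by (auto simp: p_def basis_vec_closed) (auto simp: basis_vec_def fun_eq_iff)
  have p: "p \<in> ctrl_hom R T' (A, \<alpha>) (push (A0, \<alpha>0))"
    unfolding prod.case
    by (rule ctrl_hom_of_close[OF projection_linear[where A = A and B = A0, folded p_def] A0 order_refl \<alpha> close p_basis])
  have s: "s \<in> ctrl_hom R T' (push (A0, \<alpha>0)) (A, \<alpha>)"
    unfolding prod.case
  proof (rule ctrl_hom_of_close[OF _ order_refl A0 _ close_on_sym[OF close]])
    show "s \<in> linear_maps R (free_mod R A0) (free_mod R A)"
      unfolding s_def by (rule inclusion_linear[OF A0])
    show "compose A0 f \<alpha>0 \<in> A0 \<rightarrow> topspace T'"
      using push_closed[OF ob0] by (simp add: T'.ctrl_ob_iff)
  qed (simp add: s_def basis_vec_closed)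
  have ps: "compose (carrier (free_mod R A0)) p s = (\<lambda>v\<in>carrier (free_mod R A0). v)"
    unfolding compose_def
  proof (rule restrict_ext)
    fix v assume v: "v \<in> carrier (free_mod R A0)"
    then have "v \<in> carrier (free_mod R A)"
      using free_mod_mono[OF A0] by blast
    then show "p (s v) = v"
      using v by (auto simp: p_def s_def carrier_free_mod)
  qed
  have w: "compose (carrier (free_mod R A0)) u s \<in> ctrl_hom R T (A0, \<alpha>0) (B, \<beta>) \<and>
      u = compose (carrier (free_mod R A)) (compose (carrier (free_mod R A0)) u s) p"
    if u: "u \<in> ctrl_hom R T' (A, \<alpha>) (push (B, \<beta>))" and \<beta>: "\<beta> \<in> B \<rightarrow> topspace T"
      and zero: "\<And>a. \<lbrakk>a \<in> A; a \<notin> A0\<rbrakk> \<Longrightarrow> u (basis_vec R a) = (\<lambda>b. \<zero>\<^bsub>R\<^esub>)" for u B and \<beta> :: "'b \<Rightarrow> 'a"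
  proof
    let ?w = "compose (carrier (free_mod R A0)) u s"
    have "?w \<in> ctrl_hom R T' (push (A0, \<alpha>0)) (push (B, \<beta>))"
      using ctrl_Comp_closed s u by simp
    \<comment> \<open>The restriction is at first controlled only over \<open>T'\<close>; fullness
      of the change of tree brings it back to \<open>T\<close>.\<close>
    then show "?w \<in> ctrl_hom R T (A0, \<alpha>0) (B, \<beta>)"
      by (intro ctrl_hom_pull[OF inj \<alpha>0 \<beta>]) simp
    have lu: "u \<in> linear_maps R (free_mod R A) (free_mod R B)"
      and lw: "?w \<in> linear_maps R (free_mod R A0) (free_mod R B)"
      and lp: "p \<in> linear_maps R (free_mod R A) (free_mod R A0)"
      using u \<open>?w \<in> ctrl_hom R T' _ _\<close> p by (simp_all add: ctrl_hom_iff)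
    show "u = compose (carrier (free_mod R A)) ?w p"
    proof (rule linear_maps_eqI[OF lu linear_maps_compose[OF lp lw]])
      fix a assume a: "a \<in> A"
      show "u (basis_vec R a) = compose (carrier (free_mod R A)) ?w p (basis_vec R a)"
      proof (cases "a \<in> A0")
        case True
        then show ?thesis
          using a by (simp add: compose_eq basis_vec_closed p_basis s_def)
      next
        case False
        then show ?thesis
          using a zero linear_maps_zero[OF lw] by (simp add: compose_eq[OF basis_vec_closed[OF a]] p_basis)
      qed
    qed
  qed
  have "u1 (basis_vec R a) = (\<lambda>b. \<zero>\<^bsub>R\<^esub>)" "u2 (basis_vec R a) = (\<lambda>b. \<zero>\<^bsub>R\<^esub>)" if "a \<in> A" "a \<notin> A0" for a
    using that by (auto simp: A0_def)
  note w1 = w[OF u1 \<beta>1 this(1)] and w2 = w[OF u2 \<beta>2 this(2)]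
  show ?thesis
    by (rule exI[of _ A0], rule exI[of _ \<alpha>0], rule exI[of _ p], rule exI[of _ s],
        rule exI[of _ "compose (carrier (free_mod R A0)) u1 s"], rule exI[of _ "compose (carrier (free_mod R A0)) u2 s"])
      (intro conjI ob0 p s ps conjunct1[OF w1] conjunct1[OF w2] conjunct2[OF w1] conjunct2[OF w2])
qed

section \<open>The change of tree as a cofinal system of retracts, and smallness\<close>

lemma (in proper_map_end_spaces) retract_cofinal_push:
  fixes R :: "'r ring"
  assumes R: "cring R" and ne: "topspace T \<noteq> {}" and inj: "inj_on (ends_map T T' f) (ends T)"
  shows "retract_cofinal (ctrl_cat R T' :: ('b set \<times> ('b \<Rightarrow> 'c), ('b \<Rightarrow> 'r) \<Rightarrow> ('b \<Rightarrow> 'r)) preadd_cat)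
    (ctrl_cat R T) push"
proof -
  interpret coefficient_ring R
    by (simp add: coefficient_ring_def R)
  have ob: "\<alpha> \<in> A \<rightarrow> topspace T" if "(A, \<alpha>) \<in> ctrl_ob T" for A :: "'b set" and \<alpha>
    using that by (simp add: T.ctrl_ob_iff)
  show ?thesis
  proof (rule retract_cofinal.intro[OF preadditive_ctrl_cat retract_cofinal_axioms.intro])
    fix X :: "'b set \<times> ('b \<Rightarrow> 'a)"
    assume "X \<in> Ob (ctrl_cat R T)"
    then show "push X \<in> Ob (ctrl_cat R T')"
      using push_closed by (simp add: ctrl_cat_simps)
  next
    fix X Y :: "'b set \<times> ('b \<Rightarrow> 'a)"
    assume *: "X \<in> Ob (ctrl_cat R T)" "Y \<in> Ob (ctrl_cat R T)"
    obtain A \<alpha> B \<beta> where XY: "X = (A, \<alpha>)" "Y = (B, \<beta>)"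
      by (cases X, cases Y)
    note ob = ob[OF *(1)[unfolded XY ctrl_cat_simps]] ob[OF *(2)[unfolded XY ctrl_cat_simps]]
    show "Hom (ctrl_cat R T) X Y = Hom (ctrl_cat R T') (push X) (push Y)"
      unfolding ctrl_cat_simps XY prod.case
    proof (intro equalityI subsetI)
      show "\<phi> \<in> ctrl_hom R T' (A, compose A f \<alpha>) (B, compose B f \<beta>)" if "\<phi> \<in> ctrl_hom R T (A, \<alpha>) (B, \<beta>)" for \<phi>
        by (rule ctrl_hom_push[OF ob that])
      show "\<phi> \<in> ctrl_hom R T (A, \<alpha>) (B, \<beta>)" if "\<phi> \<in> ctrl_hom R T' (A, compose A f \<alpha>) (B, compose B f \<beta>)" for \<phi>
        by (rule ctrl_hom_pull[OF inj ob that])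
    qed
  next
    fix X Y Z :: "'b set \<times> ('b \<Rightarrow> 'a)"
    show "Comp (ctrl_cat R T) X Y Z = Comp (ctrl_cat R T') (push X) (push Y) (push Z)"
      by (cases X) (simp add: fun_eq_iff ctrl_cat_simps)
    show "Ident (ctrl_cat R T) X = Ident (ctrl_cat R T') (push X)"
      by (cases X) (simp add: ctrl_cat_simps)
    show "Add (ctrl_cat R T) X Y = Add (ctrl_cat R T') (push X) (push Y)"
      by (cases X, cases Y) (simp add: fun_eq_iff ctrl_cat_simps)
  next
    fix X' :: "'b set \<times> ('b \<Rightarrow> 'c)" and X1 X2 :: "'b set \<times> ('b \<Rightarrow> 'a)" and u1 u2
    assume *: "X' \<in> Ob (ctrl_cat R T')" "X1 \<in> Ob (ctrl_cat R T)" "X2 \<in> Ob (ctrl_cat R T)"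
      "u1 \<in> Hom (ctrl_cat R T') X' (push X1)" "u2 \<in> Hom (ctrl_cat R T') X' (push X2)"
    obtain A \<alpha> B1 \<beta>1 B2 \<beta>2 where X: "X' = (A, \<alpha>)" "X1 = (B1, \<beta>1)" "X2 = (B2, \<beta>2)"
      by (cases X', cases X1, cases X2)
    obtain A0 \<alpha>0 p s w1 w2 where **: "(A0, \<alpha>0) \<in> ctrl_ob T"
      "p \<in> ctrl_hom R T' (A, \<alpha>) (push (A0, \<alpha>0))" "s \<in> ctrl_hom R T' (push (A0, \<alpha>0)) (A, \<alpha>)"
      "w1 \<in> ctrl_hom R T (A0, \<alpha>0) (B1, \<beta>1)" "w2 \<in> ctrl_hom R T (A0, \<alpha>0) (B2, \<beta>2)"
      "compose (carrier (free_mod R A0)) p s = (\<lambda>v\<in>carrier (free_mod R A0). v)"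
      "u1 = compose (carrier (free_mod R A)) w1 p" "u2 = compose (carrier (free_mod R A)) w2 p"
      using factorisation_through_push[OF R ne inj *[unfolded X ctrl_cat_simps]] by (elim exE conjE)
    show "\<exists>X\<in>Ob (ctrl_cat R T). \<exists>p\<in>Hom (ctrl_cat R T') X' (push X). \<exists>s\<in>Hom (ctrl_cat R T') (push X) X'.
        \<exists>w1\<in>Hom (ctrl_cat R T) X X1. \<exists>w2\<in>Hom (ctrl_cat R T) X X2.
          Comp (ctrl_cat R T') (push X) X' (push X) p s = Ident (ctrl_cat R T') (push X) \<and>
          u1 = Comp (ctrl_cat R T') X' (push X) (push X1) w1 p \<and>
          u2 = Comp (ctrl_cat R T') X' (push X) (push X2) w2 p"
      unfolding ctrl_cat_simps X
      by (rule bexI[OF _ **(1)], rule bexI[OF _ **(2)], rule bexI[OF _ **(3)], rule bexI[OF _ **(4)],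
          rule bexI[OF _ **(5)])
        (use **(6-8) in \<open>simp add: ctrl_cat_simps\<close>)
  next
    fix X' :: "'b set \<times> ('b \<Rightarrow> 'c)"
    assume X': "X' \<in> Ob (ctrl_cat R T')"
    obtain A \<alpha> where X'_eq: "X' = (A, \<alpha>)"
      by (cases X')
    \<comment> \<open>The zero object, free on the empty basis, receives the zero map from every
      object.\<close>
    let ?X = "({}, \<lambda>_. undefined) :: 'b set \<times> ('b \<Rightarrow> 'a)"
    let ?u = "\<lambda>v\<in>carrier (free_mod R A). \<lambda>b. \<zero>\<^bsub>R\<^esub>"
    have "?u \<in> ctrl_hom R T' (A, \<alpha>) (push ?X)"
      unfolding prod.case
    proof (rule ctrl_hom_of_close[where M = "{}"])
      show "?u \<in> linear_maps R (free_mod R A) (free_mod R {})"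
        by (rule linear_mapsI) (simp_all add: free_zero_closed)
      show "\<alpha> \<in> A \<rightarrow> topspace T'"
        using X' by (simp add: X'_eq ctrl_cat_simps T'.ctrl_ob_iff)
    qed (simp_all add: close_on_def basis_vec_closed)
    moreover have "?X \<in> ctrl_ob T"
      by (simp add: T.ctrl_ob_iff)
    ultimately show "\<exists>X\<in>Ob (ctrl_cat R T). \<exists>u. u \<in> Hom (ctrl_cat R T') X' (push X)"
      unfolding ctrl_cat_simps X'_eq by (intro bexI[of _ ?X] exI[of _ ?u])
  qed
qed

text \<open>One-element bases placed at a fixed point of \<open>T\<close> form a family of objects
  indexed by the infinite type \<open>'b\<close>. Smallness then forces \<open>'g\<close> to be
  infinite.\<close>

lemma infinite_ctrl_ob:
  assumes "end_space T" "topspace T \<noteq> {}" "infinite (UNIV :: 'b set)"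
  shows "infinite (ctrl_ob T :: ('b set \<times> ('b \<Rightarrow> 'a)) set)"
proof -
  interpret end_space T by fact
  obtain t where t: "t \<in> topspace T"
    using assms(2) by blast
  let ?g = "\<lambda>b::'b. ({b}, \<lambda>x\<in>{b}. t)"
  have "range ?g \<subseteq> ctrl_ob T"
    using t by (auto simp: ctrl_ob_iff)
  moreover have "inj ?g"
    by (rule injI) simp
  then have "infinite (range ?g)"
    using assms(3) finite_imageD by blast
  ultimately show ?thesis
    using infinite_super by blast
qed

theorem proposition1p2p13:
  fixes R :: "'r ring" and T :: "'a topology" and T' :: "'c topology" and f :: "'a \<Rightarrow> 'c"
    and L :: "(('b set \<times> ('b \<Rightarrow> 'a), ('b \<Rightarrow> 'r) \<Rightarrow> ('b \<Rightarrow> 'r), 'g) cmod,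
               'b set \<times> ('b \<Rightarrow> 'a) \<Rightarrow> 'g \<Rightarrow> 'g,
               ('b set \<times> ('b \<Rightarrow> 'c), ('b \<Rightarrow> 'r) \<Rightarrow> ('b \<Rightarrow> 'r), 'g) cmod,
               'b set \<times> ('b \<Rightarrow> 'c) \<Rightarrow> 'g \<Rightarrow> 'g) functor_data"
  assumes "cring R"
    and "tree T" and "tree T'"
    and "proper_cont T T' f"
    and "inj_on (ends_map T T' f) (ends T)"
    and "infinite (UNIV :: 'b set)"
    and "small_in (UNIV :: 'g set)
          (ctrl_cat R T :: ('b set \<times> ('b \<Rightarrow> 'a), ('b \<Rightarrow> 'r) \<Rightarrow> ('b \<Rightarrow> 'r)) preadd_cat)"
    and "small_in (UNIV :: 'g set)
          (ctrl_cat R T' :: ('b set \<times> ('b \<Rightarrow> 'c), ('b \<Rightarrow> 'r) \<Rightarrow> ('b \<Rightarrow> 'r)) preadd_cat)"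
    and "left_adjoint (mod_cat (ctrl_cat R T)) (mod_cat (ctrl_cat R T')) L
          (precomp (ctrl_cat R T) (change_of_tree f))"
  shows "exact_functor (ctrl_cat R T) (ctrl_cat R T') L"
proof -
  let ?C = "ctrl_cat R T :: ('b set \<times> ('b \<Rightarrow> 'a), ('b \<Rightarrow> 'r) \<Rightarrow> ('b \<Rightarrow> 'r)) preadd_cat"
  let ?D = "ctrl_cat R T' :: ('b set \<times> ('b \<Rightarrow> 'c), ('b \<Rightarrow> 'r) \<Rightarrow> ('b \<Rightarrow> 'r)) preadd_cat"
  note es = tree_end_space[OF assms(2)] tree_end_space[OF assms(3)]
  interpret F: proper_map_end_spaces T T' f
    by (intro proper_map_end_spaces.intro es proper_map_end_spaces_axioms.intro assms(4))
  have cofinal: "retract_cofinal ?D ?C F.push"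
    by (rule F.retract_cofinal_push[OF assms(1) tree_nonempty[OF assms(2)] assms(5)])
  have G: "change_of_tree f = \<lparr>on_ob = F.push, on_hom = (\<lambda>_ _ u. u)\<rparr>"
    by (simp add: change_of_tree_def)
  \<comment> \<open>Needed for the cardinality estimate behind injectivity of the unit; the
    infinitely many objects over \<open>T\<close> inject into \<open>'g\<close>.\<close>
  have "infinite (UNIV :: 'g set)"
  proof
    assume "finite (UNIV :: 'g set)"
    moreover have "Ob ?C \<lesssim> (UNIV :: 'g set)"
      using assms(7) by (simp add: small_in_def)
    ultimately have "finite (Ob ?C)"
      unfolding lepoll_def by (metis inj_on_finite)
    then show False
      using infinite_ctrl_ob[OF es(1) tree_nonempty[OF assms(2)] assms(6)] by (simp add: ctrl_cat_simps)
  qed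
  then show ?thesis
    by (rule retract_cofinal.exact_left_adjoint[OF cofinal assms(9)[unfolded G]])
      (use assms(7,8) in \<open>simp_all add: small_in_def\<close>)
qed

end
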